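(* Let $k$ be a field of characteristic zero and let $C$ be an $n$-cyclic coassociative DG coalgebra over $k$ with pairing $\langle-,-\rangle$. Let $\boldsymbol{\Omega}(C)$ be its cobar construction, and define $\{\!\{-,-\}\!\}:\boldsymbol{\Omega}(C)\otimes\boldsymbol{\Omega}(C)\to\boldsymbol{\Omega}(C)\otimes\boldsymbol{\Omega}(C)$ on $v=(v_1,\dots,v_p)$ and $w=(w_1,\dots,w_m)$ by $$\{\!\{v,w\}\!\}:=\sum_{i=1}^{p}\sum_{j=1}^{m}\pm\langle v_i,w_j\rangle\,(w_1,\dots,w_{j-1},v_{i+1},\dots,v_p)\otimes(v_1,\dots,v_{i-1},w_{j+1},\dots,w_m),$$ where the signs are those determined by the Koszul rule. Then this bracket gives a double $(n+2)$-Poisson structure on the DG algebra $\boldsymbol{\Omega}(C)$.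
   Context: **Cyclic DG coalgebras.** For an element $v$ of a coalgebra write $\Delta(v)=v'\otimes v''$ (Sweedler notation, sum suppressed). An $n$-cyclic DG coalgebra is a coassociative (not necessarily counital) DG coalgebra $(C,\Delta,d)$ with a graded symmetric bilinear pairing $\langle-,-\rangle:C\otimes C\to k$ of degree $n$ such that, for all $v,w\in C$, $$\langle v',w\rangle\,v''=\pm\langle v,w''\rangle\,w',\qquad \langle dv,w\rangle\pm\langle v,dw\rangle=0.$$ All signs $\pm$ here are those determined by the Koszul rule. **Cobar construction.** $\boldsymbol{\Omega}(C)$ is the DG algebra whose underlying graded algebra is the tensor algebra $T(C[-1])$, where $C[-1]$ is $C$ with degrees lowered by $1$. Its elements are spanned by tuples $(v_1,\dots,v_p)$ with $v_i\in C$; the empty tuple is $1$ and multiplication is concatenation. Its differential $\partial$ is the derivation with $\partial v=dv\pm(v',v'')$ on generators $v\in C$. **Double Poisson DG algebras.** Let $A$ be a DG algebra. The outer bimodule structure on $A\otimes A$ is $a\cdot(u\otimes v)\cdot b=au\otimes vb$. A double bracket of degree $N$ on $A$ is a bilinear map $\{\!\{-,-\}\!\}:A\otimes A\to A\otimes A$, of degree $N$ and compatible with the differential, which is a graded derivation of degree $N$ in its second argument for the outer bimodule structure and satisfies $\{\!\{a,b\}\!\}=-(-1)^{(|a|+N)(|b|+N)}\{\!\{b,a\}\!\}^\circ$, where $(u\otimes v)^\circ=(-1)^{|u||v|}v\otimes u$. Compatibility with the differential means $\partial\{\!\{a,b\}\!\}=\{\!\{\partial a,b\}\!\}\pm\{\!\{a,\partial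 b\}\!\}$. Put $\{\!\{a,b_1\otimes\cdots\otimes b_r\}\!\}_L:=\{\!\{a,b_1\}\!\}\otimes b_2\otimes\cdots\otimes b_r$. For $s\in S_r$ put $\sigma_s(b_1\otimes\cdots\otimes b_r):=(-1)^tb_{s^{-1}(1)}\otimes\cdots\otimes b_{s^{-1}(r)}$ with $t=\sum_{i<j,\ s^{-1}(i)>s^{-1}(j)}|b_{s^{-1}(i)}||b_{s^{-1}(j)}|$. $A$ is a double $N$-Poisson algebra if in addition the double Jacobi identity holds for all homogeneous $a,b,c$: $$\{\!\{a,\{\!\{b,c\}\!\}\}\!\}_L+(-1)^{(|a|+N)(|b|+|c|)}\sigma_{(123)}\{\!\{b,\{\!\{c,a\}\!\}\}\!\}_L+(-1)^{(|c|+N)(|a|+|b|)}\sigma_{(132)}\{\!\{c,\{\!\{a,b\}\!\}\}\!\}_L=0.$$ *)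

theory Defs
  imports
    Complex_Main
    "HOL-Library.Function_Algebras"
    "HOL-Combinatorics.Cycles"
begin

section \<open>Graded vector spaces\<close>

text \<open>
  A graded vector space is given by its homogeneous components, which are subspaces of an ambient
  type.  Its underlying vector space is their (direct) sum and need not exhaust the type.
  All gradings are homological: differentials have degree \<open>-1\<close>.
\<close>

record ('k, 'v) gspace =
  scl :: "'k \<Rightarrow> 'v \<Rightarrow> 'v"
  hcomp :: "int \<Rightarrow> 'v set"

abbreviation ksign :: "int \<Rightarrow> 'k::field"
  where "ksign e \<equiv> (- 1) powi e"

definition homog :: "('k::field, 'v::ab_group_add, 'z) gspace_scheme \<Rightarrow> 'v set"
  where "homog V = (\<Union>i. hcomp V i)"

definition carr :: "('k::field, 'v::ab_group_add, 'z) gspace_scheme \<Rightarrow> 'v set"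
  where "carr V = module.span (scl V) (homog V)"

text \<open>
  The degree of a homogeneous element.  It is arbitrary at \<open>0\<close>; below it only enters signs of
  terms that vanish when one of the vectors involved is \<open>0\<close>.
\<close>

definition deg :: "('k::field, 'v::ab_group_add, 'z) gspace_scheme \<Rightarrow> 'v \<Rightarrow> int"
  where "deg V x = (SOME i. x \<in> hcomp V i)"

definition wdeg :: "('k::field, 'v::ab_group_add, 'z) gspace_scheme \<Rightarrow> 'v list \<Rightarrow> int"
  where "wdeg V xs = (\<Sum>x\<leftarrow>xs. deg V x)"

locale graded_space =
  fixes V :: "('k::field, 'v::ab_group_add, 'z) gspace_scheme"
  assumes vector_space: "vector_space (scl V)"
    and comp_subspace: "module.subspace (scl V) (hcomp V i)"
    and comp_independent:
      "\<lbrakk>\<And>i. x i \<in> hcomp V i; finite {i. x i \<noteq> 0}; (\<Sum>i | x i \<noteq> 0. x i) = 0\<rbrakk> \<Longrightarrow> x i = 0"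

definition ground :: "('k::field, 'k) gspace"
  where "ground = \<lparr>scl = (*), hcomp = (\<lambda>i. if i = 0 then UNIV else {0})\<rparr>"

text \<open>The space \<open>V[-1]\<close>: degrees are lowered by one.\<close>

definition desusp :: "('k::field, 'v::ab_group_add, 'z) gspace_scheme \<Rightarrow> ('k, 'v) gspace"
  where "desusp V = \<lparr>scl = scl V, hcomp = (\<lambda>i. hcomp V (i + 1))\<rparr>"

definition linear_map ::
  "('k::field, 'v::ab_group_add, 'y) gspace_scheme \<Rightarrow> ('k, 'w::ab_group_add, 'z) gspace_scheme \<Rightarrow>
   ('v \<Rightarrow> 'w) \<Rightarrow> bool"
  where "linear_map V W f \<longleftrightarrow>
    (\<forall>x\<in>carr V. f x \<in> carr W) \<and>
    (\<forall>x\<in>carr V. \<forall>y\<in>carr V. f (x + y) = f x + f y) \<and>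
    (\<forall>c. \<forall>x\<in>carr V. f (scl V c x) = scl W c (f x))"

definition has_degree ::
  "('k::field, 'v::ab_group_add, 'y) gspace_scheme \<Rightarrow> ('k, 'w::ab_group_add, 'z) gspace_scheme \<Rightarrow>
   int \<Rightarrow> ('v \<Rightarrow> 'w) \<Rightarrow> bool"
  where "has_degree V W m f \<longleftrightarrow> (\<forall>i. \<forall>x\<in>hcomp V i. f x \<in> hcomp W (i + m))"

definition bilinear_map ::
  "('k::field, 'u::ab_group_add, 'x) gspace_scheme \<Rightarrow> ('k, 'v::ab_group_add, 'y) gspace_scheme \<Rightarrow>
   ('k, 'w::ab_group_add, 'z) gspace_scheme \<Rightarrow> ('u \<Rightarrow> 'v \<Rightarrow> 'w) \<Rightarrow> bool"
  where "bilinear_map U V W f \<longleftrightarrow>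
    (\<forall>x\<in>carr U. linear_map V W (f x)) \<and> (\<forall>y\<in>carr V. linear_map U W (\<lambda>x. f x y))"

definition has_bidegree ::
  "('k::field, 'u::ab_group_add, 'x) gspace_scheme \<Rightarrow> ('k, 'v::ab_group_add, 'y) gspace_scheme \<Rightarrow>
   ('k, 'w::ab_group_add, 'z) gspace_scheme \<Rightarrow> int \<Rightarrow> ('u \<Rightarrow> 'v \<Rightarrow> 'w) \<Rightarrow> bool"
  where "has_bidegree U V W m f \<longleftrightarrow>
    (\<forall>i j. \<forall>x\<in>hcomp U i. \<forall>y\<in>hcomp V j. f x y \<in> hcomp W (i + j + m))"


section \<open>Tensors\<close>

text \<open>
  Over a field, \<open>V\<^sup>\<otimes>\<^sup>r\<close> embeds into the dual of the space of multilinear forms on \<open>V\<^sup>r\<close>.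
  We take the image as the definition: the tensor \<open>x\<^sub>1 \<otimes> \<dots> \<otimes> x\<^sub>r\<close> is evaluation of
  multilinear forms at \<open>[x\<^sub>1, \<dots>, x\<^sub>r]\<close>.  Forms on lists of all lengths together give
  the tensor algebra \<open>T(V)\<close>, which contains every \<open>V\<^sup>\<otimes>\<^sup>r\<close>.
\<close>

type_synonym ('k, 'v) tensor = "('v list \<Rightarrow> 'k) \<Rightarrow> 'k"

definition tscale :: "'k::field \<Rightarrow> ('k, 'v) tensor \<Rightarrow> ('k, 'v) tensor"
  where "tscale c x = (\<lambda>f. c * x f)"

definition multilinear_form ::
  "('k::field, 'v::ab_group_add, 'z) gspace_scheme \<Rightarrow> ('v list \<Rightarrow> 'k) \<Rightarrow> bool"
  where "multilinear_form V f \<longleftrightarrow>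
    (\<forall>us\<in>lists (carr V). \<forall>ws\<in>lists (carr V). \<forall>x\<in>carr V.
      (\<forall>y\<in>carr V. f (us @ (x + y) # ws) = f (us @ x # ws) + f (us @ y # ws)) \<and>
      (\<forall>c. f (us @ scl V c x # ws) = c * f (us @ x # ws)))"

definition word :: "('k::field, 'v::ab_group_add, 'z) gspace_scheme \<Rightarrow> 'v list \<Rightarrow> ('k, 'v) tensor"
  where "word V xs = (\<lambda>f. if multilinear_form V f then f xs else 0)"

definition tensor_algebra ::
  "('k::field, 'v::ab_group_add, 'z) gspace_scheme \<Rightarrow> ('k, ('k, 'v) tensor) gspace"
  where "tensor_algebra V = \<lparr>scl = tscale,
    hcomp = (\<lambda>i. module.span tscale
      {word V xs | xs ds. list_all2 (\<lambda>x d. x \<in> hcomp V d) xs ds \<and> sum_list ds = i})\<rparr>"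

definition tensor_power ::
  "nat \<Rightarrow> ('k::field, 'v::ab_group_add, 'z) gspace_scheme \<Rightarrow> ('k, ('k, 'v) tensor) gspace"
  where "tensor_power r V = \<lparr>scl = tscale,
    hcomp = (\<lambda>i. module.span tscale
      {word V xs | xs ds. length xs = r \<and> list_all2 (\<lambda>x d. x \<in> hcomp V d) xs ds \<and>
        sum_list ds = i})\<rparr>"

text \<open>
  Linear extension to \<open>T(V)\<close> of a map given on tensors of homogeneous elements, by a formula
  that is multilinear within each multidegree.
\<close>

definition lift ::
  "('k::field, 'v::ab_group_add, 'z) gspace_scheme \<Rightarrow> ('k \<Rightarrow> 'w::ab_group_add \<Rightarrow> 'w) \<Rightarrow>
   ('v list \<Rightarrow> 'w) \<Rightarrow> ('k, 'v) tensor \<Rightarrow> 'w"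
  where "lift V s \<phi> x = (THE y. \<exists>S c. finite S \<and> S \<subseteq> lists (homog V) \<and>
    x = (\<Sum>xs\<in>S. tscale (c xs) (word V xs)) \<and> y = (\<Sum>xs\<in>S. s (c xs) (\<phi> xs)))"

text \<open>
  \<open>lift\<close> is well defined: \<open>\<phi>\<close> may be any map on lists of homogeneous elements that is linear
  in each entry as long as this entry stays within one component.
\<close>

definition multihomogeneous ::
  "('k::field, 'v::ab_group_add, 'z) gspace_scheme \<Rightarrow> ('k \<Rightarrow> 'w::ab_group_add \<Rightarrow> 'w) \<Rightarrow>
   ('v list \<Rightarrow> 'w) \<Rightarrow> bool"
  where "multihomogeneous V s \<phi> \<longleftrightarrow>
    (\<forall>us\<in>lists (homog V). \<forall>ws\<in>lists (homog V). \<forall>i. \<forall>x\<in>hcomp V i.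
      (\<forall>y\<in>hcomp V i. \<phi> (us @ (x + y) # ws) = \<phi> (us @ x # ws) + \<phi> (us @ y # ws)) \<and>
      (\<forall>c. \<phi> (us @ scl V c x # ws) = s c (\<phi> (us @ x # ws))))"

lemma vector_space_ground: "vector_space ((*) :: 'k::field \<Rightarrow> 'k \<Rightarrow> 'k)"
  by unfold_locales (simp_all add: algebra_simps)

lemma vector_space_tscale: "vector_space (tscale :: 'k::field \<Rightarrow> ('k, 'v) tensor \<Rightarrow> _)"
  by unfold_locales (simp_all add: tscale_def fun_eq_iff algebra_simps)

lemma sum_difference:
  fixes \<psi> :: "'i \<Rightarrow> 'x::ab_group_add"
  assumes t: "vector_space t" and S: "finite S" "finite S'"
  shows "(\<Sum>i\<in>S \<union> S'. t ((if i \<in> S then c i else 0) - (if i \<in> S' then c' i else 0)) (\<psi> i)) =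
    (\<Sum>i\<in>S. t (c i) (\<psi> i)) - (\<Sum>i\<in>S'. t (c' i) (\<psi> i))"
proof -
  interpret t: vector_space t by (rule t)
  have "(\<Sum>i\<in>S \<union> S'. t (if i \<in> S then c i else 0) (\<psi> i)) = (\<Sum>i\<in>S. t (c i) (\<psi> i))"
    by (rule sum.mono_neutral_cong_right) (use S in auto)
  moreover have "(\<Sum>i\<in>S \<union> S'. t (if i \<in> S' then c' i else 0) (\<psi> i)) = (\<Sum>i\<in>S'. t (c' i) (\<psi> i))"
    by (rule sum.mono_neutral_cong_right) (use S in auto)
  ultimately show ?thesis
    by (simp add: t.scale_left_diff_distrib sum_subtractf)
qed

context graded_space
begin

interpretation V: vector_space "scl V"
  by (rule vector_space)

interpretation VK: vector_space_pair "scl V" "(*) :: 'k \<Rightarrow> 'k \<Rightarrow> 'k"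
  by (intro vector_space_pair.intro vector_space vector_space_ground)

primrec form_extend :: "'v set \<Rightarrow> 'v list \<Rightarrow> ('v list \<Rightarrow> 'k) \<Rightarrow> 'k" where
  "form_extend B [] g = g []"
| "form_extend B (x # xs) g = VK.construct B (\<lambda>b. form_extend B xs (\<lambda>ys. g (b # ys))) x"

lemma form_extend_add:
  assumes B: "V.independent B"
  shows "form_extend B (us @ (x + y) # ws) g =
    form_extend B (us @ x # ws) g + form_extend B (us @ y # ws) g"
proof (induction us arbitrary: g)
  case Nil
  then show ?case
    using VK.linear_construct[OF B] by (simp add: VK.linear_add)
next
  case (Cons u us)
  then show ?case
    by (simp add: VK.construct_add[OF B])
qed

lemma form_extend_scale:
  assumes B: "V.independent B"
  shows "form_extend B (us @ scl V c x # ws) g = c * form_extend B (us @ x # ws) g"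
proof (induction us arbitrary: g)
  case Nil
  then show ?case
    using VK.linear_construct[OF B] by (simp add: VK.linear_scale)
next
  case (Cons u us)
  then show ?case
    by (simp add: VK.construct_scale[OF B])
qed

lemma homogeneous_basis_expansion:
  assumes BH: "B \<subseteq> homog V" and span: "homog V \<subseteq> V.span B" and x: "x \<in> hcomp V i"
  obtains T r where "finite T" "T \<subseteq> B \<inter> hcomp V i" "x = (\<Sum>b\<in>T. scl V (r b) b)"
proof -
  have "x \<in> V.span B"
    using x span by (auto simp: homog_def)
  then obtain T r where T: "finite T" "T \<subseteq> B" "x = (\<Sum>b\<in>T. scl V (r b) b)"
    by (auto simp: V.span_explicit)
  obtain h where h: "\<And>b. b \<in> T \<Longrightarrow> b \<in> hcomp V (h b)"
    using T BH unfolding homog_def by (metis UN_E subsetD)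
  define z where "z j = (\<Sum>b\<in>{b\<in>T. h b = j}. scl V (r b) b) - (if j = i then x else 0)" for j
  have zj: "z j \<in> hcomp V j" for j
    unfolding z_def
    by (intro V.subspace_diff comp_subspace V.subspace_sum V.subspace_scale)
      (use h x in \<open>auto intro: V.subspace_0[OF comp_subspace]\<close>)
  define J where "J = insert i (h ` T)"
  have J: "finite J" using T by (simp add: J_def)
  have z0: "z j = 0" if "j \<notin> J" for j
  proof -
    have "{b\<in>T. h b = j} = {}" using that by (auto simp: J_def)
    then show ?thesis using that by (simp only: z_def) (simp add: J_def)
  qed
  have sub: "{j. z j \<noteq> 0} \<subseteq> J" using z0 by blast
  have "(\<Sum>j | z j \<noteq> 0. z j) = (\<Sum>j\<in>J. z j)"
    by (rule sum.mono_neutral_left) (use J sub in auto)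
  also have "\<dots> = (\<Sum>j\<in>J. \<Sum>b\<in>{b\<in>T. h b = j}. scl V (r b) b) - x"
    unfolding z_def using J by (simp add: sum_subtractf J_def)
  also have "(\<Sum>j\<in>J. \<Sum>b\<in>{b\<in>T. h b = j}. scl V (r b) b) = x"
    unfolding T(3) by (rule sum.group) (use T J in \<open>auto simp: J_def\<close>)
  finally have "z i = 0"
    by (intro comp_independent[of z]) (use zj finite_subset[OF sub J] in auto)
  then have "x = (\<Sum>b\<in>{b\<in>T. h b = i}. scl V (r b) b)"
    by (simp add: z_def)
  then show ?thesis
    by (intro that[of "{b\<in>T. h b = i}" r]) (use T h in auto)
qed

lemma multihomogeneous_sum:
  assumes s: "vector_space s" and \<phi>: "multihomogeneous V s \<phi>" and T: "finite T" "T \<subseteq> hcomp V i"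
    and xs: "xs \<in> lists (homog V)"
  shows "\<phi> ((\<Sum>b\<in>T. scl V (r b) b) # xs) = (\<Sum>b\<in>T. s (r b) (\<phi> (b # xs)))"
  using T
proof (induction T rule: finite_induct)
  case empty
  have "\<phi> ([] @ scl V 0 0 # xs) = s 0 (\<phi> ([] @ 0 # xs))"
    using \<phi> xs V.subspace_0[OF comp_subspace] unfolding multihomogeneous_def by blast
  then show ?case
    using module.scale_zero_left[of s] s by (simp add: module_iff_vector_space)
next
  case (insert b T)
  have b: "b \<in> hcomp V i" and sb: "scl V (r b) b \<in> hcomp V i"
    using insert V.subspace_scale[OF comp_subspace] by auto
  have S: "(\<Sum>b\<in>T. scl V (r b) b) \<in> hcomp V i"
    using insert by (intro V.subspace_sum comp_subspace V.subspace_scale) auto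
  have "\<phi> ([] @ (scl V (r b) b + (\<Sum>b\<in>T. scl V (r b) b)) # xs) =
    \<phi> ([] @ scl V (r b) b # xs) + \<phi> ([] @ (\<Sum>b\<in>T. scl V (r b) b) # xs)"
    using \<phi> xs S sb unfolding multihomogeneous_def by blast
  moreover have "\<phi> ([] @ scl V (r b) b # xs) = s (r b) (\<phi> ([] @ b # xs))"
    using \<phi> xs b unfolding multihomogeneous_def by blast
  ultimately show ?case
    using insert by simp
qed

lemma form_extend_eq:
  assumes BH: "B \<subseteq> homog V" and span: "homog V \<subseteq> V.span B" and B: "V.independent B"
    and xs: "xs \<in> lists (homog V)" and g: "multihomogeneous V (*) g"
  shows "form_extend B xs g = g xs"
  using xs g
proof (induction xs arbitrary: g)
  case Nil
  then show ?case by simp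
next
  case (Cons x xs)
  then obtain i where "x \<in> hcomp V i" by (auto simp: homog_def)
  then obtain T r where T: "finite T" "T \<subseteq> B \<inter> hcomp V i" "x = (\<Sum>b\<in>T. scl V (r b) b)"
    using homogeneous_basis_expansion[OF BH span] by metis
  have gb: "multihomogeneous V (*) (\<lambda>ys. g (b # ys))" if "b \<in> B" for b
    unfolding multihomogeneous_def
  proof (intro ballI allI conjI)
    fix us ws i x c
    assume *: "us \<in> lists (homog V)" "ws \<in> lists (homog V)" "x \<in> hcomp V i"
    have "b # us \<in> lists (homog V)" using * that BH by auto
    with * Cons.prems have
      "g ((b # us) @ scl V c x # ws) = c * g ((b # us) @ x # ws)"
      "y \<in> hcomp V i \<Longrightarrow> g ((b # us) @ (x + y) # ws) = g ((b # us) @ x # ws) + g ((b # us) @ y # ws)"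
      for y
      unfolding multihomogeneous_def by blast+
    then show "g (b # us @ scl V c x # ws) = c * g (b # us @ x # ws)"
      "y \<in> hcomp V i \<Longrightarrow> g (b # us @ (x + y) # ws) = g (b # us @ x # ws) + g (b # us @ y # ws)"
      for y
      by simp_all
  qed
  have "form_extend B (x # xs) g =
    (\<Sum>b\<in>T. r b * VK.construct B (\<lambda>b. form_extend B xs (\<lambda>ys. g (b # ys))) b)"
    using VK.linear_construct[OF B] by (simp add: T(3) VK.linear_sum VK.linear_scale)
  also have "\<dots> = (\<Sum>b\<in>T. r b * g (b # xs))"
  proof (rule sum.cong[OF refl])
    fix b
    assume "b \<in> T"
    then have "b \<in> B" using T by auto
    then show "r b * VK.construct B (\<lambda>b. form_extend B xs (\<lambda>ys. g (b # ys))) b = r b * g (b # xs)"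
      using Cons.IH[OF gb] by (simp add: VK.construct_basis[OF B])
  qed
  also have "\<dots> = g (x # xs)"
    using multihomogeneous_sum[OF vector_space_ground Cons.prems, of T i xs r] T Cons.hyps
    by simp
  finally show ?case .
qed

lemma multilinear_extension:
  assumes "multihomogeneous V (*) g"
  obtains f where "multilinear_form V f" "\<And>xs. xs \<in> lists (homog V) \<Longrightarrow> f xs = g xs"
proof -
  obtain B where B: "B \<subseteq> homog V" "V.independent B" "homog V \<subseteq> V.span B"
    by (rule V.maximal_independent_subset)
  show ?thesis
    by (rule that[of "\<lambda>xs. form_extend B xs g"])
      (auto simp: multilinear_form_def form_extend_add form_extend_scale form_extend_eq B assms)
qed

lemma word_relation:
  assumes s: "vector_space s" and \<phi>: "multihomogeneous V s \<phi>"
    and S: "finite S" "S \<subseteq> lists (homog V)" and 0: "(\<Sum>xs\<in>S. tscale (c xs) (word V xs)) = 0"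
  shows "(\<Sum>xs\<in>S. s (c xs) (\<phi> xs)) = 0"
proof (rule ccontr)
  assume ne: "(\<Sum>xs\<in>S. s (c xs) (\<phi> xs)) \<noteq> 0" (is "?y \<noteq> 0")
  interpret W: vector_space s by (rule s)
  interpret WK: vector_space_pair s "(*) :: 'k \<Rightarrow> 'k \<Rightarrow> 'k"
    by (intro vector_space_pair.intro s vector_space_ground)
  have ind: "W.independent {?y}"
    using ne by (simp add: W.dependent_single)
  define l where "l = WK.construct {?y} (\<lambda>_. 1)"
  have l: "Vector_Spaces.linear s (*) l" and ly: "l ?y = 1"
    using WK.linear_construct[OF ind] WK.construct_basis[OF ind] by (auto simp: l_def)
  have "multihomogeneous V (*) (\<lambda>xs. l (\<phi> xs))"
    using \<phi> by (simp add: multihomogeneous_def WK.linear_add[OF l] WK.linear_scale[OF l])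
  then obtain f where f: "multilinear_form V f" "\<And>xs. xs \<in> lists (homog V) \<Longrightarrow> f xs = l (\<phi> xs)"
    using multilinear_extension by blast
  have "0 = (\<Sum>xs\<in>S. tscale (c xs) (word V xs)) f"
    by (simp add: 0)
  also have "\<dots> = (\<Sum>xs\<in>S. c xs * f xs)"
    using S(1) by (induction S rule: finite_induct) (simp_all add: tscale_def word_def f(1))
  also have "\<dots> = (\<Sum>xs\<in>S. c xs * l (\<phi> xs))"
    by (rule sum.cong[OF refl]) (metis S(2) f(2) subsetD)
  also have "\<dots> = l ?y"
    by (simp add: WK.linear_sum[OF l] WK.linear_scale[OF l])
  finally show False using ly by simp
qed

lemma lift_sum:
  assumes s: "vector_space s" and \<phi>: "multihomogeneous V s \<phi>"
    and S: "finite S" "S \<subseteq> lists (homog V)"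
  shows "lift V s \<phi> (\<Sum>xs\<in>S. tscale (c xs) (word V xs)) = (\<Sum>xs\<in>S. s (c xs) (\<phi> xs))"
  unfolding lift_def
proof (rule the_equality, intro exI conjI)
  interpret W: vector_space s by (rule s)
  interpret T: vector_space "tscale :: 'k \<Rightarrow> ('k, 'v) tensor \<Rightarrow> _"
    by (rule vector_space_tscale)
  fix y
  assume "\<exists>S' c'. finite S' \<and> S' \<subseteq> lists (homog V) \<and>
    (\<Sum>xs\<in>S. tscale (c xs) (word V xs)) = (\<Sum>xs\<in>S'. tscale (c' xs) (word V xs)) \<and>
    y = (\<Sum>xs\<in>S'. s (c' xs) (\<phi> xs))"
  then obtain S' c' where S': "finite S'" "S' \<subseteq> lists (homog V)"
    and eq: "(\<Sum>xs\<in>S. tscale (c xs) (word V xs)) = (\<Sum>xs\<in>S'. tscale (c' xs) (word V xs))"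
    and y: "y = (\<Sum>xs\<in>S'. s (c' xs) (\<phi> xs))"
    by blast
  define e where "e xs = (if xs \<in> S then c xs else 0) - (if xs \<in> S' then c' xs else 0)" for xs
  note ext = sum_difference[OF _ S(1) S'(1), of _ c c', folded e_def]
  have "(\<Sum>xs\<in>S \<union> S'. tscale (e xs) (word V xs)) = 0"
    using ext[OF vector_space_tscale, of "word V"] eq by simp
  then have "(\<Sum>xs\<in>S \<union> S'. s (e xs) (\<phi> xs)) = 0"
    using S S' by (intro word_relation[OF s \<phi>]) auto
  then show "y = (\<Sum>xs\<in>S. s (c xs) (\<phi> xs))"
    using ext[OF s, of \<phi>] y by simp
qed (use S in auto)

end

definition lift2 ::
  "('k::field, 'v::ab_group_add, 'z) gspace_scheme \<Rightarrow> ('k \<Rightarrow> 'w::ab_group_add \<Rightarrow> 'w) \<Rightarrow>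
   ('v \<Rightarrow> 'v \<Rightarrow> 'w) \<Rightarrow> ('k, 'v) tensor \<Rightarrow> 'w"
  where "lift2 V s \<phi> = lift V s (\<lambda>xs. case xs of [x, y] \<Rightarrow> \<phi> x y | _ \<Rightarrow> 0)"

definition tmul ::
  "('k::field, 'v::ab_group_add, 'z) gspace_scheme \<Rightarrow>
   ('k, 'v) tensor \<Rightarrow> ('k, 'v) tensor \<Rightarrow> ('k, 'v) tensor"
  where "tmul V x y = lift V tscale (\<lambda>us. lift V tscale (\<lambda>ws. word V (us @ ws)) y) x"

text \<open>The derivation of \<open>T(V)\<close> of odd degree that restricts to \<open>\<delta>\<close> on \<open>V\<close>.\<close>

definition odd_derivation ::
  "('k::field, 'v::ab_group_add, 'z) gspace_scheme \<Rightarrow> ('v \<Rightarrow> ('k, 'v) tensor) \<Rightarrow>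
   ('k, 'v) tensor \<Rightarrow> ('k, 'v) tensor"
  where "odd_derivation V \<delta> = lift V tscale (\<lambda>xs. \<Sum>i<length xs.
    tscale (ksign (wdeg V (take i xs)))
      (tmul V (word V (take i xs)) (tmul V (\<delta> (xs ! i)) (word V (drop (Suc i) xs)))))"

text \<open>The differential \<open>\<Sum>\<^sub>i 1 \<otimes> \<dots> \<otimes> d \<otimes> \<dots> \<otimes> 1\<close> on the powers \<open>V\<^sup>\<otimes>\<^sup>r\<close>.\<close>

definition tensor_diff ::
  "('k::field, 'v::ab_group_add, 'z) gspace_scheme \<Rightarrow> ('v \<Rightarrow> 'v) \<Rightarrow>
   ('k, 'v) tensor \<Rightarrow> ('k, 'v) tensor"
  where "tensor_diff V d = odd_derivation V (\<lambda>x. word V [d x])"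

text \<open>
  The signed action of a permutation of \<open>{0..<r}\<close> on \<open>V\<^sup>\<otimes>\<^sup>r\<close>; positions are counted from \<open>0\<close>.
\<close>

definition tensor_perm ::
  "nat \<Rightarrow> ('k::field, 'v::ab_group_add, 'z) gspace_scheme \<Rightarrow> (nat \<Rightarrow> nat) \<Rightarrow>
   ('k, 'v) tensor \<Rightarrow> ('k, 'v) tensor"
  where "tensor_perm r V s = lift V tscale (\<lambda>xs. if length xs = r then
    tscale
      (ksign (\<Sum>(i, j)\<in>{(i, j). i < j \<and> j < r \<and> inv s i > inv s j}.
        deg V (xs ! inv s i) * deg V (xs ! inv s j)))
      (word V (map (\<lambda>i. xs ! inv s i) [0..<r])) else 0)"

definition flip ::
  "('k::field, 'v::ab_group_add, 'z) gspace_scheme \<Rightarrow> ('k, 'v) tensor \<Rightarrow> ('k, 'v) tensor"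
  where "flip V = lift2 V tscale (\<lambda>x y. tscale (ksign (deg V x * deg V y)) (word V [y, x]))"


section \<open>DG algebras and double Poisson brackets\<close>

record ('k, 'v) dgspace = "('k, 'v) gspace" +
  diff :: "'v \<Rightarrow> 'v"

locale dg_space = graded_space V
  for V :: "('k::field, 'v::ab_group_add, 'z) dgspace_scheme" +
  assumes diff_linear: "linear_map V V (diff V)"
    and diff_degree: "has_degree V V (- 1) (diff V)"
    and diff_diff: "x \<in> carr V \<Longrightarrow> diff V (diff V x) = 0"

record ('k, 'a) dgalg = "('k, 'a) dgspace" +
  mult :: "'a \<Rightarrow> 'a \<Rightarrow> 'a"
  unity :: "'a"

locale dg_algebra = dg_space A
  for A :: "('k::field, 'a::ab_group_add, 'z) dgalg_scheme" +
  assumes mult_bilinear: "bilinear_map A A A (mult A)"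
    and mult_degree: "has_bidegree A A A 0 (mult A)"
    and mult_assoc: "\<lbrakk>x \<in> carr A; y \<in> carr A; z \<in> carr A\<rbrakk> \<Longrightarrow>
      mult A (mult A x y) z = mult A x (mult A y z)"
    and unit_degree: "unity A \<in> hcomp A 0"
    and mult_unit_left: "x \<in> carr A \<Longrightarrow> mult A (unity A) x = x"
    and mult_unit_right: "x \<in> carr A \<Longrightarrow> mult A x (unity A) = x"
    and leibniz: "\<lbrakk>x \<in> hcomp A i; y \<in> hcomp A j\<rbrakk> \<Longrightarrow>
      diff A (mult A x y) = mult A (diff A x) y + scl A (ksign i) (mult A x (diff A y))"

text \<open>The outer bimodule structure on \<open>A \<otimes> A\<close>.\<close>

definition outer_left ::
  "('k::field, 'a::ab_group_add, 'z) dgalg_scheme \<Rightarrow> 'a \<Rightarrow> ('k, 'a) tensor \<Rightarrow> ('k, 'a) tensor"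
  where "outer_left A a = lift2 A tscale (\<lambda>x y. word A [mult A a x, y])"

definition outer_right ::
  "('k::field, 'a::ab_group_add, 'z) dgalg_scheme \<Rightarrow> ('k, 'a) tensor \<Rightarrow> 'a \<Rightarrow> ('k, 'a) tensor"
  where "outer_right A t b = lift2 A tscale (\<lambda>x y. word A [x, mult A y b]) t"

definition bracket_L ::
  "('k::field, 'a::ab_group_add, 'z) dgalg_scheme \<Rightarrow> ('a \<Rightarrow> 'a \<Rightarrow> ('k, 'a) tensor) \<Rightarrow>
   'a \<Rightarrow> ('k, 'a) tensor \<Rightarrow> ('k, 'a) tensor"
  where "bracket_L A br a = lift A tscale (\<lambda>xs. tmul A (br a (hd xs)) (word A (tl xs)))"

text \<open>
  The symbol of the bracket, of degree \<open>N\<close>, stands between its two arguments for the Koszul rule: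
  \<open>br a\<close> is an operator of degree \<open>|a| + N\<close>.  This determines the signs in the compatibility with
  the differential and in the derivation rule.
\<close>

locale double_bracket = dg_algebra A
  for A :: "('k::field, 'a::ab_group_add, 'z) dgalg_scheme" +
  fixes N :: int and br :: "'a \<Rightarrow> 'a \<Rightarrow> ('k, 'a) tensor"
  assumes br_bilinear: "bilinear_map A A (tensor_power 2 A) br"
    and br_degree: "has_bidegree A A (tensor_power 2 A) N br"
    and br_diff: "\<lbrakk>a \<in> hcomp A i; b \<in> hcomp A j\<rbrakk> \<Longrightarrow>
      tensor_diff A (diff A) (br a b) =
        br (diff A a) b + tscale (ksign (i + N)) (br a (diff A b))"
    and br_derivation: "\<lbrakk>a \<in> hcomp A i; b \<in> hcomp A j; c \<in> hcomp A l\<rbrakk> \<Longrightarrow>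
      br a (mult A b c) =
        outer_right A (br a b) c + tscale (ksign ((i + N) * j)) (outer_left A b (br a c))"
    and br_skew: "\<lbrakk>a \<in> hcomp A i; b \<in> hcomp A j\<rbrakk> \<Longrightarrow>
      br a b = - tscale (ksign ((i + N) * (j + N))) (flip A (br b a))"

locale double_poisson_algebra = double_bracket A N br
  for A :: "('k::field, 'a::ab_group_add, 'z) dgalg_scheme"
    and N :: int and br :: "'a \<Rightarrow> 'a \<Rightarrow> ('k, 'a) tensor" +
  assumes double_jacobi: "\<lbrakk>a \<in> hcomp A i; b \<in> hcomp A j; c \<in> hcomp A l\<rbrakk> \<Longrightarrow>
      bracket_L A br a (br b c)
      + tscale (ksign ((i + N) * (j + l)))
          (tensor_perm 3 A (cycle_of_list [0, 1, 2]) (bracket_L A br b (br c a)))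
      + tscale (ksign ((l + N) * (i + j)))
          (tensor_perm 3 A (cycle_of_list [0, 2, 1]) (bracket_L A br c (br a b))) = 0"


section \<open>Cyclic DG coalgebras and the cobar construction\<close>

record ('k, 'v) dgcoalg = "('k, 'v) dgspace" +
  comult :: "'v \<Rightarrow> ('k, 'v) tensor"

record ('k, 'v) cyclic_dgcoalg = "('k, 'v) dgcoalg" +
  pairing :: "'v \<Rightarrow> 'v \<Rightarrow> 'k"

locale dg_coalgebra = dg_space C
  for C :: "('k::field, 'v::ab_group_add, 'z) dgcoalg_scheme" +
  assumes comult_linear: "linear_map C (tensor_power 2 C) (comult C)"
    and comult_degree: "has_degree C (tensor_power 2 C) 0 (comult C)"
    and coassoc: "v \<in> carr C \<Longrightarrow>
      lift2 C tscale (\<lambda>x y. tmul C (comult C x) (word C [y])) (comult C v) =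
      lift2 C tscale (\<lambda>x y. tmul C (word C [x]) (comult C y)) (comult C v)"
    and comult_diff: "v \<in> carr C \<Longrightarrow> comult C (diff C v) = tensor_diff C (diff C) (comult C v)"

text \<open>
  As for double brackets, the symbol of the pairing, of degree \<open>n\<close>, stands between its arguments.
  So \<open>d\<close> passes \<open>v\<close> and the pairing in \<open>pairing_diff\<close>.  In \<open>cyclic\<close>, \<open>v''\<close> passes the pairing
  and \<open>w\<close> on the left-hand side, and \<open>w'\<close> and \<open>w''\<close> are interchanged on the right-hand side.
\<close>

locale cyclic_dg_coalgebra = dg_coalgebra C
  for n :: int and C :: "('k::field, 'v::ab_group_add, 'z) cyclic_dgcoalg_scheme" +
  assumes pairing_bilinear: "bilinear_map C C ground (pairing C)"
    and pairing_degree: "has_bidegree C C ground n (pairing C)"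
    and pairing_symmetric: "\<lbrakk>v \<in> hcomp C i; w \<in> hcomp C j\<rbrakk> \<Longrightarrow>
      pairing C v w = ksign (i * j) * pairing C w v"
    and cyclic: "\<lbrakk>v \<in> hcomp C i; w \<in> hcomp C j\<rbrakk> \<Longrightarrow>
      lift2 C (scl C) (\<lambda>x y. scl C (ksign (deg C y * (n + j)) * pairing C x w) y) (comult C v) =
      lift2 C (scl C) (\<lambda>x y. scl C (ksign (deg C x * deg C y) * pairing C v y) x) (comult C w)"
    and pairing_diff: "\<lbrakk>v \<in> hcomp C i; w \<in> hcomp C j\<rbrakk> \<Longrightarrow>
      pairing C (diff C v) w + ksign (i + n) * pairing C v (diff C w) = 0"

text \<open>The sign is that of moving the second desuspension past \<open>v'\<close>, where \<open>|v'|\<close> is the degree in \<open>C\<close>.\<close>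

definition cobar_gen ::
  "('k::field, 'v::ab_group_add, 'z) dgcoalg_scheme \<Rightarrow> 'v \<Rightarrow> ('k, 'v) tensor"
  where "cobar_gen C v = word (desusp C) [diff C v] +
    lift2 C tscale (\<lambda>x y. tscale (ksign (deg C x)) (word (desusp C) [x, y])) (comult C v)"

definition cobar ::
  "('k::field, 'v::ab_group_add, 'z) dgcoalg_scheme \<Rightarrow> ('k, ('k, 'v) tensor) dgalg"
  where "cobar C = \<lparr>scl = tscale, hcomp = hcomp (tensor_algebra (desusp C)),
    diff = odd_derivation (desusp C) (cobar_gen C),
    mult = tmul (desusp C), unity = word (desusp C) []\<rparr>"

text \<open>
  Write \<open>v = (a, x, b)\<close> with \<open>x = v\<^sub>i\<close> and \<open>w = (c, y, e)\<close> with \<open>y = w\<^sub>j\<close>.  The pairing on \<open>C[-1]\<close>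
  is \<open>(-1)\<^sup>|\<^sup>x\<^sup>|\<langle>x, y\<rangle>\<close> with \<open>|x|\<close> the degree in \<open>C\<close> (desuspension), so the bracket symbol has degree
  \<open>n + 2\<close>.  Passing from the order \<open>(a, x, b), {{,}}, (c, y, e)\<close> to \<open>c, b, a, x, {{,}}, y, e\<close> moves
  \<open>c\<close> past \<open>v\<close> and the bracket, and \<open>b\<close> past \<open>a\<close> and \<open>x\<close>; all these degrees are those of \<open>C[-1]\<close>.
\<close>

definition cobar_bracket ::
  "int \<Rightarrow> ('k::field, 'v::ab_group_add, 'z) cyclic_dgcoalg_scheme \<Rightarrow>
   ('k, 'v) tensor \<Rightarrow> ('k, 'v) tensor \<Rightarrow> ('k, ('k, 'v) tensor) tensor"
  where "cobar_bracket n C p q =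
    lift (desusp C) tscale (\<lambda>v. lift (desusp C) tscale (\<lambda>w.
      \<Sum>i<length v. \<Sum>j<length w.
        tscale
          (ksign (deg C (v ! i)
             + (wdeg (desusp C) v + n + 2) * wdeg (desusp C) (take j w)
             + wdeg (desusp C) (drop (Suc i) v) * wdeg (desusp C) (take (Suc i) v))
           * pairing C (v ! i) (w ! j))
          (word (cobar C)
            [word (desusp C) (take j w @ drop (Suc i) v),
             word (desusp C) (take i v @ drop (Suc j) w)]))
      q) p"

end

theory Submission
  imports Defs
begin

text \<open>
  All structures on \<open>\<Omega>(C)\<close> are given on words in homogeneous elements of \<open>C\<close> and extended by
  \<open>lift\<close>, which is a linear map with the prescribed values on words as soon as the formula is
  multihomogeneous.  Hence two multilinear expressions agree on \<open>\<Omega>(C)\<close> if they agree on words in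
  nonzero homogeneous elements (\<open>words_eqI\<close>, \<open>words_eqI2\<close>, \<open>words_eqI3\<close>).

  \<open>\<Omega>(C)\<close> is a DG algebra because \<open>\<partial>\<close> is an odd derivation.  Its square is a derivation, too, and
  vanishes on generators by coassociativity and by the compatibility of \<open>\<Delta>\<close> with \<open>d\<close>
  (\<open>cobar_diff_gen\<close>).

  The bracket of two words is a sum over one marked letter in each of them.  The letters of a
  concatenation \<open>w @ u\<close> are those of \<open>w\<close> and those of \<open>u\<close>, which gives the derivation rule
  (\<open>bwords_append\<close>); exchanging the two sums gives skew symmetry (\<open>bwords_skew\<close>).  The failure of a
  skew-symmetric bracket with the derivation rule to be compatible with \<open>\<partial>\<close> obeys the derivation rule
  and skew symmetry as well (\<open>diff_compatible_mult\<close>, \<open>diff_compatible_skew\<close>), so it is enough to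
  consider generators \<open>x\<close> and \<open>y\<close> (\<open>diff_compatible_gen\<close>).  Their bracket is a multiple of \<open>1 \<otimes> 1\<close>,
  which \<open>\<partial>\<close> kills.  In \<open>{{\<partial>x, y}} \<plusminus> {{x, \<partial>y}}\<close> the terms with \<open>d\<close> cancel because \<open>d\<close> is
  compatible with the pairing; the other terms have the form \<open>(z) \<otimes> 1\<close> or \<open>1 \<otimes> (z)\<close>, and they
  cancel by the cyclicity condition for the pairs \<open>x\<close>, \<open>y\<close> and \<open>y\<close>, \<open>x\<close>, respectively.

  For words \<open>u\<close>, \<open>v\<close>, \<open>w\<close>, the expression \<open>{{u, {{v, w}}}}\<^sub>L\<close> is the sum of two parts: \<open>u\<close> is
  paired with a letter of \<open>{{v, w}}'\<close> that comes from \<open>w\<close>, or with one that comes from \<open>v\<close>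
  (\<open>brL_bwords\<close>).  In the first part \<open>w\<close> is paired with both other words.  This also happens in the
  second part of \<open>{{v, {{w, u}}}}\<^sub>L\<close>, with the same pairs of letters and, after a cyclic permutation,
  the same three words; only the sign differs (\<open>jacobi_cancel\<close>).  So the six parts of the double
  Jacobi identity cancel in pairs.  All signs rest on the fact that \<open>\<langle>x, y\<rangle>\<close> vanishes unless the
  degrees of \<open>x\<close> and \<open>y\<close> add up to \<open>- n\<close>.
\<close>


section \<open>Signs and sums over splittings\<close>

lemma ksign_add: "ksign (a + b) = (ksign a * ksign b :: 'k::field)"
  by (rule power_int_add) simp

lemma ksign_square: "ksign a * ksign a = (1 :: 'k::field)"
  by (simp add: power_int_def flip: power_mult_distrib)

lemma ksign_even: "even a \<Longrightarrow> ksign a = (1 :: 'k::field)"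
  by (auto elim!: evenE simp: power_int_mult)

lemma ksign_cong: "even (a + b) \<Longrightarrow> ksign a = (ksign b :: 'k::field)"
  using ksign_even[of "a + b", where 'k = 'k] ksign_square[of b, where 'k = 'k]
  by (metis ksign_add mult.assoc mult.left_neutral mult.right_neutral)

lemma ksign_cong_minus: "odd (a + b) \<Longrightarrow> ksign a = (- ksign b :: 'k::field)"
  using ksign_cong[of a "b + 1", where 'k = 'k] by (simp add: ksign_add)

text \<open>
  \<open>split_sum F xs\<close> is the sum of \<open>F a x b\<close> over all ways to write \<open>xs = a @ x # b\<close>.
\<close>

definition split_sum :: "('v list \<Rightarrow> 'v \<Rightarrow> 'v list \<Rightarrow> 'w::comm_monoid_add) \<Rightarrow> 'v list \<Rightarrow> 'w"
  where "split_sum F xs = (\<Sum>i<length xs. F (take i xs) (xs ! i) (drop (Suc i) xs))"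

lemma split_sum_Nil [simp]: "split_sum F [] = 0"
  by (simp add: split_sum_def)

lemma split_sum_Cons:
  "split_sum F (x # xs) = F [] x xs + split_sum (\<lambda>a y b. F (x # a) y b) xs"
  by (simp add: split_sum_def sum.lessThan_Suc_shift del: sum.lessThan_Suc)

lemma split_sum_single [simp]: "split_sum F [x] = F [] x []"
  by (simp add: split_sum_Cons)

lemma split_sum_append:
  "split_sum F (us @ vs) =
    split_sum (\<lambda>a x b. F a x (b @ vs)) us + split_sum (\<lambda>a x b. F (us @ a) x b) vs"
  by (induction us arbitrary: F) (simp_all add: split_sum_Cons ac_simps)

lemma split_sum_add:
  "split_sum (\<lambda>a x b. F a x b + G a x b) xs = split_sum F xs + split_sum G xs"
  by (simp add: split_sum_def sum.distrib)

lemma split_sum_swap: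
  "split_sum (\<lambda>a x b. split_sum (\<lambda>c y e. F a x b c y e) ws) vs =
    split_sum (\<lambda>c y e. split_sum (\<lambda>a x b. F a x b c y e) vs) ws"
  unfolding split_sum_def by (rule sum.swap)

lemma split_sum_cong:
  assumes "\<And>a x b. xs = a @ x # b \<Longrightarrow> F a x b = G a x b"
  shows "split_sum F xs = split_sum G xs"
  unfolding split_sum_def by (rule sum.cong) (auto simp: assms id_take_nth_drop)

lemma split_sum_in:
  assumes "\<And>a x b. xs = a @ x # b \<Longrightarrow> P (F a x b)" "P 0" "\<And>x y. P x \<Longrightarrow> P y \<Longrightarrow> P (x + y)"
  shows "P (split_sum F xs)"
proof -
  have "P (\<Sum>i\<in>I. F (take i xs) (xs ! i) (drop (Suc i) xs))" if "I \<subseteq> {..<length xs}" for I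
    using finite_subset[OF that] that
    by (induction I rule: finite_induct) (use assms in \<open>auto simp: id_take_nth_drop\<close>)
  then show ?thesis
    by (simp add: split_sum_def)
qed

text \<open>A word with two marked letters is split at either of them first.\<close>

lemma split_sum_nested:
  "split_sum (\<lambda>c y e. split_sum (\<lambda>a x b. F a x b y e) c) xs =
    split_sum (\<lambda>a x r. split_sum (\<lambda>b y e. F a x b y e) r) xs"
  by (induction xs arbitrary: F) (simp_all add: split_sum_Cons split_sum_add add_ac)


lemma split_sum_reverse:
  "split_sum (\<lambda>a x b. split_sum (\<lambda>p z q. split_sum (\<lambda>c y e. F a x b p z q c y e) cs) us) vs =
    split_sum (\<lambda>c y e. split_sum (\<lambda>p z q. split_sum (\<lambda>a x b. F a x b p z q c y e) vs) us) cs"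
proof -
  have "split_sum (\<lambda>a x b. split_sum (\<lambda>p z q. split_sum (\<lambda>c y e. F a x b p z q c y e) cs) us) vs =
      split_sum (\<lambda>a x b. split_sum (\<lambda>c y e. split_sum (\<lambda>p z q. F a x b p z q c y e) us) cs) vs"
    by (rule split_sum_cong, rule split_sum_swap)
  also have "\<dots> = split_sum (\<lambda>c y e. split_sum (\<lambda>a x b. split_sum (\<lambda>p z q. F a x b p z q c y e) us) vs) cs"
    by (rule split_sum_swap)
  also have "\<dots> = split_sum (\<lambda>c y e. split_sum (\<lambda>p z q. split_sum (\<lambda>a x b. F a x b p z q c y e) vs) us) cs"
    by (rule split_sum_cong, rule split_sum_swap)
  finally show ?thesis .
qed

section \<open>Linear maps on subspaces\<close>

text \<open>Additivity and homogeneity on a subset of the ambient type only.\<close>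

definition linear_on ::
  "('k \<Rightarrow> 'a::ab_group_add \<Rightarrow> 'a) \<Rightarrow> ('k \<Rightarrow> 'b::ab_group_add \<Rightarrow> 'b) \<Rightarrow> 'a set \<Rightarrow> ('a \<Rightarrow> 'b) \<Rightarrow> bool"
  where "linear_on s t S f \<longleftrightarrow>
    (\<forall>x\<in>S. \<forall>y\<in>S. f (x + y) = f x + f y) \<and> (\<forall>c. \<forall>x\<in>S. f (s c x) = t c (f x))"

lemma linear_onI:
  assumes "\<And>x y. x \<in> S \<Longrightarrow> y \<in> S \<Longrightarrow> f (x + y) = f x + f y"
    and "\<And>c x. x \<in> S \<Longrightarrow> f (s c x) = t c (f x)"
  shows "linear_on s t S f"
  using assms by (auto simp: linear_on_def)

lemma linear_on_add: "linear_on s t S f \<Longrightarrow> x \<in> S \<Longrightarrow> y \<in> S \<Longrightarrow> f (x + y) = f x + f y"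
  by (auto simp: linear_on_def)

lemma linear_on_scale: "linear_on s t S f \<Longrightarrow> x \<in> S \<Longrightarrow> f (s c x) = t c (f x)"
  by (auto simp: linear_on_def)

lemma linear_on_zero:
  assumes "vector_space s" "vector_space t" "linear_on s t S f" "module.subspace s S"
  shows "f 0 = 0"
proof -
  interpret s: vector_space s by (rule assms)
  interpret t: vector_space t by (rule assms)
  have "f (s 0 0) = t 0 (f 0)"
    using assms s.subspace_0 by (blast intro: linear_on_scale)
  then show ?thesis by simp
qed

lemma linear_on_subset: "linear_on s t S f \<Longrightarrow> S' \<subseteq> S \<Longrightarrow> linear_on s t S' f"
  unfolding linear_on_def by blast

lemma linear_on_cong:
  assumes "module.subspace s S" "vector_space s" "\<And>x. x \<in> S \<Longrightarrow> f x = g x"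
  shows "linear_on s t S f \<longleftrightarrow> linear_on s t S g"
proof -
  interpret s: vector_space s by (rule assms)
  show ?thesis
    using assms(1,3) s.subspace_add s.subspace_scale by (simp add: linear_on_def)
qed

lemma linear_on_compose:
  assumes "linear_on s t S g" "\<And>x. x \<in> S \<Longrightarrow> g x \<in> S'" "linear_on t u S' f"
  shows "linear_on s u S (\<lambda>x. f (g x))"
  using assms by (simp add: linear_on_def)

lemma linear_on_plus:
  assumes "vector_space t" "linear_on s t S f" "linear_on s t S g"
  shows "linear_on s t S (\<lambda>x. f x + g x)"
proof -
  interpret t: vector_space t by (rule assms)
  show ?thesis
    using assms(2,3) by (simp add: linear_on_def t.scale_right_distrib)
qed

lemma linear_on_const0:
  assumes "vector_space t"
  shows "linear_on s t S (\<lambda>x. 0)"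
proof -
  interpret t: vector_space t by (rule assms)
  show ?thesis by (simp add: linear_on_def)
qed

lemma linear_on_scaled:
  assumes "vector_space t" "linear_on s t S f"
  shows "linear_on s t S (\<lambda>x. t c (f x))"
proof -
  interpret t: vector_space t by (rule assms)
  show ?thesis
    using assms(2) by (simp add: linear_on_def t.scale_right_distrib t.scale_left_commute)
qed

lemma linear_on_uminus:
  assumes "vector_space t" "linear_on s t S f"
  shows "linear_on s t S (\<lambda>x. - f x)"
proof -
  interpret t: vector_space t by (rule assms)
  show ?thesis
    using assms(2) by (simp add: linear_on_def)
qed

lemma linear_on_id: "linear_on s s S (\<lambda>x. x)"
  by (simp add: linear_on_def)

lemma linear_on_sum:
  assumes "vector_space t" "\<And>i. i \<in> I \<Longrightarrow> linear_on s t S (f i)"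
  shows "linear_on s t S (\<lambda>x. \<Sum>i\<in>I. f i x)"
proof -
  interpret t: vector_space t by (rule assms)
  show ?thesis
    using assms(2) by (simp add: linear_on_def t.scale_sum_right sum.distrib)
qed

lemma linear_on_span_eq:
  assumes "vector_space s" "vector_space t"
    and "linear_on s t (module.span s B) f" "linear_on s t (module.span s B) g"
    and eq: "\<And>b. b \<in> B \<Longrightarrow> f b = g b" and x: "x \<in> module.span s B"
  shows "f x = g x"
proof -
  interpret s: vector_space s by (rule assms)
  interpret t: vector_space t by (rule assms)
  have 0: "f 0 = 0" "g 0 = 0"
    using assms(3,4) linear_on_zero[OF assms(1,2)] by auto
  have "x \<in> s.span B \<and> f x = g x"
    using x
  proof (induction x rule: s.span_induct_alt)
    case base
    then show ?case by (simp add: 0 s.span_zero)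
  next
    case (step c b y)
    then have "s c b \<in> s.span B" "y \<in> s.span B" "b \<in> s.span B"
      by (auto intro: s.span_base s.span_scale)
    then show ?case
      using step eq assms(3,4) by (simp add: linear_on_add linear_on_scale s.span_add)
  qed
  then show ?thesis by blast
qed

lemma linear_on_span_in:
  assumes "vector_space s" "vector_space t" "linear_on s t (module.span s B) f"
    and W: "module.subspace t W" "\<And>b. b \<in> B \<Longrightarrow> f b \<in> W" and x: "x \<in> module.span s B"
  shows "f x \<in> W"
proof -
  interpret s: vector_space s by (rule assms)
  interpret t: vector_space t by (rule assms)
  have 0: "f 0 = 0"
    using assms(3) linear_on_zero[OF assms(1,2)] by auto
  have "x \<in> s.span B \<and> f x \<in> W"
    using x
  proof (induction x rule: s.span_induct_alt)
    case base
    then show ?case by (simp add: 0 s.span_zero t.subspace_0 W)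
  next
    case (step c b y)
    then have "s c b \<in> s.span B" "y \<in> s.span B" "b \<in> s.span B"
      by (auto intro: s.span_base s.span_scale)
    then show ?case
      using step W assms(3)
      by (simp add: linear_on_add linear_on_scale s.span_add t.subspace_add t.subspace_scale)
  qed
  then show ?thesis by blast
qed


lemma split_sum_linear:
  assumes "vector_space s" "vector_space t" "linear_on s t S f" "module.subspace s S"
    and "\<And>a x b. xs = a @ x # b \<Longrightarrow> F a x b \<in> S"
  shows "f (split_sum F xs) = split_sum (\<lambda>a x b. f (F a x b)) xs"
  using assms(5)
proof (induction xs arbitrary: F)
  case Nil
  then show ?case
    using linear_on_zero[OF assms(1-4)] by simp
next
  case (Cons x xs)
  interpret s: vector_space s by (rule assms)
  have "F [] x xs \<in> S"
    using Cons.prems[of "[]"] by simp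
  moreover have F: "F (x # a) y b \<in> S" if "xs = a @ y # b" for a y b
    using Cons.prems[of "x # a"] that by simp
  then have "split_sum (\<lambda>a. F (x # a)) xs \<in> S"
    by (rule split_sum_in[where P = "\<lambda>x. x \<in> S"])
      (use assms(4) in \<open>auto simp: s.subspace_0 s.subspace_add\<close>)
  ultimately show ?case
    using Cons.IH[of "\<lambda>a. F (x # a)"] F by (simp add: split_sum_Cons linear_on_add[OF assms(3)])
qed

lemma linear_map_on: "linear_map V W f \<Longrightarrow> linear_on (scl V) (scl W) (carr V) f"
  by (auto simp: linear_map_def linear_on_def)

section \<open>Multihomogeneous maps\<close>

text \<open>
  A map on lists is multihomogeneous if it is linear on each homogeneous component in each entry;
  the prefix \<open>mh\<close> below stands for this property.
\<close>

global_interpretation TS: vector_space "tscale :: 'k::field \<Rightarrow> ('k, 'v) tensor \<Rightarrow> _"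
  by (rule vector_space_tscale)

lemmas vsT = vector_space_tscale

lemma split_sum_subspace:
  assumes "TS.subspace S" "\<And>a x b. xs = a @ x # b \<Longrightarrow> F a x b \<in> S"
  shows "split_sum F xs \<in> S"
  by (rule split_sum_in[where P = "\<lambda>t. t \<in> S"])
    (use assms in \<open>simp_all add: TS.subspace_0 TS.subspace_add\<close>)

context graded_space
begin

sublocale VS: vector_space "scl V"
  by (rule vector_space)

lemma hcomp_0 [simp]: "0 \<in> hcomp V i"
  by (rule VS.subspace_0[OF comp_subspace])

lemma hcomp_homog: "x \<in> hcomp V i \<Longrightarrow> x \<in> homog V"
  by (auto simp: homog_def)

lemma homog_0 [simp]: "0 \<in> homog V"
  using hcomp_homog[OF hcomp_0] .

lemma homog_carr: "x \<in> homog V \<Longrightarrow> x \<in> carr V"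
  by (simp add: carr_def VS.span_base)

lemma hcomp_carr: "x \<in> hcomp V i \<Longrightarrow> x \<in> carr V"
  by (simp add: hcomp_homog homog_carr)

lemma carr_subspace: "VS.subspace (carr V)"
  by (simp add: carr_def)

lemma carr_0 [simp]: "0 \<in> carr V"
  by (simp add: homog_carr)

lemma deg_eq:
  assumes x: "x \<in> hcomp V i" "x \<noteq> 0"
  shows "deg V x = i"
  unfolding deg_def
proof (rule some_equality)
  fix j
  assume j: "x \<in> hcomp V j"
  show "j = i"
  proof (rule ccontr)
    assume ne: "j \<noteq> i"
    \<comment> \<open>If \<open>x\<close> had two degrees, then \<open>x - x = 0\<close> would contradict independence.\<close>
    define z where "z k = (if k = i then x else if k = j then - x else 0)" for k
    have nz: "{k. z k \<noteq> 0} = {i, j}"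
      using x ne by (auto simp: z_def)
    have "z i = 0"
    proof (rule comp_independent[of z])
      show "z k \<in> hcomp V k" for k
        using x j VS.subspace_neg[OF comp_subspace] by (auto simp: z_def)
      show "finite {k. z k \<noteq> 0}" "(\<Sum>k | z k \<noteq> 0. z k) = 0"
        using ne unfolding nz by (auto simp: z_def)
    qed
    then show False using x by (simp add: z_def)
  qed
qed (fact x)

text \<open>
  The value of \<open>deg V\<close> at \<open>0\<close> does not matter, since \<open>f d 0 = 0\<close> for all \<open>d\<close>.
\<close>

lemma linear_on_deg:
  assumes t: "vector_space t" and "\<And>d. linear_on (scl V) t (hcomp V i) (f d)"
  shows "linear_on (scl V) t (hcomp V i) (\<lambda>x. f (deg V x) x)"
proof -
  have "f d 0 = 0" for d
    by (rule linear_on_zero[OF vector_space t assms(2) comp_subspace])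
  then have "f (deg V x) x = f i x" if "x \<in> hcomp V i" for x
    using that by (cases "x = 0") (simp_all add: deg_eq)
  then have "linear_on (scl V) t (hcomp V i) (\<lambda>x. f (deg V x) x) \<longleftrightarrow>
      linear_on (scl V) t (hcomp V i) (f i)"
    by (intro linear_on_cong[OF comp_subspace vector_space])
  then show ?thesis
    using assms(2)[of i] by simp
qed

lemma mhI:
  assumes "\<And>us ws i. us \<in> lists (homog V) \<Longrightarrow> ws \<in> lists (homog V) \<Longrightarrow>
    linear_on (scl V) s (hcomp V i) (\<lambda>x. \<phi> (us @ x # ws))"
  shows "multihomogeneous V s \<phi>"
  using assms unfolding multihomogeneous_def linear_on_def by blast

lemma mhD:
  assumes "multihomogeneous V s \<phi>" "us \<in> lists (homog V)" "ws \<in> lists (homog V)"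
  shows "linear_on (scl V) s (hcomp V i) (\<lambda>x. \<phi> (us @ x # ws))"
  using assms unfolding multihomogeneous_def linear_on_def by blast

lemma mh_cong:
  assumes \<psi>: "multihomogeneous V s \<psi>"
    and eq: "\<And>xs. xs \<in> lists (homog V) \<Longrightarrow> xs \<noteq> [] \<Longrightarrow> \<phi> xs = \<psi> xs"
  shows "multihomogeneous V s \<phi>"
proof (rule mhI)
  fix us ws i
  assume us: "us \<in> lists (homog V)" and ws: "ws \<in> lists (homog V)"
  have "linear_on (scl V) s (hcomp V i) (\<lambda>x. \<phi> (us @ x # ws)) \<longleftrightarrow>
      linear_on (scl V) s (hcomp V i) (\<lambda>x. \<psi> (us @ x # ws))"
    by (rule linear_on_cong[OF comp_subspace vector_space], rule eq)
      (use us ws in \<open>auto simp: hcomp_homog\<close>)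
  then show "linear_on (scl V) s (hcomp V i) (\<lambda>x. \<phi> (us @ x # ws))"
    using mhD[OF \<psi> us ws] by simp
qed

lemma mh_zero:
  assumes "vector_space s" "multihomogeneous V s \<phi>" "xs \<in> lists (homog V)" "0 \<in> set xs"
  shows "\<phi> xs = 0"
proof -
  obtain us ws where xs: "xs = us @ 0 # ws"
    using split_list[OF assms(4)] by blast
  then show ?thesis
    using linear_on_zero[OF vector_space assms(1) mhD[OF assms(2)] comp_subspace] assms(3) by auto
qed

text \<open>
  Coefficients may depend on the degrees of the entries, for instance through signs.
\<close>

lemma mh_deg:
  assumes s: "vector_space s" and \<psi>: "\<And>ds. multihomogeneous V s (\<psi> ds)"
  shows "multihomogeneous V s (\<lambda>xs. \<psi> (map (deg V) xs) xs)"
proof (rule mhI)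
  fix us ws i
  assume us: "us \<in> lists (homog V)" and ws: "ws \<in> lists (homog V)"
  show "linear_on (scl V) s (hcomp V i) (\<lambda>x. \<psi> (map (deg V) (us @ x # ws)) (us @ x # ws))"
    using linear_on_deg[OF s, of i "\<lambda>d x. \<psi> (map (deg V) us @ d # map (deg V) ws) (us @ x # ws)"]
      mhD[OF \<psi> us ws] by simp
qed

lemma mh_lin:
  assumes "multihomogeneous V s \<phi>" "\<And>xs. xs \<in> lists (homog V) \<Longrightarrow> \<phi> xs \<in> S" "linear_on s t S f"
  shows "multihomogeneous V t (\<lambda>xs. f (\<phi> xs))"
proof (rule mhI)
  fix us ws i
  assume us: "us \<in> lists (homog V)" and ws: "ws \<in> lists (homog V)"
  show "linear_on (scl V) t (hcomp V i) (\<lambda>x. f (\<phi> (us @ x # ws)))"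
    by (rule linear_on_compose[OF mhD[OF assms(1) us ws] _ assms(3)])
      (use us ws in \<open>auto intro!: assms simp: hcomp_homog\<close>)
qed

lemma mh_scale:
  assumes "vector_space s" "multihomogeneous V s \<phi>"
  shows "multihomogeneous V s (\<lambda>xs. s c (\<phi> xs))"
  by (rule mhI, rule linear_on_scaled, rule assms, rule mhD[OF assms(2)])

lemma mh_sum:
  assumes "vector_space s" "\<And>i. i \<in> I \<Longrightarrow> multihomogeneous V s (\<phi> i)"
  shows "multihomogeneous V s (\<lambda>xs. \<Sum>i\<in>I. \<phi> i xs)"
  by (rule mhI, rule linear_on_sum, rule assms, rule mhD[OF assms(2)])

lemma mh_const0:
  assumes "vector_space s"
  shows "multihomogeneous V s (\<lambda>xs. 0)"
  by (rule mhI, rule linear_on_const0[OF assms])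

lemma mh_append:
  assumes "multihomogeneous V s \<phi>" "ps \<in> lists (homog V)" "qs \<in> lists (homog V)"
  shows "multihomogeneous V s (\<lambda>xs. \<phi> (ps @ xs @ qs))"
proof (rule mhI)
  fix us ws i
  assume "us \<in> lists (homog V)" and "ws \<in> lists (homog V)"
  then show "linear_on (scl V) s (hcomp V i) (\<lambda>x. \<phi> (ps @ (us @ x # ws) @ qs))"
    using mhD[OF assms(1), of "ps @ us" "ws @ qs" i] assms by simp
qed

text \<open>Multihomogeneity may be checked in each part of a splitting separately.\<close>

lemma mh_split_sum:
  assumes s: "vector_space s"
    and l: "\<And>y e. y \<in> homog V \<Longrightarrow> e \<in> lists (homog V) \<Longrightarrow> multihomogeneous V s (\<lambda>c. F c y e)"
    and m: "\<And>c e i. c \<in> lists (homog V) \<Longrightarrow> e \<in> lists (homog V) \<Longrightarrow>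
      linear_on (scl V) s (hcomp V i) (\<lambda>y. F c y e)"
    and r: "\<And>c y. c \<in> lists (homog V) \<Longrightarrow> y \<in> homog V \<Longrightarrow> multihomogeneous V s (\<lambda>e. F c y e)"
  shows "multihomogeneous V s (split_sum F)"
proof (rule mhI)
  fix us ws i
  assume us: "us \<in> lists (homog V)" and ws: "ws \<in> lists (homog V)"
  have "split_sum F (us @ x # ws) = (\<Sum>i<length us. F (take i us) (us ! i) (drop (Suc i) us @ x # ws))
     + (F us x ws + (\<Sum>i<length ws. F (us @ x # take i ws) (ws ! i) (drop (Suc i) ws)))" for x
    by (simp add: split_sum_append split_sum_Cons) (simp add: split_sum_def)
  moreover have "linear_on (scl V) s (hcomp V i) (\<lambda>x. (\<Sum>i<length us. F (take i us) (us ! i) (drop (Suc i) us @ x # ws))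
     + (F us x ws + (\<Sum>i<length ws. F (us @ x # take i ws) (ws ! i) (drop (Suc i) ws))))"
    using us ws
    by (intro linear_on_plus linear_on_sum s m mhD[OF r] mhD[OF l])
      (auto dest: in_set_takeD in_set_dropD)
  ultimately show "linear_on (scl V) s (hcomp V i) (\<lambda>x. split_sum F (us @ x # ws))"
    by simp
qed

lemma mh_split_sum_param:
  assumes "vector_space s" "\<And>a x b. v = a @ x # b \<Longrightarrow> multihomogeneous V s (F a x b)"
  shows "multihomogeneous V s (\<lambda>w. split_sum (\<lambda>a x b. F a x b w) v)"
  unfolding split_sum_def by (rule mh_sum[OF assms(1)], rule assms(2)) (simp add: id_take_nth_drop)

lemma mh_word: "multihomogeneous V tscale (word V)"
proof (rule mhI)
  fix us ws i
  assume "us \<in> lists (homog V)" and "ws \<in> lists (homog V)"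
  then have "us \<in> lists (carr V)" "ws \<in> lists (carr V)"
    by (auto simp: homog_carr)
  then show "linear_on (scl V) tscale (hcomp V i) (\<lambda>x. word V (us @ x # ws))"
    by (auto simp: linear_on_def word_def fun_eq_iff tscale_def multilinear_form_def hcomp_carr)
qed

lemma word_linear_on:
  assumes "us \<in> lists (carr V)" "ws \<in> lists (carr V)"
  shows "linear_on (scl V) tscale (carr V) (\<lambda>x. word V (us @ x # ws))"
  using assms by (auto simp: linear_on_def word_def fun_eq_iff tscale_def multilinear_form_def)

end


section \<open>The tensor algebra\<close>

text \<open>The underlying vector space of \<open>T(V)\<close>; it contains all powers \<open>V\<^sup>\<otimes>\<^sup>r\<close>.\<close>

definition tens :: "('k::field, 'v::ab_group_add, 'z) gspace_scheme \<Rightarrow> ('k, 'v) tensor set"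
  where "tens V = TS.span (word V ` lists (homog V))"

lemma tens_subspace: "TS.subspace (tens V)"
  by (simp add: tens_def)

lemma tens_add: "x \<in> tens V \<Longrightarrow> y \<in> tens V \<Longrightarrow> x + y \<in> tens V"
  by (simp add: tens_def TS.span_add)

lemma tens_scale: "x \<in> tens V \<Longrightarrow> tscale c x \<in> tens V"
  by (simp add: tens_def TS.span_scale)

lemma tens_0 [simp]: "0 \<in> tens V"
  by (simp add: tens_def TS.span_zero)

lemma word_tens: "xs \<in> lists (homog V) \<Longrightarrow> word V xs \<in> tens V"
  by (simp add: tens_def TS.span_base)

text \<open>Lists of nonzero homogeneous elements, whose degrees are determined.\<close>

definition nzl :: "('k::field, 'v::ab_group_add, 'z) gspace_scheme \<Rightarrow> 'v list set"
  where "nzl V = lists (homog V - {0})"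

lemma nzl_simps [simp]:
  "[] \<in> nzl V" "x # xs \<in> nzl V \<longleftrightarrow> x \<in> homog V \<and> x \<noteq> 0 \<and> xs \<in> nzl V"
  "us @ ws \<in> nzl V \<longleftrightarrow> us \<in> nzl V \<and> ws \<in> nzl V"
  by (auto simp: nzl_def)

lemma nzl_homog: "xs \<in> nzl V \<Longrightarrow> xs \<in> lists (homog V)"
  by (auto simp: nzl_def)

lemma wdeg_simps [simp]:
  "wdeg V [] = 0" "wdeg V (x # xs) = deg V x + wdeg V xs" "wdeg V (us @ ws) = wdeg V us + wdeg V ws"
  by (simp_all add: wdeg_def)

lemma wdeg_deg: "wdeg V xs = sum_list (map (deg V) xs)"
  by (simp add: wdeg_def)

context graded_space
begin

lemma mh_wdeg:
  assumes "vector_space s" "\<And>d. multihomogeneous V s (\<psi> d)"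
  shows "multihomogeneous V s (\<lambda>xs. \<psi> (wdeg V xs) xs)"
  using mh_deg[OF assms(1), of "\<lambda>ds. \<psi> (sum_list ds)"] assms(2) by (simp add: wdeg_def)

lemma tens_explicit:
  assumes "x \<in> tens V"
  obtains S c where "finite S" "S \<subseteq> lists (homog V)" "x = (\<Sum>xs\<in>S. tscale (c xs) (word V xs))"
proof -
  obtain t r where t: "finite t" "t \<subseteq> word V ` lists (homog V)" and x: "x = (\<Sum>a\<in>t. tscale (r a) a)"
    using assms unfolding tens_def TS.span_explicit by blast
  define S where "S = inv_into (lists (homog V)) (word V) ` t"
  have inj: "inj_on (inv_into (lists (homog V)) (word V)) t"
    using inj_on_inv_into[OF t(2)] .
  have "x = (\<Sum>a\<in>t. tscale (r (word V (inv_into (lists (homog V)) (word V) a)))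
      (word V (inv_into (lists (homog V)) (word V) a)))"
    unfolding x by (rule sum.cong) (use t(2) in \<open>auto simp: f_inv_into_f subset_iff\<close>)
  also have "\<dots> = (\<Sum>xs\<in>S. tscale (r (word V xs)) (word V xs))"
    unfolding S_def by (simp add: sum.reindex[OF inj])
  finally have eq: "x = (\<Sum>xs\<in>S. tscale (r (word V xs)) (word V xs))" .
  have "inv_into (lists (homog V)) (word V) a \<in> lists (homog V)" if "a \<in> t" for a
    using that t(2) by (intro inv_into_into) blast
  then have "S \<subseteq> lists (homog V)"
    unfolding S_def by blast
  then show ?thesis
    using that[OF _ _ eq] t(1) by (simp add: S_def)
qed

lemma lift_cong:
  assumes "\<And>xs. xs \<in> lists (homog V) \<Longrightarrow> \<phi> xs = \<psi> xs"
  shows "lift V s \<phi> = lift V s \<psi>"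
proof -
  have "(\<Sum>xs\<in>S. s (c xs) (\<phi> xs)) = (\<Sum>xs\<in>S. s (c xs) (\<psi> xs))" if "S \<subseteq> lists (homog V)" for S c
    using that assms by (intro sum.cong refl) (metis subsetD)
  then have "(finite S \<and> S \<subseteq> lists (homog V) \<and>
      x = (\<Sum>xs\<in>S. tscale (c xs) (word V xs)) \<and> y = (\<Sum>xs\<in>S. s (c xs) (\<phi> xs))) =
    (finite S \<and> S \<subseteq> lists (homog V) \<and>
      x = (\<Sum>xs\<in>S. tscale (c xs) (word V xs)) \<and> y = (\<Sum>xs\<in>S. s (c xs) (\<psi> xs)))" for S c x y
    by (cases "S \<subseteq> lists (homog V)") (simp_all only: simp_thms)
  then show ?thesis
    unfolding lift_def fun_eq_iff by (simp only: simp_thms)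
qed

lemma lift_linear_on:
  assumes s: "vector_space s" and \<phi>: "multihomogeneous V s \<phi>"
  shows "linear_on tscale s (tens V) (lift V s \<phi>)"
proof -
  interpret s: vector_space s by (rule s)
  have diff: "lift V s \<phi> (x - y) = lift V s \<phi> x - lift V s \<phi> y" if xy: "x \<in> tens V" "y \<in> tens V" for x y
  proof -
    obtain S c where S: "finite S" "S \<subseteq> lists (homog V)" "x = (\<Sum>xs\<in>S. tscale (c xs) (word V xs))"
      using tens_explicit[OF xy(1)] .
    obtain S' c' where S': "finite S'" "S' \<subseteq> lists (homog V)" "y = (\<Sum>xs\<in>S'. tscale (c' xs) (word V xs))"
      using tens_explicit[OF xy(2)] .
    define e where "e xs = (if xs \<in> S then c xs else 0) - (if xs \<in> S' then c' xs else 0)" for xs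
    note ext = sum_difference[OF _ S(1) S'(1), of _ c c', folded e_def]
    show ?thesis
      unfolding S(3) S'(3)
      using S(1,2) S'(1,2)
      by (simp add: lift_sum[OF s \<phi>] flip: ext[OF vector_space_tscale] ext[OF s])
  qed
  show ?thesis
  proof (rule linear_onI)
    fix x y assume xy: "x \<in> tens V" "y \<in> tens V"
    show "lift V s \<phi> (x + y) = lift V s \<phi> x + lift V s \<phi> y"
      using diff[of "x + y" y] xy by (simp add: tens_add algebra_simps)
  next
    fix c x assume x: "x \<in> tens V"
    obtain S r where S: "finite S" "S \<subseteq> lists (homog V)" "x = (\<Sum>xs\<in>S. tscale (r xs) (word V xs))"
      using tens_explicit[OF x] .
    have "tscale c x = (\<Sum>xs\<in>S. tscale (c * r xs) (word V xs))"
      by (simp add: S(3) TS.scale_sum_right)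
    then show "lift V s \<phi> (tscale c x) = s c (lift V s \<phi> x)"
      using S(1,2) by (simp add: lift_sum[OF s \<phi>] s.scale_sum_right S(3))
  qed
qed

lemma lift_word:
  assumes s: "vector_space s" and \<phi>: "multihomogeneous V s \<phi>" and xs: "xs \<in> lists (homog V)"
  shows "lift V s \<phi> (word V xs) = \<phi> xs"
proof -
  interpret s: vector_space s by (rule s)
  show ?thesis
    using lift_sum[OF s \<phi>, of "{xs}" "\<lambda>_. 1"] xs by simp
qed

lemma tens_eqI:
  assumes "vector_space t" "linear_on tscale t (tens V) f" "linear_on tscale t (tens V) g"
    and "\<And>xs. xs \<in> lists (homog V) \<Longrightarrow> f (word V xs) = g (word V xs)" and "x \<in> tens V"
  shows "f x = g x"
  using linear_on_span_eq[OF vsT assms(1), of "word V ` lists (homog V)" f g x] assms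
  by (auto simp: tens_def)

lemma tens_inI:
  assumes "vector_space t" "linear_on tscale t (tens V) f" "module.subspace t W"
    and "\<And>xs. xs \<in> lists (homog V) \<Longrightarrow> f (word V xs) \<in> W" and "x \<in> tens V"
  shows "f x \<in> W"
  using linear_on_span_in[OF vsT assms(1), of "word V ` lists (homog V)" f W x] assms
  by (auto simp: tens_def)

lemma lift_in:
  assumes "vector_space t" "multihomogeneous V t \<phi>" "module.subspace t W"
    and "\<And>xs. xs \<in> lists (homog V) \<Longrightarrow> \<phi> xs \<in> W" and "x \<in> tens V"
  shows "lift V t \<phi> x \<in> W"
  by (rule tens_inI[OF assms(1) lift_linear_on[OF assms(1,2)] assms(3)])
    (simp_all add: lift_word assms)

text \<open>If the formula depends linearly on a parameter \<open>y\<close>, then so does its extension.\<close>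

lemma lift_param:
  assumes s: "vector_space s" and r: "vector_space r" and S: "module.subspace r S"
    and \<phi>: "\<And>y. y \<in> S \<Longrightarrow> multihomogeneous V s (\<phi> y)"
    and lin: "\<And>xs. xs \<in> lists (homog V) \<Longrightarrow> linear_on r s S (\<lambda>y. \<phi> y xs)"
    and x: "x \<in> tens V"
  shows "linear_on r s S (\<lambda>y. lift V s (\<phi> y) x)"
proof -
  interpret s: vector_space s by (rule s)
  interpret r: vector_space r by (rule r)
  obtain T c where T: "finite T" "T \<subseteq> lists (homog V)" "x = (\<Sum>xs\<in>T. tscale (c xs) (word V xs))"
    using tens_explicit[OF x] .
  have eq: "lift V s (\<phi> y) x = (\<Sum>xs\<in>T. s (c xs) (\<phi> y xs))" if "y \<in> S" for y
    unfolding T(3) by (rule lift_sum[OF s \<phi>[OF that] T(1,2)])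
  have "linear_on r s S (\<lambda>y. \<Sum>xs\<in>T. s (c xs) (\<phi> y xs))"
    by (intro linear_on_sum linear_on_scaled s lin) (use T in auto)
  then show ?thesis
    using linear_on_cong[OF S r, of "\<lambda>y. lift V s (\<phi> y) x", OF eq] by simp
qed

lemma mh_lift:
  assumes s: "vector_space s"
    and \<phi>: "\<And>xs. xs \<in> lists (homog V) \<Longrightarrow> multihomogeneous V s (\<phi> xs)"
    and lin: "\<And>ws. ws \<in> lists (homog V) \<Longrightarrow> multihomogeneous V s (\<lambda>xs. \<phi> xs ws)"
    and x: "x \<in> tens V"
  shows "multihomogeneous V s (\<lambda>xs. lift V s (\<phi> xs) x)"
proof (rule mhI)
  fix us ws i
  assume us: "us \<in> lists (homog V)" and ws: "ws \<in> lists (homog V)"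
  show "linear_on (scl V) s (hcomp V i) (\<lambda>y. lift V s (\<phi> (us @ y # ws)) x)"
    by (rule lift_param[OF s vector_space comp_subspace _ _ x])
      (use us ws mhD[OF lin us ws] in \<open>auto intro!: \<phi> simp: hcomp_homog\<close>)
qed


subsection \<open>Grading\<close>

lemma list_all2_nzl:
  assumes "list_all2 (\<lambda>x d. x \<in> hcomp V d) xs ds"
  shows "xs \<in> lists (homog V)" "0 \<notin> set xs \<Longrightarrow> xs \<in> nzl V \<and> wdeg V xs = sum_list ds"
  using assms by (induction rule: list_all2_induct) (auto simp: hcomp_homog deg_eq)

lemma nzl_list_all2: "xs \<in> nzl V \<Longrightarrow> list_all2 (\<lambda>x d. x \<in> hcomp V d) xs (map (deg V) xs)"
  by (induction xs) (auto simp: homog_def deg_eq)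

lemma word_eq_0: "xs \<in> lists (homog V) \<Longrightarrow> 0 \<in> set xs \<Longrightarrow> word V xs = 0"
  by (rule mh_zero[OF vsT mh_word])

text \<open>
  Words with an entry \<open>0\<close> vanish, so the components are spanned by the words in nonzero elements,
  whose degree can be read off with \<open>wdeg\<close>.
\<close>

lemma span_word_nzl:
  "TS.span {word V xs | xs ds. Q (length xs) \<and> list_all2 (\<lambda>x d. x \<in> hcomp V d) xs ds \<and> sum_list ds = i} =
    TS.span (word V ` {xs \<in> nzl V. Q (length xs) \<and> wdeg V xs = i})" (is "TS.span ?A = TS.span ?B")
proof (rule antisym)
  have "?B \<subseteq> ?A"
  proof
    fix t assume "t \<in> ?B"
    then obtain xs where "xs \<in> nzl V" "t = word V xs" "Q (length xs)" "wdeg V xs = i"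
      by blast
    then show "t \<in> ?A"
      using nzl_list_all2[of xs] by (auto simp: wdeg_deg intro!: exI[of _ xs] exI[of _ "map (deg V) xs"])
  qed
  then show "TS.span ?B \<subseteq> TS.span ?A"
    by (rule TS.span_mono)
  have "?A \<subseteq> TS.span ?B"
  proof
    fix t assume "t \<in> ?A"
    then obtain xs ds where t: "t = word V xs" "Q (length xs)"
      and ds: "list_all2 (\<lambda>x d. x \<in> hcomp V d) xs ds" "sum_list ds = i"
      by blast
    show "t \<in> TS.span ?B"
    proof (cases "0 \<in> set xs")
      case True
      then show ?thesis
        using t word_eq_0 list_all2_nzl(1)[OF ds(1)] by (simp add: TS.span_zero)
    next
      case False
      then show ?thesis
        using t ds list_all2_nzl(2)[OF ds(1)] by (auto intro!: TS.span_base)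
    qed
  qed
  then show "TS.span ?A \<subseteq> TS.span ?B"
    by (simp add: TS.span_minimal)
qed

lemma hcomp_tensor_algebra:
  "hcomp (tensor_algebra V) i = TS.span (word V ` {xs \<in> nzl V. wdeg V xs = i})"
  using span_word_nzl[of "\<lambda>_. True" i]
  by (simp only: tensor_algebra_def gspace.select_convs simp_thms)

lemma hcomp_tensor_power:
  "hcomp (tensor_power r V) i = TS.span (word V ` {xs \<in> nzl V. length xs = r \<and> wdeg V xs = i})"
  using span_word_nzl[of "\<lambda>l. l = r" i]
  by (simp only: tensor_power_def gspace.select_convs)

lemma word_hcomp:
  assumes "list_all2 (\<lambda>x d. x \<in> hcomp V d) xs ds"
  shows "word V xs \<in> hcomp (tensor_algebra V) (sum_list ds)"
    "word V xs \<in> hcomp (tensor_power (length xs) V) (sum_list ds)"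
  using assms by (auto simp: tensor_algebra_def tensor_power_def intro!: TS.span_base)

lemma word_nzl_hcomp: "xs \<in> nzl V \<Longrightarrow> word V xs \<in> hcomp (tensor_algebra V) (wdeg V xs)"
  by (auto simp: hcomp_tensor_algebra intro: TS.span_base)

lemma word2_carr:
  assumes "x \<in> homog V" "y \<in> homog V"
  shows "word V [x, y] \<in> carr (tensor_power 2 V)"
proof -
  from assms obtain i j where "x \<in> hcomp V i" "y \<in> hcomp V j"
    by (auto simp: homog_def)
  then have "word V [x, y] \<in> hcomp (tensor_power 2 V) (i + j)"
    using word_hcomp(2)[of "[x, y]" "[i, j]"] by (simp add: numeral_2_eq_2)
  then show ?thesis
    by (auto simp: carr_def homog_def tensor_power_def intro!: TS.span_base)
qed

lemma hcomp_tensor_algebra_tens: "hcomp (tensor_algebra V) i \<subseteq> tens V"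
  unfolding hcomp_tensor_algebra tens_def by (rule TS.span_mono) (auto simp: nzl_homog)

lemma span_nzl_tens: "TS.span (word V ` {xs \<in> nzl V. wdeg V xs = i}) \<subseteq> tens V"
  using hcomp_tensor_algebra_tens[of i] by (simp add: hcomp_tensor_algebra)

lemma hcomp_tensor_power_tens: "hcomp (tensor_power r V) i \<subseteq> tens V"
  unfolding hcomp_tensor_power tens_def by (rule TS.span_mono) (auto simp: nzl_homog)

lemma word_homog_tensor_algebra:
  assumes "xs \<in> lists (homog V)" shows "word V xs \<in> homog (tensor_algebra V)"
proof (cases "0 \<in> set xs")
  case True
  then show ?thesis
    using word_eq_0[OF assms] by (auto simp: homog_def hcomp_tensor_algebra intro: TS.span_zero)
next
  case False
  then have "xs \<in> nzl V"
    using assms by (auto simp: nzl_def)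
  then show ?thesis
    using word_nzl_hcomp by (auto simp: homog_def)
qed

lemma scl_tensor [simp]: "scl (tensor_algebra V) = tscale" "scl (tensor_power r V) = tscale"
  by (simp_all add: tensor_algebra_def tensor_power_def)

lemma carr_tensor_algebra: "carr (tensor_algebra V) = tens V"
proof (rule antisym)
  have "homog (tensor_algebra V) \<subseteq> tens V"
    using hcomp_tensor_algebra_tens by (auto simp only: homog_def)
  then show "carr (tensor_algebra V) \<subseteq> tens V"
    unfolding carr_def scl_tensor by (rule TS.span_minimal[OF _ tens_subspace])
  have "word V ` lists (homog V) \<subseteq> homog (tensor_algebra V)"
    using word_homog_tensor_algebra by blast
  then show "tens V \<subseteq> carr (tensor_algebra V)"
    unfolding carr_def tens_def scl_tensor by (rule TS.span_mono)
qed

lemma carr_tensor_power: "carr (tensor_power r V) \<subseteq> tens V"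
proof -
  have "homog (tensor_power r V) \<subseteq> tens V"
    using hcomp_tensor_power_tens by (auto simp only: homog_def)
  then show ?thesis
    unfolding carr_def scl_tensor by (rule TS.span_minimal[OF _ tens_subspace])
qed

text \<open>Projections onto the components of \<open>T(V)\<close> show that their sum is direct.\<close>

lemma graded_tensor_algebra: "graded_space (tensor_algebra V)"
proof (rule graded_space.intro)
  show "vector_space (scl (tensor_algebra V))"
    by (simp add: tensor_algebra_def vsT)
  show "module.subspace (scl (tensor_algebra V)) (hcomp (tensor_algebra V) i)" for i
    by (simp add: hcomp_tensor_algebra)
  fix x i
  assume x: "\<And>i. x i \<in> hcomp (tensor_algebra V) i" and fin: "finite {i. x i \<noteq> 0}"
    and sum: "(\<Sum>i | x i \<noteq> 0. x i) = 0"
  \<comment> \<open>The extension of \<open>\<phi>\<close> is the projection onto the component of degree \<open>i\<close>.\<close>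
  define \<phi> where "\<phi> xs = (if wdeg V xs = i then word V xs else 0)" for xs
  have "multihomogeneous V tscale (\<lambda>xs. if d = i then word V xs else 0)" for d
    by (cases "d = i") (simp_all add: mh_word mh_const0[OF vsT])
  then have mh: "multihomogeneous V tscale \<phi>"
    unfolding \<phi>_def by (rule mh_wdeg[OF vsT])
  note lin = lift_linear_on[OF vsT mh]
  have p: "lift V tscale \<phi> (x j) = (if j = i then x j else 0)" for j
  proof -
    have lin2: "linear_on tscale tscale (tens V) (\<lambda>y. if j = i then y else 0)"
      by (cases "j = i") (simp_all add: linear_on_id linear_on_const0[OF vsT])
    show ?thesis
    proof (rule linear_on_span_eq[OF vsT vsT linear_on_subset[OF lin span_nzl_tens]
          linear_on_subset[OF lin2 span_nzl_tens] _ x[of j, unfolded hcomp_tensor_algebra]])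
      fix b assume "b \<in> word V ` {xs \<in> nzl V. wdeg V xs = j}"
      then obtain xs where xs: "xs \<in> nzl V" "wdeg V xs = j" and b: "b = word V xs"
        by blast
      show "lift V tscale \<phi> b = (if j = i then b else 0)"
        unfolding b lift_word[OF vsT mh nzl_homog[OF xs(1)]] \<phi>_def xs(2) by (rule refl)
    qed
  qed
  have "lift V tscale \<phi> (\<Sum>j\<in>J. x j) = (\<Sum>j\<in>J. lift V tscale \<phi> (x j)) \<and> (\<Sum>j\<in>J. x j) \<in> tens V"
    if "finite J" for J
    using that
  proof (induction J rule: finite_induct)
    case empty
    show ?case
      unfolding sum.empty using linear_on_zero[OF vsT vsT lin tens_subspace] tens_0 by blast
  next
    case (insert j J)
    have "x j \<in> tens V"
      using x[of j] hcomp_tensor_algebra_tens[of j] by blast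
    then show ?case
      using insert.IH unfolding sum.insert[OF insert.hyps]
      by (metis linear_on_add[OF lin] tens_add)
  qed
  note add = this[OF fin, THEN conjunct1]
  have "lift V tscale \<phi> 0 = (\<Sum>j | x j \<noteq> 0. lift V tscale \<phi> (x j))"
    by (rule trans[OF arg_cong[OF sum[symmetric], of "lift V tscale \<phi>"] add])
  also have "\<dots> = (\<Sum>j | x j \<noteq> 0. if j = i then x j else 0)"
    by (intro sum.cong refl p)
  also have "\<dots> = (if i \<in> {i. x i \<noteq> 0} then x i else 0)"
    by (rule sum.delta[OF fin])
  also have "\<dots> = x i"
    by simp
  finally show "x i = 0"
    using linear_on_zero[OF vsT vsT lin tens_subspace] by (rule trans[OF sym])
qed


subsection \<open>Multiplication\<close>

lemma mh_tmul_aux: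
  assumes "us \<in> lists (homog V)"
  shows "multihomogeneous V tscale (\<lambda>ws. word V (us @ ws))"
  using mh_append[OF mh_word assms, of "[]"] by simp

lemma mh_tmul_aux2:
  assumes "y \<in> tens V"
  shows "multihomogeneous V tscale (\<lambda>us. lift V tscale (\<lambda>ws. word V (us @ ws)) y)"
proof (rule mh_lift[OF vsT mh_tmul_aux _ assms])
  show "multihomogeneous V tscale (\<lambda>us. word V (us @ ws))" if "ws \<in> lists (homog V)" for ws
    using mh_append[OF mh_word _ that, of "[]"] by simp
qed

lemma tmul_left: "y \<in> tens V \<Longrightarrow> linear_on tscale tscale (tens V) (\<lambda>x. tmul V x y)"
  unfolding tmul_def by (rule lift_linear_on[OF vsT mh_tmul_aux2])

lemma tmul_right: "x \<in> tens V \<Longrightarrow> linear_on tscale tscale (tens V) (\<lambda>y. tmul V x y)"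
  unfolding tmul_def
  by (rule lift_param[OF vsT vsT tens_subspace mh_tmul_aux2])
    (simp_all add: lift_linear_on[OF vsT mh_tmul_aux])

lemma tmul_word [simp]:
  "us \<in> lists (homog V) \<Longrightarrow> ws \<in> lists (homog V) \<Longrightarrow> tmul V (word V us) (word V ws) = word V (us @ ws)"
  unfolding tmul_def by (simp add: lift_word[OF vsT mh_tmul_aux2] lift_word[OF vsT mh_tmul_aux] word_tens)

lemma tmul_tens:
  assumes x: "x \<in> tens V" and y: "y \<in> tens V"
  shows "tmul V x y \<in> tens V"
proof (rule tens_inI[OF vsT tmul_left[OF y] tens_subspace _ x])
  fix us assume us: "us \<in> lists (homog V)"
  show "tmul V (word V us) y \<in> tens V"
    by (rule tens_inI[OF vsT tmul_right[OF word_tens[OF us]] tens_subspace _ y])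
      (use us in \<open>simp add: word_tens\<close>)
qed

lemma tmul_add_left: "x \<in> tens V \<Longrightarrow> x' \<in> tens V \<Longrightarrow> y \<in> tens V \<Longrightarrow>
    tmul V (x + x') y = tmul V x y + tmul V x' y"
  using linear_on_add[OF tmul_left] by blast

lemma tmul_add_right: "x \<in> tens V \<Longrightarrow> y \<in> tens V \<Longrightarrow> y' \<in> tens V \<Longrightarrow>
    tmul V x (y + y') = tmul V x y + tmul V x y'"
  using linear_on_add[OF tmul_right] by blast

lemma tmul_scale_left: "x \<in> tens V \<Longrightarrow> y \<in> tens V \<Longrightarrow> tmul V (tscale c x) y = tscale c (tmul V x y)"
  using linear_on_scale[OF tmul_left] by blast

lemma tmul_scale_right: "x \<in> tens V \<Longrightarrow> y \<in> tens V \<Longrightarrow> tmul V x (tscale c y) = tscale c (tmul V x y)"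
  using linear_on_scale[OF tmul_right] by blast

lemma tmul_0_left: "y \<in> tens V \<Longrightarrow> tmul V 0 y = 0"
  using linear_on_zero[OF vsT vsT tmul_left tens_subspace] by blast

lemma tmul_0_right: "x \<in> tens V \<Longrightarrow> tmul V x 0 = 0"
  using linear_on_zero[OF vsT vsT tmul_right tens_subspace] by blast

lemma tmul_assoc:
  assumes x: "x \<in> tens V" and y: "y \<in> tens V" and z: "z \<in> tens V"
  shows "tmul V (tmul V x y) z = tmul V x (tmul V y z)"
proof (rule tens_eqI[OF vsT _ _ _ x])
  show "linear_on tscale tscale (tens V) (\<lambda>x. tmul V (tmul V x y) z)"
    by (rule linear_on_compose[OF tmul_left[OF y] _ tmul_left[OF z]]) (simp add: tmul_tens y)
  show "linear_on tscale tscale (tens V) (\<lambda>x. tmul V x (tmul V y z))"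
    by (intro tmul_left tmul_tens y z)
  fix us assume us: "us \<in> lists (homog V)"
  show "tmul V (tmul V (word V us) y) z = tmul V (word V us) (tmul V y z)"
  proof (rule tens_eqI[OF vsT _ _ _ y])
    show "linear_on tscale tscale (tens V) (\<lambda>y. tmul V (tmul V (word V us) y) z)"
      by (rule linear_on_compose[OF tmul_right _ tmul_left[OF z]]) (simp_all add: tmul_tens us word_tens)
    show "linear_on tscale tscale (tens V) (\<lambda>y. tmul V (word V us) (tmul V y z))"
      by (rule linear_on_compose[OF tmul_left[OF z] _ tmul_right]) (simp_all add: tmul_tens us z word_tens)
    fix vs assume vs: "vs \<in> lists (homog V)"
    show "tmul V (tmul V (word V us) (word V vs)) z = tmul V (word V us) (tmul V (word V vs) z)"
    proof (rule tens_eqI[OF vsT _ _ _ z])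
      show "linear_on tscale tscale (tens V) (\<lambda>z. tmul V (tmul V (word V us) (word V vs)) z)"
        by (intro tmul_right tmul_tens us vs word_tens)
      show "linear_on tscale tscale (tens V) (\<lambda>z. tmul V (word V us) (tmul V (word V vs) z))"
        by (rule linear_on_compose[OF tmul_right _ tmul_right]) (simp_all add: tmul_tens us vs word_tens)
    qed (use us vs in simp)
  qed
qed

lemma tmul_unit_left: "x \<in> tens V \<Longrightarrow> tmul V (word V []) x = x"
  by (rule tens_eqI[OF vsT tmul_right linear_on_id]) (simp_all add: word_tens)

lemma tmul_unit_right: "x \<in> tens V \<Longrightarrow> tmul V x (word V []) = x"
  by (rule tens_eqI[OF vsT tmul_left linear_on_id]) (simp_all add: word_tens)

lemma hcomp_eqI:
  assumes "vector_space t" "linear_on tscale t (tens V) f" "linear_on tscale t (tens V) g"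
    and "\<And>xs. xs \<in> nzl V \<Longrightarrow> wdeg V xs = i \<Longrightarrow> f (word V xs) = g (word V xs)"
    and "x \<in> hcomp (tensor_algebra V) i"
  shows "f x = g x"
  by (rule linear_on_span_eq[OF vsT assms(1) linear_on_subset[OF assms(2) span_nzl_tens]
      linear_on_subset[OF assms(3) span_nzl_tens] _ assms(5)[unfolded hcomp_tensor_algebra]])
    (auto simp: assms(4))

lemma hcomp_inI:
  assumes "vector_space t" "linear_on tscale t (tens V) f" "module.subspace t W"
    and "\<And>xs. xs \<in> nzl V \<Longrightarrow> wdeg V xs = i \<Longrightarrow> f (word V xs) \<in> W"
    and "x \<in> hcomp (tensor_algebra V) i"
  shows "f x \<in> W"
  by (rule linear_on_span_in[OF vsT assms(1) linear_on_subset[OF assms(2) span_nzl_tens]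
      assms(3) _ assms(5)[unfolded hcomp_tensor_algebra]])
    (auto simp: assms(4))

lemma tensor_algebra_subspace: "TS.subspace (hcomp (tensor_algebra V) i)"
  by (simp add: hcomp_tensor_algebra)

lemma tensor_power_subspace: "TS.subspace (hcomp (tensor_power r V) i)"
  by (simp add: hcomp_tensor_power)

lemma tmul_hcomp:
  assumes x: "x \<in> hcomp (tensor_algebra V) i" and y: "y \<in> hcomp (tensor_algebra V) j"
  shows "tmul V x y \<in> hcomp (tensor_algebra V) (i + j)"
proof (rule hcomp_inI[OF vsT tmul_left tensor_algebra_subspace _ x])
  show "y \<in> tens V"
    using y hcomp_tensor_algebra_tens by blast
  fix us assume us: "us \<in> nzl V" "wdeg V us = i"
  show "tmul V (word V us) y \<in> hcomp (tensor_algebra V) (i + j)"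
  proof (rule hcomp_inI[OF vsT tmul_right tensor_algebra_subspace _ y])
    show "word V us \<in> tens V"
      using us by (simp add: nzl_homog word_tens)
    fix ws assume "ws \<in> nzl V" "wdeg V ws = j"
    then show "tmul V (word V us) (word V ws) \<in> hcomp (tensor_algebra V) (i + j)"
      using us word_nzl_hcomp[of "us @ ws"] by (simp add: nzl_homog)
  qed
qed

end


context graded_space
begin

section \<open>Maps on tensor powers\<close>

text \<open>Criterion for the case distinction in the definition of \<open>lift2\<close>.\<close>

lemma mh2:
  assumes s: "vector_space s"
    and "\<And>x i. x \<in> homog V \<Longrightarrow> linear_on (scl V) s (hcomp V i) (\<lambda>y. \<phi> x y)"
    and "\<And>y i. y \<in> homog V \<Longrightarrow> linear_on (scl V) s (hcomp V i) (\<lambda>x. \<phi> x y)"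
  shows "multihomogeneous V s (\<lambda>xs. case xs of [x, y] \<Rightarrow> \<phi> x y | _ \<Rightarrow> 0)"
proof (rule mhI)
  fix us ws i
  assume us: "us \<in> lists (homog V)" and ws: "ws \<in> lists (homog V)"
  have 0: "(case xs of [x, y] \<Rightarrow> \<phi> x y | _ \<Rightarrow> 0) = 0" if "length xs \<noteq> 2" for xs
    using that by (auto split: list.split)
  show "linear_on (scl V) s (hcomp V i) (\<lambda>x. case us @ x # ws of [x, y] \<Rightarrow> \<phi> x y | _ \<Rightarrow> 0)"
  proof (cases "length us + length ws = 1")
    case True
    then have "length us = 0 \<and> length ws = 1 \<or> length us = 1 \<and> length ws = 0"
      by arith
    then show ?thesis
      using us ws by (elim disjE) (auto simp: length_Suc_conv intro!: assms)
  next
    case False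
    then show ?thesis
      using linear_on_const0[OF s] by (simp add: 0)
  qed
qed

lemma lift2_word:
  assumes s: "vector_space s"
    and "\<And>x i. x \<in> homog V \<Longrightarrow> linear_on (scl V) s (hcomp V i) (\<lambda>y. \<phi> x y)"
    and "\<And>y i. y \<in> homog V \<Longrightarrow> linear_on (scl V) s (hcomp V i) (\<lambda>x. \<phi> x y)"
    and "x \<in> homog V" "y \<in> homog V"
  shows "lift2 V s \<phi> (word V [x, y]) = \<phi> x y"
  unfolding lift2_def using lift_word[OF s mh2[OF s assms(2,3)], of "[x, y]"] assms(4,5) by simp

lemma lift2_linear_on:
  assumes s: "vector_space s"
    and "\<And>x i. x \<in> homog V \<Longrightarrow> linear_on (scl V) s (hcomp V i) (\<lambda>y. \<phi> x y)"
    and "\<And>y i. y \<in> homog V \<Longrightarrow> linear_on (scl V) s (hcomp V i) (\<lambda>x. \<phi> x y)"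
  shows "linear_on tscale s (tens V) (lift2 V s \<phi>)"
  unfolding lift2_def by (rule lift_linear_on[OF s mh2[OF s assms(2,3)]])

lemma word_linear_on_hcomp:
  assumes "us \<in> lists (homog V)" "ws \<in> lists (homog V)"
  shows "linear_on (scl V) tscale (hcomp V i) (\<lambda>x. word V (us @ x # ws))"
  by (rule mhD[OF mh_word assms])

lemma word2_linear_on:
  assumes "x \<in> carr V"
  shows "linear_on (scl V) tscale (carr V) (\<lambda>y. word V [x, y])"
    "linear_on (scl V) tscale (carr V) (\<lambda>y. word V [y, x])"
  using word_linear_on[of "[x]" "[]"] word_linear_on[of "[]" "[x]"] assms by auto

lemma word1_linear_on: "linear_on (scl V) tscale (carr V) (\<lambda>y. word V [y])"
  using word_linear_on[of "[]" "[]"] by simp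

lemma hcomp_subset_carr: "hcomp V i \<subseteq> carr V"
  by (auto simp: hcomp_carr)

lemma word_linear_on_simps:
  assumes "x \<in> carr V" "y \<in> carr V" "z \<in> carr V"
  shows "word V [x + y, z] = word V [x, z] + word V [y, z]"
    "word V [z, x + y] = word V [z, x] + word V [z, y]"
    "word V [scl V c x, z] = tscale c (word V [x, z])"
    "word V [z, scl V c x] = tscale c (word V [z, x])"
  using assms linear_on_add[OF word2_linear_on(1)[OF assms(3)]] linear_on_add[OF word2_linear_on(2)[OF assms(3)]]
    linear_on_scale[OF word2_linear_on(1)[OF assms(3)]] linear_on_scale[OF word2_linear_on(2)[OF assms(3)]]
  by auto

lemma word2_zero: "z \<in> homog V \<Longrightarrow> word V [0, z] = 0" "z \<in> homog V \<Longrightarrow> word V [z, 0] = 0"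
  by (rule word_eq_0; simp)+

lemma word2_generators:
  assumes "b \<in> word V ` {xs \<in> nzl V. length xs = 2 \<and> wdeg V xs = k}"
  obtains x y i j where "b = word V [x, y]" "x \<in> hcomp V i" "y \<in> hcomp V j" "x \<noteq> 0" "y \<noteq> 0" "k = i + j"
proof -
  from assms obtain xs where b: "b = word V xs" and xs: "xs \<in> nzl V" "length xs = 2" "wdeg V xs = k"
    by blast
  from xs(2) obtain u v where uv: "xs = [u, v]"
    by (auto simp: numeral_2_eq_2 length_Suc_conv)
  then show ?thesis
    using that[of u v "deg V u" "deg V v"] nzl_list_all2[OF xs(1)] xs(1,3) by (simp add: b)
qed

lemma hcomp_tensor_power_2_eqI:
  assumes "vector_space t" and f: "linear_on tscale t (tens V) f" and g: "linear_on tscale t (tens V) g"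
    and eq: "\<And>x y i j. x \<in> hcomp V i \<Longrightarrow> y \<in> hcomp V j \<Longrightarrow> x \<noteq> 0 \<Longrightarrow> y \<noteq> 0 \<Longrightarrow> k = i + j \<Longrightarrow>
      f (word V [x, y]) = g (word V [x, y])"
    and x: "x \<in> hcomp (tensor_power 2 V) k"
  shows "f x = g x"
proof -
  note sub = hcomp_tensor_power_tens[of 2 k, unfolded hcomp_tensor_power]
  show ?thesis
    by (rule linear_on_span_eq[OF vsT assms(1) linear_on_subset[OF f sub] linear_on_subset[OF g sub] _
          x[unfolded hcomp_tensor_power]])
      (erule word2_generators, simp add: eq)
qed

lemma hcomp_tensor_power_2_inI:
  assumes "vector_space t" and f: "linear_on tscale t (tens V) f" and W: "module.subspace t W"
    and eq: "\<And>x y i j. x \<in> hcomp V i \<Longrightarrow> y \<in> hcomp V j \<Longrightarrow> x \<noteq> 0 \<Longrightarrow> y \<noteq> 0 \<Longrightarrow> k = i + j \<Longrightarrow>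
      f (word V [x, y]) \<in> W"
    and x: "x \<in> hcomp (tensor_power 2 V) k"
  shows "f x \<in> W"
proof -
  note sub = hcomp_tensor_power_tens[of 2 k, unfolded hcomp_tensor_power]
  show ?thesis
    by (rule linear_on_span_in[OF vsT assms(1) linear_on_subset[OF f sub] W _ x[unfolded hcomp_tensor_power]])
      (erule word2_generators, simp add: eq)
qed

lemma flip_lin:
  "x \<in> homog V \<Longrightarrow> linear_on (scl V) tscale (hcomp V i) (\<lambda>y. tscale (ksign (deg V x * deg V y)) (word V [y, x]))"
  "y \<in> homog V \<Longrightarrow> linear_on (scl V) tscale (hcomp V i) (\<lambda>x. tscale (ksign (deg V x * deg V y)) (word V [y, x]))"
proof -
  assume "x \<in> homog V"
  then show "linear_on (scl V) tscale (hcomp V i) (\<lambda>y. tscale (ksign (deg V x * deg V y)) (word V [y, x]))"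
    by (intro linear_on_deg[OF vsT, of i "\<lambda>d y. tscale (ksign (deg V x * d)) (word V [y, x])"]
        linear_on_scaled[OF vsT] linear_on_subset[OF word2_linear_on(2) hcomp_subset_carr] homog_carr)
next
  assume "y \<in> homog V"
  then show "linear_on (scl V) tscale (hcomp V i) (\<lambda>x. tscale (ksign (deg V x * deg V y)) (word V [y, x]))"
    by (intro linear_on_deg[OF vsT, of i "\<lambda>d x. tscale (ksign (d * deg V y)) (word V [y, x])"]
        linear_on_scaled[OF vsT] linear_on_subset[OF word2_linear_on(1) hcomp_subset_carr] homog_carr)
qed

lemma flip_linear_on: "linear_on tscale tscale (tens V) (flip V)"
  unfolding flip_def by (rule lift2_linear_on[OF vsT flip_lin])

lemma flip_word:
  assumes x: "x \<in> hcomp V i" and y: "y \<in> hcomp V j"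
  shows "flip V (word V [x, y]) = tscale (ksign (i * j)) (word V [y, x])"
proof -
  have *: "x \<in> homog V" "y \<in> homog V" using assms by (auto simp: hcomp_homog)
  have "flip V (word V [x, y]) = tscale (ksign (deg V x * deg V y)) (word V [y, x])"
    unfolding flip_def by (rule lift2_word[OF vsT flip_lin *])
  then show ?thesis
    using x y * by (cases "x = 0 \<or> y = 0") (auto simp: deg_eq word2_zero)
qed

lemma flip_in_tens: "t \<in> tens V \<Longrightarrow> flip V t \<in> tens V"
  unfolding flip_def lift2_def
  by (rule lift_in[OF vsT mh2[OF vsT flip_lin] tens_subspace])
    (auto split: list.split intro!: tens_scale word_tens)


subsection \<open>Cyclic permutations of three factors\<close>

lemma mh3:
  assumes s: "vector_space s"
    and "\<And>y z i. y \<in> homog V \<Longrightarrow> z \<in> homog V \<Longrightarrow> linear_on (scl V) s (hcomp V i) (\<lambda>x. \<phi> x y z)"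
    and "\<And>x z i. x \<in> homog V \<Longrightarrow> z \<in> homog V \<Longrightarrow> linear_on (scl V) s (hcomp V i) (\<lambda>y. \<phi> x y z)"
    and "\<And>x y i. x \<in> homog V \<Longrightarrow> y \<in> homog V \<Longrightarrow> linear_on (scl V) s (hcomp V i) (\<lambda>z. \<phi> x y z)"
  shows "multihomogeneous V s (\<lambda>xs. case xs of [x, y, z] \<Rightarrow> \<phi> x y z | _ \<Rightarrow> 0)"
proof (rule mhI)
  fix us ws i
  assume us: "us \<in> lists (homog V)" and ws: "ws \<in> lists (homog V)"
  have 0: "(case xs of [x, y, z] \<Rightarrow> \<phi> x y z | _ \<Rightarrow> 0) = 0" if "length xs \<noteq> 3" for xs
    using that by (auto split: list.split)
  show "linear_on (scl V) s (hcomp V i) (\<lambda>x. case us @ x # ws of [x, y, z] \<Rightarrow> \<phi> x y z | _ \<Rightarrow> 0)"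
  proof (cases "length us + length ws = 2")
    case True
    then have "length us = 0 \<and> length ws = 2 \<or> length us = 1 \<and> length ws = 1 \<or>
        length us = 2 \<and> length ws = 0"
      by arith
    then show ?thesis
      using us ws by (elim disjE) (auto simp: length_Suc_conv numeral_2_eq_2 intro!: assms)
  next
    case False
    then show ?thesis
      using linear_on_const0[OF s] by (simp add: 0)
  qed
qed

lemma inv_cycle_012:
  "inv (cycle_of_list [0, 1, 2 :: nat]) = (\<lambda>i. if i = 0 then 2 else if i = 1 then 0 else if i = 2 then 1 else i)"
  by (rule inv_unique_comp) (auto simp: fun_eq_iff transpose_def)

lemma inv_cycle_021:
  "inv (cycle_of_list [0, 2, 1 :: nat]) = (\<lambda>i. if i = 0 then 1 else if i = 1 then 2 else if i = 2 then 0 else i)"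
  by (rule inv_unique_comp) (auto simp: fun_eq_iff transpose_def)

lemma perm_map_012:
  "map (\<lambda>i. [x, y, z] ! inv (cycle_of_list [0, 1, 2]) i) [0..<3] = [z, x, y]"
  "map (\<lambda>i. [x, y, z] ! inv (cycle_of_list [0, 2, 1]) i) [0..<3] = [y, z, x]"
  unfolding inv_cycle_012 inv_cycle_021 by (simp_all add: upt_rec)

lemma perm_inversions:
  "{(i, j). i < j \<and> j < 3 \<and> inv (cycle_of_list [0, 1, 2 :: nat]) i > inv (cycle_of_list [0, 1, 2]) j} =
    {(0, 1), (0, 2)}"
  "{(i, j). i < j \<and> j < 3 \<and> inv (cycle_of_list [0, 2, 1 :: nat]) i > inv (cycle_of_list [0, 2, 1]) j} =
    {(0, 2), (1, 2)}"
  unfolding inv_cycle_012 inv_cycle_021 by (auto split: if_splits)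

lemma word3_linear_on:
  assumes "x \<in> homog V" "y \<in> homog V"
  shows "linear_on (scl V) tscale (hcomp V i) (\<lambda>z. word V [z, x, y])"
    "linear_on (scl V) tscale (hcomp V i) (\<lambda>z. word V [x, z, y])"
    "linear_on (scl V) tscale (hcomp V i) (\<lambda>z. word V [x, y, z])"
  using word_linear_on_hcomp[of "[]" "[x, y]" i] word_linear_on_hcomp[of "[x]" "[y]" i]
    word_linear_on_hcomp[of "[x, y]" "[]" i] assms by auto

text \<open>The signed cyclic permutations are instances, with \<open>\<alpha>\<close> the exponent of the sign.\<close>

lemma perm3_lin:
  fixes \<alpha> :: "int \<Rightarrow> int \<Rightarrow> int \<Rightarrow> int"
  assumes lin: "\<And>x y i. x \<in> homog V \<Longrightarrow> y \<in> homog V \<Longrightarrow>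
      linear_on (scl V) tscale (hcomp V i) (\<lambda>z. \<phi> z x y) \<and>
      linear_on (scl V) tscale (hcomp V i) (\<lambda>z. \<phi> x z y) \<and>
      linear_on (scl V) tscale (hcomp V i) (\<lambda>z. \<phi> x y z)"
  shows "multihomogeneous V tscale (\<lambda>xs. case xs of [x, y, z] \<Rightarrow>
      tscale (ksign (\<alpha> (deg V x) (deg V y) (deg V z))) (\<phi> x y z) | _ \<Rightarrow> 0)"
proof (rule mh3[OF vsT])
  fix y z i assume "y \<in> homog V" "z \<in> homog V"
  then show "linear_on (scl V) tscale (hcomp V i)
      (\<lambda>x. tscale (ksign (\<alpha> (deg V x) (deg V y) (deg V z))) (\<phi> x y z))"
    using lin
    by (intro linear_on_deg[OF vsT, of i "\<lambda>d x. tscale (ksign (\<alpha> d (deg V y) (deg V z))) (\<phi> x y z)"]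
        linear_on_scaled[OF vsT]) blast
next
  fix x z i assume "x \<in> homog V" "z \<in> homog V"
  then show "linear_on (scl V) tscale (hcomp V i)
      (\<lambda>y. tscale (ksign (\<alpha> (deg V x) (deg V y) (deg V z))) (\<phi> x y z))"
    using lin
    by (intro linear_on_deg[OF vsT, of i "\<lambda>d y. tscale (ksign (\<alpha> (deg V x) d (deg V z))) (\<phi> x y z)"]
        linear_on_scaled[OF vsT]) blast
next
  fix x y i assume "x \<in> homog V" "y \<in> homog V"
  then show "linear_on (scl V) tscale (hcomp V i)
      (\<lambda>z. tscale (ksign (\<alpha> (deg V x) (deg V y) (deg V z))) (\<phi> x y z))"
    using lin
    by (intro linear_on_deg[OF vsT, of i "\<lambda>d z. tscale (ksign (\<alpha> (deg V x) (deg V y) d)) (\<phi> x y z)"]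
        linear_on_scaled[OF vsT]) blast
qed

lemma tensor_perm_lift:
  "tensor_perm 3 V (cycle_of_list [0, 1, 2]) = lift V tscale (\<lambda>xs. case xs of [x, y, z] \<Rightarrow>
    tscale (ksign (deg V z * deg V x + deg V z * deg V y)) (word V [z, x, y]) | _ \<Rightarrow> 0)"
  "tensor_perm 3 V (cycle_of_list [0, 2, 1]) = lift V tscale (\<lambda>xs. case xs of [x, y, z] \<Rightarrow>
    tscale (ksign (deg V y * deg V x + deg V z * deg V x)) (word V [y, z, x]) | _ \<Rightarrow> 0)"
proof -
  have list3: "length xs = 3 \<Longrightarrow> \<exists>x y z. xs = [x, y, z]" for xs :: "'v list"
    by (auto simp: numeral_3_eq_3 length_Suc_conv)
  have not3: "length xs \<noteq> 3 \<Longrightarrow> (case xs of [x, y, z] \<Rightarrow> \<phi> x y z | _ \<Rightarrow> 0) = 0"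
    for xs and \<phi> :: "'v \<Rightarrow> 'v \<Rightarrow> 'v \<Rightarrow> ('k, 'v) tensor"
    by (auto split: list.split)
  show "tensor_perm 3 V (cycle_of_list [0, 1, 2]) = lift V tscale (\<lambda>xs. case xs of [x, y, z] \<Rightarrow>
      tscale (ksign (deg V z * deg V x + deg V z * deg V y)) (word V [z, x, y]) | _ \<Rightarrow> 0)"
    unfolding tensor_perm_def perm_inversions
  proof (rule arg_cong[where f = "lift V tscale"], rule ext)
    fix xs :: "'v list"
    show "(if length xs = 3 then tscale (ksign (\<Sum>(i, j)\<in>{(0, 1), (0, 2)}.
          deg V (xs ! inv (cycle_of_list [0, 1, 2]) i) * deg V (xs ! inv (cycle_of_list [0, 1, 2]) j)))
        (word V (map (\<lambda>i. xs ! inv (cycle_of_list [0, 1, 2]) i) [0..<3])) else 0) =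
      (case xs of [x, y, z] \<Rightarrow>
        tscale (ksign (deg V z * deg V x + deg V z * deg V y)) (word V [z, x, y]) | _ \<Rightarrow> 0)"
    proof (cases "length xs = 3")
      case True
      from list3[OF this] obtain x y z where xs: "xs = [x, y, z]" by blast
      show ?thesis
        unfolding xs by (simp only: perm_map_012) (simp add: inv_cycle_012[simplified])
    qed (simp add: not3)
  qed
  show "tensor_perm 3 V (cycle_of_list [0, 2, 1]) = lift V tscale (\<lambda>xs. case xs of [x, y, z] \<Rightarrow>
      tscale (ksign (deg V y * deg V x + deg V z * deg V x)) (word V [y, z, x]) | _ \<Rightarrow> 0)"
    unfolding tensor_perm_def perm_inversions
  proof (rule arg_cong[where f = "lift V tscale"], rule ext)
    fix xs :: "'v list"
    show "(if length xs = 3 then tscale (ksign (\<Sum>(i, j)\<in>{(0, 2), (1, 2)}.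
          deg V (xs ! inv (cycle_of_list [0, 2, 1]) i) * deg V (xs ! inv (cycle_of_list [0, 2, 1]) j)))
        (word V (map (\<lambda>i. xs ! inv (cycle_of_list [0, 2, 1]) i) [0..<3])) else 0) =
      (case xs of [x, y, z] \<Rightarrow>
        tscale (ksign (deg V y * deg V x + deg V z * deg V x)) (word V [y, z, x]) | _ \<Rightarrow> 0)"
    proof (cases "length xs = 3")
      case True
      from list3[OF this] obtain x y z where xs: "xs = [x, y, z]" by blast
      show ?thesis
        unfolding xs by (simp only: perm_map_012) (simp add: inv_cycle_021[simplified])
    qed (simp add: not3)
  qed
qed

lemma perm3_mh:
  "multihomogeneous V tscale (\<lambda>xs. case xs of [x, y, z] \<Rightarrow>
    tscale (ksign (deg V z * deg V x + deg V z * deg V y)) (word V [z, x, y]) | _ \<Rightarrow> 0)"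
  "multihomogeneous V tscale (\<lambda>xs. case xs of [x, y, z] \<Rightarrow>
    tscale (ksign (deg V y * deg V x + deg V z * deg V x)) (word V [y, z, x]) | _ \<Rightarrow> 0)"
  by (rule perm3_lin[where \<alpha> = "\<lambda>x y z. z * x + z * y" and \<phi> = "\<lambda>x y z. word V [z, x, y]"],
      simp add: word3_linear_on)
    (rule perm3_lin[where \<alpha> = "\<lambda>x y z. y * x + z * x" and \<phi> = "\<lambda>x y z. word V [y, z, x]"],
      simp add: word3_linear_on)

lemma tensor_perm_linear_on:
  "linear_on tscale tscale (tens V) (tensor_perm 3 V (cycle_of_list [0, 1, 2]))"
  "linear_on tscale tscale (tens V) (tensor_perm 3 V (cycle_of_list [0, 2, 1]))"
  unfolding tensor_perm_lift by (rule lift_linear_on[OF vsT perm3_mh(1)], rule lift_linear_on[OF vsT perm3_mh(2)])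

lemma tensor_perm_in_tens:
  assumes "t \<in> tens V"
  shows "tensor_perm 3 V (cycle_of_list [0, 1, 2]) t \<in> tens V"
    "tensor_perm 3 V (cycle_of_list [0, 2, 1]) t \<in> tens V"
  unfolding tensor_perm_lift
  by (rule lift_in[OF vsT perm3_mh(1) tens_subspace _ assms],
      force split: list.split intro!: tens_scale word_tens)
    (rule lift_in[OF vsT perm3_mh(2) tens_subspace _ assms],
      force split: list.split intro!: tens_scale word_tens)

lemma tensor_perm_word:
  assumes x: "x \<in> hcomp V i" and y: "y \<in> hcomp V j" and z: "z \<in> hcomp V l"
  shows "tensor_perm 3 V (cycle_of_list [0, 1, 2]) (word V [x, y, z]) =
      tscale (ksign (l * (i + j))) (word V [z, x, y])" (is ?P)
    and "tensor_perm 3 V (cycle_of_list [0, 2, 1]) (word V [x, y, z]) =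
      tscale (ksign (i * (j + l))) (word V [y, z, x])" (is ?Q)
proof -
  have xs: "[x, y, z] \<in> lists (homog V)"
    using assms by (auto simp: hcomp_homog)
  have 0: "word V [y, z, x] = 0" "word V [z, x, y] = 0" if "x = 0 \<or> y = 0 \<or> z = 0"
    using that xs by (auto intro!: word_eq_0)
  have 1: "tensor_perm 3 V (cycle_of_list [0, 1, 2]) (word V [x, y, z]) =
      tscale (ksign (deg V z * deg V x + deg V z * deg V y)) (word V [z, x, y])"
    unfolding tensor_perm_lift by (subst lift_word[OF vsT perm3_mh(1) xs]) simp
  have 2: "tensor_perm 3 V (cycle_of_list [0, 2, 1]) (word V [x, y, z]) =
      tscale (ksign (deg V y * deg V x + deg V z * deg V x)) (word V [y, z, x])"
    unfolding tensor_perm_lift by (subst lift_word[OF vsT perm3_mh(2) xs]) simp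
  show ?P ?Q
    unfolding 1 2 using 0 assms
    by (cases "x = 0 \<or> y = 0 \<or> z = 0"; simp add: deg_eq algebra_simps)+
qed


section \<open>Odd derivations of the tensor algebra\<close>

text \<open>
  Only the restrictions of \<open>\<delta>\<close> to the components need be linear, and \<open>\<delta>\<close> may have any degree up
  to \<open>odd_derivation_leibniz\<close>: the signs in the definition do not depend on it.
\<close>

context
  fixes \<delta> :: "'v \<Rightarrow> ('k, 'v) tensor"
  assumes \<delta>_lin: "\<And>i. linear_on (scl V) tscale (hcomp V i) \<delta>"
    and \<delta>_tens: "\<And>x. x \<in> homog V \<Longrightarrow> \<delta> x \<in> tens V"
begin

lemma odd_derivation_lift:
  "odd_derivation V \<delta> = lift V tscale (split_sum (\<lambda>a x b.
    tscale (ksign (wdeg V a)) (tmul V (word V a) (tmul V (\<delta> x) (word V b)))))"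
  unfolding odd_derivation_def split_sum_def ..

lemma odd_derivation_mh:
  "multihomogeneous V tscale (split_sum (\<lambda>a x b.
    tscale (ksign (wdeg V a)) (tmul V (word V a) (tmul V (\<delta> x) (word V b)))))"
proof (rule mh_split_sum[OF vsT])
  fix y e assume "y \<in> homog V" "e \<in> lists (homog V)"
  then have t: "tmul V (\<delta> y) (word V e) \<in> tens V"
    by (simp add: tmul_tens \<delta>_tens word_tens)
  show "multihomogeneous V tscale (\<lambda>c. tscale (ksign (wdeg V c)) (tmul V (word V c) (tmul V (\<delta> y) (word V e))))"
    by (rule mh_wdeg[OF vsT, of "\<lambda>d c. tscale (ksign d) (tmul V (word V c) (tmul V (\<delta> y) (word V e)))"])
      (rule mh_scale[OF vsT mh_lin[OF mh_word word_tens tmul_left[OF t]]])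
next
  fix c e i assume c: "c \<in> lists (homog V)" and e: "e \<in> lists (homog V)"
  show "linear_on (scl V) tscale (hcomp V i)
      (\<lambda>y. tscale (ksign (wdeg V c)) (tmul V (word V c) (tmul V (\<delta> y) (word V e))))"
    by (rule linear_on_scaled[OF vsT], rule linear_on_compose[OF _ _ tmul_right[OF word_tens[OF c]]],
        rule linear_on_compose[OF \<delta>_lin _ tmul_left[OF word_tens[OF e]]])
      (simp_all add: \<delta>_tens hcomp_homog tmul_tens word_tens e)
next
  fix c y assume c: "c \<in> lists (homog V)" and y: "y \<in> homog V"
  show "multihomogeneous V tscale (\<lambda>e. tscale (ksign (wdeg V c)) (tmul V (word V c) (tmul V (\<delta> y) (word V e))))"
    by (rule mh_scale[OF vsT], rule mh_lin[OF _ _ tmul_right[OF word_tens[OF c]]],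
        rule mh_lin[OF mh_word word_tens tmul_right[OF \<delta>_tens[OF y]]])
      (simp_all add: \<delta>_tens tmul_tens word_tens y)
qed

lemma odd_derivation_word:
  "xs \<in> lists (homog V) \<Longrightarrow> odd_derivation V \<delta> (word V xs) = split_sum (\<lambda>a x b.
    tscale (ksign (wdeg V a)) (tmul V (word V a) (tmul V (\<delta> x) (word V b)))) xs"
  unfolding odd_derivation_lift by (rule lift_word[OF vsT odd_derivation_mh])

lemma odd_derivation_linear_on: "linear_on tscale tscale (tens V) (odd_derivation V \<delta>)"
  unfolding odd_derivation_lift by (rule lift_linear_on[OF vsT odd_derivation_mh])

lemma odd_derivation_word_in:
  assumes "TS.subspace W" "xs \<in> lists (homog V)"
    and "\<And>a x b. xs = a @ x # b \<Longrightarrow> tmul V (word V a) (tmul V (\<delta> x) (word V b)) \<in> W"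
  shows "odd_derivation V \<delta> (word V xs) \<in> W"
  unfolding odd_derivation_word[OF assms(2)]
  by (rule split_sum_in[where P = "\<lambda>t. t \<in> W"])
    (use assms in \<open>auto simp: TS.subspace_scale TS.subspace_0 TS.subspace_add\<close>)

lemma odd_derivation_tens:
  assumes "x \<in> tens V"
  shows "odd_derivation V \<delta> x \<in> tens V"
proof (rule tens_inI[OF vsT odd_derivation_linear_on tens_subspace _ assms])
  fix xs assume "xs \<in> lists (homog V)"
  then show "odd_derivation V \<delta> (word V xs) \<in> tens V"
    by (rule odd_derivation_word_in[OF tens_subspace]) (use \<open>xs \<in> lists (homog V)\<close> in \<open>simp add: tmul_tens word_tens \<delta>_tens\<close>)
qed

lemma odd_derivation_unit: "odd_derivation V \<delta> (word V []) = 0"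
  by (simp add: odd_derivation_word)

lemma odd_derivation_single: "x \<in> homog V \<Longrightarrow> odd_derivation V \<delta> (word V [x]) = \<delta> x"
  by (simp add: odd_derivation_word tmul_unit_left tmul_unit_right \<delta>_tens tmul_tens word_tens)

lemma odd_derivation_append:
  assumes us: "us \<in> lists (homog V)" and ws: "ws \<in> lists (homog V)"
  shows "odd_derivation V \<delta> (word V (us @ ws)) =
    tmul V (odd_derivation V \<delta> (word V us)) (word V ws) +
    tscale (ksign (wdeg V us)) (tmul V (word V us) (odd_derivation V \<delta> (word V ws)))"
proof -
  have "split_sum (\<lambda>a x b. tscale (ksign (wdeg V a)) (tmul V (word V a) (tmul V (\<delta> x) (word V (b @ ws))))) us =
      split_sum (\<lambda>a x b. tmul V (tscale (ksign (wdeg V a)) (tmul V (word V a) (tmul V (\<delta> x) (word V b)))) (word V ws)) us"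
    by (rule split_sum_cong)
      (use us ws in \<open>simp add: tmul_scale_left tmul_assoc \<delta>_tens word_tens tmul_tens\<close>)
  also have "\<dots> = tmul V (odd_derivation V \<delta> (word V us)) (word V ws)"
    unfolding odd_derivation_word[OF us]
    by (rule split_sum_linear[OF vsT vsT tmul_left[OF word_tens[OF ws]] tens_subspace, symmetric])
      (use us in \<open>simp add: tens_scale \<delta>_tens word_tens tmul_tens\<close>)
  finally have 1: "split_sum (\<lambda>a x b. tscale (ksign (wdeg V a)) (tmul V (word V a) (tmul V (\<delta> x) (word V (b @ ws))))) us =
    tmul V (odd_derivation V \<delta> (word V us)) (word V ws)" .
  have "split_sum (\<lambda>a x b. tscale (ksign (wdeg V (us @ a))) (tmul V (word V (us @ a)) (tmul V (\<delta> x) (word V b)))) ws =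
      split_sum (\<lambda>a x b. tscale (ksign (wdeg V us)) (tmul V (word V us)
        (tscale (ksign (wdeg V a)) (tmul V (word V a) (tmul V (\<delta> x) (word V b)))))) ws"
    by (rule split_sum_cong)
      (use us ws in \<open>simp add: tmul_scale_right tmul_assoc \<delta>_tens word_tens tmul_tens ksign_add flip: tmul_word\<close>)
  also have "\<dots> = tscale (ksign (wdeg V us)) (tmul V (word V us) (odd_derivation V \<delta> (word V ws)))"
    unfolding odd_derivation_word[OF ws]
    by (rule split_sum_linear[OF vsT vsT linear_on_scaled[OF vsT tmul_right[OF word_tens[OF us]]] tens_subspace, symmetric])
      (use ws in \<open>simp add: tens_scale \<delta>_tens word_tens tmul_tens\<close>)
  finally show ?thesis
    using us ws 1 by (simp add: odd_derivation_word[of "us @ ws"] split_sum_append)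
qed

lemma odd_derivation_leibniz:
  assumes x: "x \<in> hcomp (tensor_algebra V) i" and y: "y \<in> tens V"
  shows "odd_derivation V \<delta> (tmul V x y) =
    tmul V (odd_derivation V \<delta> x) y + tscale (ksign i) (tmul V x (odd_derivation V \<delta> y))"
proof (rule hcomp_eqI[OF vsT _ _ _ x])
  note lin = odd_derivation_linear_on and tns = odd_derivation_tens
  show "linear_on tscale tscale (tens V) (\<lambda>x. odd_derivation V \<delta> (tmul V x y))"
    by (rule linear_on_compose[OF tmul_left[OF y] _ lin]) (simp add: tmul_tens y)
  show "linear_on tscale tscale (tens V)
      (\<lambda>x. tmul V (odd_derivation V \<delta> x) y + tscale (ksign i) (tmul V x (odd_derivation V \<delta> y)))"
    by (intro linear_on_plus[OF vsT] linear_on_scaled[OF vsT] linear_on_compose[OF lin _ tmul_left[OF y]]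
        tmul_left tns y)
  fix us assume "us \<in> nzl V" and deg: "wdeg V us = i"
  then have us: "us \<in> lists (homog V)" by (simp add: nzl_homog)
  note wus = word_tens[OF us]
  show "odd_derivation V \<delta> (tmul V (word V us) y) = tmul V (odd_derivation V \<delta> (word V us)) y +
      tscale (ksign i) (tmul V (word V us) (odd_derivation V \<delta> y))"
  proof (rule tens_eqI[OF vsT _ _ _ y])
    show "linear_on tscale tscale (tens V) (\<lambda>y. odd_derivation V \<delta> (tmul V (word V us) y))"
      by (rule linear_on_compose[OF tmul_right[OF wus] _ lin]) (simp add: tmul_tens wus)
    show "linear_on tscale tscale (tens V) (\<lambda>y. tmul V (odd_derivation V \<delta> (word V us)) y +
        tscale (ksign i) (tmul V (word V us) (odd_derivation V \<delta> y)))"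
      by (intro linear_on_plus[OF vsT] linear_on_scaled[OF vsT] linear_on_compose[OF lin _ tmul_right[OF wus]]
          tmul_right tns wus)
    fix ws assume ws: "ws \<in> lists (homog V)"
    show "odd_derivation V \<delta> (tmul V (word V us) (word V ws)) =
        tmul V (odd_derivation V \<delta> (word V us)) (word V ws) +
        tscale (ksign i) (tmul V (word V us) (odd_derivation V \<delta> (word V ws)))"
      using odd_derivation_append[OF us ws] us ws deg by simp
  qed
qed

lemma odd_derivation_hcomp:
  assumes \<delta>_deg: "\<And>x i. x \<in> hcomp V i \<Longrightarrow> \<delta> x \<in> hcomp (tensor_algebra V) (i - 1)"
    and x: "x \<in> hcomp (tensor_algebra V) i"
  shows "odd_derivation V \<delta> x \<in> hcomp (tensor_algebra V) (i - 1)"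
proof (rule hcomp_inI[OF vsT odd_derivation_linear_on tensor_algebra_subspace _ x])
  fix xs assume xs: "xs \<in> nzl V" "wdeg V xs = i"
  show "odd_derivation V \<delta> (word V xs) \<in> hcomp (tensor_algebra V) (i - 1)"
  proof (rule odd_derivation_word_in[OF tensor_algebra_subspace nzl_homog[OF xs(1)]])
    fix a x b assume eq: "xs = a @ x # b"
    then have "x \<in> hcomp V (deg V x)"
      using xs(1) by (auto simp: homog_def deg_eq)
    then have "tmul V (word V a) (tmul V (\<delta> x) (word V b)) \<in>
        hcomp (tensor_algebra V) (wdeg V a + ((deg V x - 1) + wdeg V b))"
      using xs(1) by (intro tmul_hcomp word_nzl_hcomp \<delta>_deg) (simp_all add: eq)
    also have "wdeg V a + ((deg V x - 1) + wdeg V b) = i - 1"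
      using xs(2) by (simp add: eq)
    finally show "tmul V (word V a) (tmul V (\<delta> x) (word V b)) \<in> hcomp (tensor_algebra V) (i - 1)" .
  qed
qed

text \<open>The square of an odd derivation is a derivation, so it vanishes if it does on generators.\<close>

lemma odd_derivation_square_0:
  assumes \<delta>_deg: "\<And>x i. x \<in> hcomp V i \<Longrightarrow> \<delta> x \<in> hcomp (tensor_algebra V) (i - 1)"
    and \<delta>\<delta>: "\<And>x. x \<in> homog V \<Longrightarrow> odd_derivation V \<delta> (\<delta> x) = 0"
    and x: "x \<in> tens V"
  shows "odd_derivation V \<delta> (odd_derivation V \<delta> x) = 0"
proof (rule tens_eqI[OF vsT _ linear_on_const0[OF vsT] _ x])
  let ?D = "odd_derivation V \<delta>"
  note lin = odd_derivation_linear_on and tns = odd_derivation_tens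
  show "linear_on tscale tscale (tens V) (\<lambda>x. ?D (?D x))"
    by (rule linear_on_compose[OF lin tns lin])
  fix xs assume "xs \<in> lists (homog V)"
  then show "?D (?D (word V xs)) = 0"
  proof (induction xs)
    case Nil
    then show ?case
      by (simp only: odd_derivation_unit linear_on_zero[OF vsT vsT lin tens_subspace])
  next
    case (Cons x xs)
    then have xs: "xs \<in> lists (homog V)" by auto
    from Cons obtain i where x: "x \<in> hcomp V i"
      by (auto simp: homog_def)
    then have xh: "x \<in> homog V" by (rule hcomp_homog)
    have wx: "word V [x] \<in> hcomp (tensor_algebra V) i"
      using word_hcomp(1)[of "[x]" "[i]"] x by simp
    have dx: "\<delta> x \<in> hcomp (tensor_algebra V) (i - 1)"
      by (rule \<delta>_deg[OF x])
    have t: "\<delta> x \<in> tens V" "word V [x] \<in> tens V" "word V xs \<in> tens V" "?D (word V xs) \<in> tens V"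
      using xh xs by (auto intro!: \<delta>_tens word_tens tns)
    have "word V (x # xs) = tmul V (word V [x]) (word V xs)"
      using xh xs by simp
    then have "?D (word V (x # xs)) = tmul V (\<delta> x) (word V xs) + tscale (ksign i) (tmul V (word V [x]) (?D (word V xs)))"
      by (simp only: odd_derivation_leibniz[OF wx t(3)] odd_derivation_single[OF xh])
    then have "?D (?D (word V (x # xs))) =
        ?D (tmul V (\<delta> x) (word V xs)) + tscale (ksign i) (?D (tmul V (word V [x]) (?D (word V xs))))"
      using t by (simp only: linear_on_add[OF lin] linear_on_scale[OF lin] tmul_tens tens_scale)
    also have "?D (tmul V (\<delta> x) (word V xs)) = tscale (ksign (i - 1)) (tmul V (\<delta> x) (?D (word V xs)))"
      by (simp only: odd_derivation_leibniz[OF dx t(3)] \<delta>\<delta>[OF xh] tmul_0_left[OF t(3)] add_0_left)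
    also have "?D (tmul V (word V [x]) (?D (word V xs))) = tmul V (\<delta> x) (?D (word V xs))"
      by (simp only: odd_derivation_leibniz[OF wx t(4)] Cons.IH tmul_0_right[OF t(2)]
          odd_derivation_single[OF xh] TS.scale_zero_right add_0_right)
    also have "tscale (ksign (i - 1)) (tmul V (\<delta> x) (?D (word V xs))) + tscale (ksign i) (tmul V (\<delta> x) (?D (word V xs))) = 0"
    proof -
      have "ksign (i - 1) = (- ksign i :: 'k)"
        by (rule ksign_cong_minus) simp
      then show ?thesis
        by simp
    qed
    finally show ?case .
  qed
qed

end

end


section \<open>Double brackets and differentials\<close>

context dg_space
begin

lemma diff_linear_on: "linear_on (scl V) (scl V) (carr V) (diff V)"
  by (rule linear_map_on[OF diff_linear])

lemma diff_hcomp: "x \<in> hcomp V i \<Longrightarrow> diff V x \<in> hcomp V (i - 1)"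
  using diff_degree by (auto simp: has_degree_def)

lemma diff_homog: "x \<in> homog V \<Longrightarrow> diff V x \<in> homog V"
  using diff_hcomp by (fastforce simp: homog_def)

lemma diff_carr: "x \<in> carr V \<Longrightarrow> diff V x \<in> carr V"
  using diff_linear by (simp add: linear_map_def)

lemma diff_0 [simp]: "diff V 0 = 0"
  by (rule linear_on_zero[OF vector_space vector_space diff_linear_on carr_subspace])

lemma tensor_diff_gen:
  "linear_on (scl V) tscale (hcomp V i) (\<lambda>x. word V [diff V x])"
  "x \<in> homog V \<Longrightarrow> word V [diff V x] \<in> tens V"
  by (rule linear_on_compose[OF linear_on_subset[OF diff_linear_on hcomp_subset_carr] _ word1_linear_on])
    (simp_all add: diff_carr hcomp_carr word_tens diff_homog)

lemmas tensor_diff_linear_on =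
  odd_derivation_linear_on[OF tensor_diff_gen, folded tensor_diff_def]

lemmas tensor_diff_tens =
  odd_derivation_tens[OF tensor_diff_gen, folded tensor_diff_def]

lemma tensor_diff_word2:
  assumes x: "x \<in> hcomp V i" and y: "y \<in> homog V"
  shows "tensor_diff V (diff V) (word V [x, y]) =
    word V [diff V x, y] + tscale (ksign i) (word V [x, diff V y])"
proof -
  have xh: "x \<in> homog V"
    using x by (rule hcomp_homog)
  have "tensor_diff V (diff V) (word V [x, y]) =
      word V [diff V x, y] + tscale (ksign (deg V x)) (word V [x, diff V y])"
    unfolding tensor_diff_def
    using xh y
    by (simp add: odd_derivation_word[OF tensor_diff_gen] split_sum_Cons diff_homog)
  then show ?thesis
    using x y by (cases "x = 0") (simp_all add: deg_eq word2_zero diff_homog)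
qed

text \<open>The flip commutes with the differential.\<close>

lemma tensor_diff_flip:
  assumes t: "t \<in> hcomp (tensor_power 2 V) k"
  shows "tensor_diff V (diff V) (flip V t) = flip V (tensor_diff V (diff V) t)"
proof (rule hcomp_tensor_power_2_eqI[OF vsT _ _ _ t])
  show "linear_on tscale tscale (tens V) (\<lambda>t. tensor_diff V (diff V) (flip V t))"
    by (rule linear_on_compose[OF flip_linear_on flip_in_tens tensor_diff_linear_on])
  show "linear_on tscale tscale (tens V) (\<lambda>t. flip V (tensor_diff V (diff V) t))"
    by (rule linear_on_compose[OF tensor_diff_linear_on tensor_diff_tens flip_linear_on])
  fix x y i j
  assume x: "x \<in> hcomp V i" and y: "y \<in> hcomp V j"
  note d = diff_hcomp[OF x] diff_hcomp[OF y]
  have h: "x \<in> homog V" "y \<in> homog V"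
    using x y by (auto simp: hcomp_homog)
  have w: "word V [a, b] \<in> tens V" if "a \<in> homog V" "b \<in> homog V" for a b
    using that by (simp add: word_tens)
  have "flip V (tensor_diff V (diff V) (word V [x, y])) =
      flip V (word V [diff V x, y]) + tscale (ksign i) (flip V (word V [x, diff V y]))"
    by (simp only: tensor_diff_word2[OF x h(2)] linear_on_add[OF flip_linear_on] linear_on_scale[OF flip_linear_on]
        w h diff_homog tens_scale)
  also have "\<dots> = tscale (ksign ((i - 1) * j)) (word V [y, diff V x]) +
      tscale (ksign (i + i * (j - 1))) (word V [diff V y, x])"
    by (simp add: flip_word[OF d(1) y] flip_word[OF x d(2)] ksign_add)
  also have "ksign ((i - 1) * j) = (ksign (i * j + j) :: 'k)"
    by (rule ksign_cong) (simp add: algebra_simps)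
  also have "ksign (i + i * (j - 1)) = (ksign (i * j) :: 'k)"
    by (rule ksign_cong) (simp add: algebra_simps)
  also have "tscale (ksign (i * j + j)) (word V [y, diff V x]) + tscale (ksign (i * j)) (word V [diff V y, x]) =
      tensor_diff V (diff V) (flip V (word V [x, y]))"
    by (simp add: flip_word[OF x y] linear_on_scale[OF tensor_diff_linear_on w] h tensor_diff_word2[OF y]
        TS.scale_right_distrib ksign_add add.commute)
  finally show "tensor_diff V (diff V) (flip V (word V [x, y])) =
      flip V (tensor_diff V (diff V) (word V [x, y]))" ..
qed

end

context dg_algebra
begin

lemma mult_carr: "x \<in> carr A \<Longrightarrow> y \<in> carr A \<Longrightarrow> mult A x y \<in> carr A"
  using mult_bilinear by (simp add: bilinear_map_def linear_map_def)

lemma mult_left: "y \<in> carr A \<Longrightarrow> linear_on (scl A) (scl A) (carr A) (\<lambda>x. mult A x y)"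
  using mult_bilinear by (simp add: bilinear_map_def linear_map_on)

lemma mult_right: "x \<in> carr A \<Longrightarrow> linear_on (scl A) (scl A) (carr A) (\<lambda>y. mult A x y)"
  using mult_bilinear by (simp add: bilinear_map_def linear_map_on)

lemma mult_hcomp: "x \<in> hcomp A i \<Longrightarrow> y \<in> hcomp A j \<Longrightarrow> mult A x y \<in> hcomp A (i + j)"
  using mult_degree by (auto simp: has_bidegree_def)

lemma mult_homog: "x \<in> homog A \<Longrightarrow> y \<in> homog A \<Longrightarrow> mult A x y \<in> homog A"
  using mult_hcomp by (fastforce simp: homog_def)

lemma outer_left_lin:
  assumes "a \<in> carr A"
  shows "x \<in> homog A \<Longrightarrow> linear_on (scl A) tscale (hcomp A i) (\<lambda>y. word A [mult A a x, y])"
    "y \<in> homog A \<Longrightarrow> linear_on (scl A) tscale (hcomp A i) (\<lambda>x. word A [mult A a x, y])"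
proof -
  assume "x \<in> homog A"
  then show "linear_on (scl A) tscale (hcomp A i) (\<lambda>y. word A [mult A a x, y])"
    using assms by (intro linear_on_subset[OF word2_linear_on(1) hcomp_subset_carr]) (simp add: mult_carr homog_carr)
next
  assume "y \<in> homog A"
  then show "linear_on (scl A) tscale (hcomp A i) (\<lambda>x. word A [mult A a x, y])"
    by (intro linear_on_subset[OF linear_on_compose[OF mult_right[OF assms] _ word2_linear_on(2)] hcomp_subset_carr])
      (simp_all add: mult_carr assms homog_carr)
qed

lemma outer_right_lin:
  assumes "b \<in> carr A"
  shows "x \<in> homog A \<Longrightarrow> linear_on (scl A) tscale (hcomp A i) (\<lambda>y. word A [x, mult A y b])"
    "y \<in> homog A \<Longrightarrow> linear_on (scl A) tscale (hcomp A i) (\<lambda>x. word A [x, mult A y b])"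
proof -
  assume "x \<in> homog A"
  then show "linear_on (scl A) tscale (hcomp A i) (\<lambda>y. word A [x, mult A y b])"
    by (intro linear_on_subset[OF linear_on_compose[OF mult_left[OF assms] _ word2_linear_on(1)] hcomp_subset_carr])
      (simp_all add: mult_carr assms homog_carr)
next
  assume "y \<in> homog A"
  then show "linear_on (scl A) tscale (hcomp A i) (\<lambda>x. word A [x, mult A y b])"
    using assms by (intro linear_on_subset[OF word2_linear_on(2) hcomp_subset_carr]) (simp add: mult_carr homog_carr)
qed

lemma outer_left_word:
  "a \<in> carr A \<Longrightarrow> x \<in> homog A \<Longrightarrow> y \<in> homog A \<Longrightarrow> outer_left A a (word A [x, y]) = word A [mult A a x, y]"
  unfolding outer_left_def by (rule lift2_word[OF vsT outer_left_lin])

lemma outer_right_word: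
  "b \<in> carr A \<Longrightarrow> x \<in> homog A \<Longrightarrow> y \<in> homog A \<Longrightarrow> outer_right A (word A [x, y]) b = word A [x, mult A y b]"
  unfolding outer_right_def by (rule lift2_word[OF vsT outer_right_lin])

lemma outer_left_linear_on: "a \<in> carr A \<Longrightarrow> linear_on tscale tscale (tens A) (outer_left A a)"
  unfolding outer_left_def by (rule lift2_linear_on[OF vsT outer_left_lin])

lemma outer_right_linear_on: "b \<in> carr A \<Longrightarrow> linear_on tscale tscale (tens A) (\<lambda>t. outer_right A t b)"
  unfolding outer_right_def by (rule lift2_linear_on[OF vsT outer_right_lin])

lemma outer_left_tens: "a \<in> homog A \<Longrightarrow> t \<in> tens A \<Longrightarrow> outer_left A a t \<in> tens A"
  unfolding outer_left_def lift2_def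
  by (rule lift_in[OF vsT mh2[OF vsT outer_left_lin] tens_subspace])
    (auto split: list.split intro!: word_tens mult_homog simp: homog_carr)

lemma outer_right_tens: "b \<in> homog A \<Longrightarrow> t \<in> tens A \<Longrightarrow> outer_right A t b \<in> tens A"
  unfolding outer_right_def lift2_def
  by (rule lift_in[OF vsT mh2[OF vsT outer_right_lin] tens_subspace])
    (auto split: list.split intro!: word_tens mult_homog simp: homog_carr)

lemma outer_left_param:
  assumes "t \<in> tens A"
  shows "linear_on (scl A) tscale (carr A) (\<lambda>a. outer_left A a t)"
  unfolding outer_left_def lift2_def
proof (rule lift_param[OF vsT vector_space carr_subspace _ _ assms])
  fix xs assume xs: "xs \<in> lists (homog A)"
  have *: "linear_on (scl A) tscale (carr A) (\<lambda>a. word A [mult A a x, y])"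
    if "x \<in> homog A" "y \<in> homog A" for x y
    using that by (intro linear_on_compose[OF mult_left _ word2_linear_on(2)])
      (simp_all add: mult_carr homog_carr)
  show "linear_on (scl A) tscale (carr A) (\<lambda>a. case xs of [x, y] \<Rightarrow> word A [mult A a x, y] | _ \<Rightarrow> 0)"
  proof (cases "\<exists>x y. xs = [x, y]")
    case True
    then show ?thesis
      using xs by (auto intro!: *)
  next
    case False
    then have "(case xs of [x, y] \<Rightarrow> \<phi> x y | _ \<Rightarrow> 0) = 0" for \<phi> :: "'a \<Rightarrow> 'a \<Rightarrow> ('k, 'a) tensor"
      by (auto split: list.split)
    then show ?thesis
      using linear_on_const0[OF vsT] by simp
  qed
qed (rule mh2[OF vsT outer_left_lin])

lemma outer_right_param:
  assumes "t \<in> tens A"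
  shows "linear_on (scl A) tscale (carr A) (\<lambda>b. outer_right A t b)"
  unfolding outer_right_def lift2_def
proof (rule lift_param[OF vsT vector_space carr_subspace _ _ assms])
  fix xs assume xs: "xs \<in> lists (homog A)"
  have *: "linear_on (scl A) tscale (carr A) (\<lambda>b. word A [x, mult A y b])"
    if "x \<in> homog A" "y \<in> homog A" for x y
    using that by (intro linear_on_compose[OF mult_right _ word2_linear_on(1)])
      (simp_all add: mult_carr homog_carr)
  show "linear_on (scl A) tscale (carr A) (\<lambda>b. case xs of [x, y] \<Rightarrow> word A [x, mult A y b] | _ \<Rightarrow> 0)"
  proof (cases "\<exists>x y. xs = [x, y]")
    case True
    then show ?thesis
      using xs by (auto intro!: *)
  next
    case False
    then have "(case xs of [x, y] \<Rightarrow> \<phi> x y | _ \<Rightarrow> 0) = 0" for \<phi> :: "'a \<Rightarrow> 'a \<Rightarrow> ('k, 'a) tensor"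
      by (auto split: list.split)
    then show ?thesis
      using linear_on_const0[OF vsT] by simp
  qed
qed (rule mh2[OF vsT outer_right_lin])

lemma word2_tens: "x \<in> homog A \<Longrightarrow> y \<in> homog A \<Longrightarrow> word A [x, y] \<in> tens A"
  by (simp add: word_tens)

lemma tensor_diff_outer_right:
  assumes t: "t \<in> hcomp (tensor_power 2 A) k" and c: "c \<in> homog A"
  shows "tensor_diff A (diff A) (outer_right A t c) =
    outer_right A (tensor_diff A (diff A) t) c + tscale (ksign k) (outer_right A t (diff A c))"
proof (rule hcomp_tensor_power_2_eqI[OF vsT _ _ _ t])
  have cc: "c \<in> carr A" "diff A c \<in> carr A" and dc: "diff A c \<in> homog A"
    using c by (simp_all add: homog_carr diff_homog)
  show "linear_on tscale tscale (tens A) (\<lambda>t. tensor_diff A (diff A) (outer_right A t c))"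
    by (rule linear_on_compose[OF outer_right_linear_on[OF cc(1)] outer_right_tens[OF c] tensor_diff_linear_on])
  show "linear_on tscale tscale (tens A)
      (\<lambda>t. outer_right A (tensor_diff A (diff A) t) c + tscale (ksign k) (outer_right A t (diff A c)))"
    by (intro linear_on_plus[OF vsT] linear_on_scaled[OF vsT] outer_right_linear_on[OF cc(2)])
      (rule linear_on_compose[OF tensor_diff_linear_on tensor_diff_tens outer_right_linear_on[OF cc(1)]])
  fix x y i j
  assume x: "x \<in> hcomp A i" and y: "y \<in> hcomp A j" and k: "k = i + j"
  have h: "x \<in> homog A" "y \<in> homog A" "diff A x \<in> homog A" "diff A y \<in> homog A"
    using x y by (auto simp: hcomp_homog diff_homog)
  have yc: "diff A (mult A y c) = mult A (diff A y) c + scl A (ksign j) (mult A y (diff A c))"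
    using c leibniz[OF y] by (auto simp: homog_def)
  have "tensor_diff A (diff A) (outer_right A (word A [x, y]) c) =
      word A [diff A x, mult A y c] + tscale (ksign i) (word A [x, diff A (mult A y c)])"
    by (simp only: outer_right_word[OF cc(1) h(1,2)] tensor_diff_word2[OF x mult_homog[OF h(2) c]])
  also have "word A [x, diff A (mult A y c)] =
      word A [x, mult A (diff A y) c] + tscale (ksign j) (word A [x, mult A y (diff A c)])"
    unfolding yc using h cc
    by (simp only: word_linear_on_simps mult_carr homog_carr VS.subspace_scale[OF carr_subspace])
  also have "word A [diff A x, mult A y c] + tscale (ksign i)
        (word A [x, mult A (diff A y) c] + tscale (ksign j) (word A [x, mult A y (diff A c)])) =
      outer_right A (word A [diff A x, y]) c + tscale (ksign i) (outer_right A (word A [x, diff A y]) c)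
      + tscale (ksign k) (outer_right A (word A [x, y]) (diff A c))"
    by (simp only: outer_right_word cc h k ksign_add TS.scale_right_distrib TS.scale_scale add.assoc)
  also have "outer_right A (word A [diff A x, y]) c + tscale (ksign i) (outer_right A (word A [x, diff A y]) c) =
      outer_right A (tensor_diff A (diff A) (word A [x, y])) c"
    by (simp only: tensor_diff_word2[OF x h(2)] linear_on_add[OF outer_right_linear_on[OF cc(1)]]
        linear_on_scale[OF outer_right_linear_on[OF cc(1)]] word2_tens h tens_scale)
  finally show "tensor_diff A (diff A) (outer_right A (word A [x, y]) c) =
      outer_right A (tensor_diff A (diff A) (word A [x, y])) c +
      tscale (ksign k) (outer_right A (word A [x, y]) (diff A c))" .
qed

lemma tensor_diff_outer_left:
  assumes t: "t \<in> hcomp (tensor_power 2 A) k" and b: "b \<in> hcomp A l"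
  shows "tensor_diff A (diff A) (outer_left A b t) =
    outer_left A (diff A b) t + tscale (ksign l) (outer_left A b (tensor_diff A (diff A) t))"
proof (rule hcomp_tensor_power_2_eqI[OF vsT _ _ _ t])
  have bh: "b \<in> homog A" using b by (rule hcomp_homog)
  have bc: "b \<in> carr A" "diff A b \<in> carr A" and db: "diff A b \<in> homog A"
    using bh by (simp_all add: homog_carr diff_homog)
  show "linear_on tscale tscale (tens A) (\<lambda>t. tensor_diff A (diff A) (outer_left A b t))"
    by (rule linear_on_compose[OF outer_left_linear_on[OF bc(1)] outer_left_tens[OF bh] tensor_diff_linear_on])
  show "linear_on tscale tscale (tens A)
      (\<lambda>t. outer_left A (diff A b) t + tscale (ksign l) (outer_left A b (tensor_diff A (diff A) t)))"
    by (intro linear_on_plus[OF vsT] linear_on_scaled[OF vsT] outer_left_linear_on[OF bc(2)])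
      (rule linear_on_compose[OF tensor_diff_linear_on tensor_diff_tens outer_left_linear_on[OF bc(1)]])
  fix x y i j
  assume x: "x \<in> hcomp A i" and y: "y \<in> hcomp A j" and k: "k = i + j"
  have h: "x \<in> homog A" "y \<in> homog A" "diff A x \<in> homog A" "diff A y \<in> homog A"
    using x y by (auto simp: hcomp_homog diff_homog)
  have bx: "diff A (mult A b x) = mult A (diff A b) x + scl A (ksign l) (mult A b (diff A x))"
    by (rule leibniz[OF b x])
  have "tensor_diff A (diff A) (outer_left A b (word A [x, y])) =
      word A [diff A (mult A b x), y] + tscale (ksign (l + i)) (word A [mult A b x, diff A y])"
    by (simp only: outer_left_word[OF bc(1) h(1,2)] tensor_diff_word2[OF mult_hcomp[OF b x] h(2)])
  also have "word A [diff A (mult A b x), y] =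
      word A [mult A (diff A b) x, y] + tscale (ksign l) (word A [mult A b (diff A x), y])"
    unfolding bx using h bc
    by (simp only: word_linear_on_simps mult_carr homog_carr VS.subspace_scale[OF carr_subspace])
  also have "word A [mult A (diff A b) x, y] + tscale (ksign l) (word A [mult A b (diff A x), y])
       + tscale (ksign (l + i)) (word A [mult A b x, diff A y]) =
      outer_left A (diff A b) (word A [x, y]) + tscale (ksign l)
      (outer_left A b (word A [diff A x, y]) + tscale (ksign i) (outer_left A b (word A [x, diff A y])))"
    by (simp only: outer_left_word bc h k ksign_add TS.scale_right_distrib TS.scale_scale add.assoc)
  also have "outer_left A b (word A [diff A x, y]) + tscale (ksign i) (outer_left A b (word A [x, diff A y])) =
      outer_left A b (tensor_diff A (diff A) (word A [x, y]))"
    by (simp only: tensor_diff_word2[OF x h(2)] linear_on_add[OF outer_left_linear_on[OF bc(1)]]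
        linear_on_scale[OF outer_left_linear_on[OF bc(1)]] word2_tens h tens_scale)
  finally show "tensor_diff A (diff A) (outer_left A b (word A [x, y])) =
      outer_left A (diff A b) (word A [x, y]) +
      tscale (ksign l) (outer_left A b (tensor_diff A (diff A) (word A [x, y])))" .
qed

end

text \<open>A double bracket that need not be compatible with the differential.\<close>

locale graded_double_bracket = dg_algebra A
  for A :: "('k::field, 'a::ab_group_add, 'z) dgalg_scheme" +
  fixes N :: int and br :: "'a \<Rightarrow> 'a \<Rightarrow> ('k, 'a) tensor"
  assumes br_bilinear: "bilinear_map A A (tensor_power 2 A) br"
    and br_degree: "has_bidegree A A (tensor_power 2 A) N br"
    and br_derivation: "\<lbrakk>a \<in> hcomp A i; b \<in> hcomp A j; c \<in> hcomp A l\<rbrakk> \<Longrightarrow>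
      br a (mult A b c) =
        outer_right A (br a b) c + tscale (ksign ((i + N) * j)) (outer_left A b (br a c))"
    and br_skew: "\<lbrakk>a \<in> hcomp A i; b \<in> hcomp A j\<rbrakk> \<Longrightarrow>
      br a b = - tscale (ksign ((i + N) * (j + N))) (flip A (br b a))"
begin

lemma br_left: "b \<in> carr A \<Longrightarrow> linear_on (scl A) tscale (carr A) (\<lambda>a. br a b)"
  using br_bilinear linear_map_on[of A "tensor_power 2 A" "\<lambda>a. br a b"] by (simp add: bilinear_map_def)

lemma br_right: "a \<in> carr A \<Longrightarrow> linear_on (scl A) tscale (carr A) (\<lambda>b. br a b)"
  using br_bilinear linear_map_on[of A "tensor_power 2 A" "br a"] by (simp add: bilinear_map_def)

lemma br_tens: "a \<in> carr A \<Longrightarrow> b \<in> carr A \<Longrightarrow> br a b \<in> tens A"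
  using br_bilinear carr_tensor_power[of 2] by (auto simp: bilinear_map_def linear_map_def)

lemma br_hcomp: "a \<in> hcomp A i \<Longrightarrow> b \<in> hcomp A j \<Longrightarrow> br a b \<in> hcomp (tensor_power 2 A) (i + j + N)"
  using br_degree by (simp add: has_bidegree_def)

text \<open>Compatibility with the differential on a pair \<open>a\<close>, \<open>b\<close> with \<open>a\<close> of degree \<open>i\<close>.\<close>

definition diff_compatible :: "int \<Rightarrow> 'a \<Rightarrow> 'a \<Rightarrow> bool"
  where "diff_compatible i a b \<longleftrightarrow> tensor_diff A (diff A) (br a b) =
    br (diff A a) b + tscale (ksign (i + N)) (br a (diff A b))"

text \<open>Compatibility passes from \<open>b\<close> and \<open>c\<close> to their product, by the derivation rule.\<close>

lemma diff_compatible_mult: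
  assumes a: "a \<in> hcomp A i" and b: "b \<in> hcomp A j" and c: "c \<in> hcomp A l"
    and ab: "diff_compatible i a b" and ac: "diff_compatible i a c"
  shows "diff_compatible i a (mult A b c)"
proof -
  let ?d = "diff A" and ?t = "tensor_diff A (diff A)"
  let ?R = "outer_right A" and ?L = "outer_left A"
  note d = diff_hcomp[OF a] diff_hcomp[OF b] diff_hcomp[OF c]
  have h: "a \<in> homog A" "b \<in> homog A" "c \<in> homog A" "?d a \<in> homog A" "?d b \<in> homog A" "?d c \<in> homog A"
    using a b c d by (auto simp: hcomp_homog)
  then have ca: "a \<in> carr A" "b \<in> carr A" "c \<in> carr A" "?d a \<in> carr A" "?d b \<in> carr A" "?d c \<in> carr A"
    by (auto simp: homog_carr)
  note Rl = outer_right_linear_on and Ll = outer_left_linear_on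
  define s where "s = (ksign ((i + N) * j) :: 'k)"
  have s1: "ksign ((i - 1 + N) * j) = s * ksign j" and s2: "ksign ((i + N) * (j - 1)) = ksign (i + N) * s"
    and s3: "ksign (i + j + N) = (ksign (i + N) * ksign j :: 'k)"
    unfolding s_def ksign_add[symmetric] by (rule ksign_cong; simp add: algebra_simps)+
  have "?t (br a (mult A b c)) = ?t (?R (br a b) c) + tscale s (?t (?L b (br a c)))"
    unfolding br_derivation[OF a b c] s_def[symmetric]
    by (simp only: linear_on_add[OF tensor_diff_linear_on] linear_on_scale[OF tensor_diff_linear_on]
        outer_left_tens outer_right_tens tens_scale br_tens ca h)
  also have "?t (?R (br a b) c) = ?R (br (?d a) b) c + tscale (ksign (i + N)) (?R (br a (?d b)) c)
      + tscale (ksign (i + N) * ksign j) (?R (br a b) (?d c))"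
    unfolding tensor_diff_outer_right[OF br_hcomp[OF a b] h(3)] ab[unfolded diff_compatible_def] s3
    by (simp only: linear_on_add[OF Rl] linear_on_scale[OF Rl] br_tens tens_scale ca)
  also have "?t (?L b (br a c)) = ?L (?d b) (br a c) + tscale (ksign j) (?L b (br (?d a) c))
      + tscale (ksign j * ksign (i + N)) (?L b (br a (?d c)))"
    unfolding tensor_diff_outer_left[OF br_hcomp[OF a c] b] ac[unfolded diff_compatible_def]
    by (simp only: linear_on_add[OF Ll] linear_on_scale[OF Ll] br_tens tens_scale ca
        TS.scale_right_distrib TS.scale_scale add.assoc)
  finally have lhs: "?t (br a (mult A b c)) =
      ?R (br (?d a) b) c + tscale (ksign (i + N)) (?R (br a (?d b)) c)
      + tscale (ksign (i + N) * ksign j) (?R (br a b) (?d c))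
      + tscale s (?L (?d b) (br a c) + tscale (ksign j) (?L b (br (?d a) c))
      + tscale (ksign j * ksign (i + N)) (?L b (br a (?d c))))" .
  have 1: "br (?d a) (mult A b c) = ?R (br (?d a) b) c + tscale (s * ksign j) (?L b (br (?d a) c))"
    using br_derivation[OF d(1) b c] by (simp only: s1)
  have "br a (?d (mult A b c)) = br a (mult A (?d b) c) + tscale (ksign j) (br a (mult A b (?d c)))"
    unfolding leibniz[OF b c]
    by (simp only: linear_on_add[OF br_right] linear_on_scale[OF br_right] mult_carr ca
        VS.subspace_scale[OF carr_subspace])
  also have "br a (mult A (?d b) c) = ?R (br a (?d b)) c + tscale (ksign (i + N) * s) (?L (?d b) (br a c))"
    using br_derivation[OF a d(2) c] by (simp only: s2)
  also have "br a (mult A b (?d c)) = ?R (br a b) (?d c) + tscale s (?L b (br a (?d c)))"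
    using br_derivation[OF a b d(3)] by (simp only: s_def)
  finally have 2: "br a (?d (mult A b c)) = ?R (br a (?d b)) c + tscale (ksign (i + N) * s) (?L (?d b) (br a c))
      + tscale (ksign j) (?R (br a b) (?d c) + tscale s (?L b (br a (?d c))))" .
  have sq: "ksign (i + N) * (ksign (i + N) * s) = s"
    by (simp add: mult.assoc[symmetric] ksign_square)
  show ?thesis
    unfolding diff_compatible_def lhs 1 2 TS.scale_right_distrib TS.scale_scale sq
    by (simp only: ac_simps)
qed

text \<open>Compatibility is symmetric, by skew symmetry of the bracket.\<close>

lemma diff_compatible_skew:
  assumes a: "a \<in> hcomp A i" and b: "b \<in> hcomp A j" and ba: "diff_compatible j b a"
  shows "diff_compatible i a b"
proof -
  let ?d = "diff A" and ?t = "tensor_diff A (diff A)"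
  note d = diff_hcomp[OF a] diff_hcomp[OF b]
  have h: "a \<in> homog A" "b \<in> homog A" "?d a \<in> homog A" "?d b \<in> homog A"
    using a b d by (auto simp: hcomp_homog)
  then have ca: "a \<in> carr A" "b \<in> carr A" "?d a \<in> carr A" "?d b \<in> carr A"
    by (auto simp: homog_carr)
  define s where "s = (ksign ((i + N) * (j + N)) :: 'k)"
  have s1: "ksign ((i - 1 + N) * (j + N)) = s * ksign (j + N)"
    and s2: "ksign ((i + N) * (j - 1 + N)) = ksign (i + N) * s"
    unfolding s_def ksign_add[symmetric] by (rule ksign_cong; simp add: algebra_simps)+
  have sq: "ksign (i + N) * (ksign (i + N) * s) = s"
    by (simp add: mult.assoc[symmetric] ksign_square)
  have "?t (br a b) = ?t (tscale (- s) (flip A (br b a)))"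
    unfolding br_skew[OF a b] s_def by simp
  also have "\<dots> = tscale (- s) (flip A (?t (br b a)))"
    by (simp only: linear_on_scale[OF tensor_diff_linear_on] flip_in_tens br_tens ca
        tensor_diff_flip[OF br_hcomp[OF b a]])
  also have "\<dots> = tscale (- s) (flip A (br (?d b) a) + tscale (ksign (j + N)) (flip A (br b (?d a))))"
    unfolding ba[unfolded diff_compatible_def]
    by (simp only: linear_on_add[OF flip_linear_on] linear_on_scale[OF flip_linear_on] br_tens tens_scale ca)
  finally have 1: "?t (br a b) = \<dots>" .
  have 2: "br (?d a) b = tscale (- (s * ksign (j + N))) (flip A (br b (?d a)))"
    unfolding br_skew[OF d(1) b] s1 by (simp only: TS.scale_minus_left)
  have 3: "br a (?d b) = tscale (- (ksign (i + N) * s)) (flip A (br (?d b) a))"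
    unfolding br_skew[OF a d(2)] s2 by (simp only: TS.scale_minus_left)
  show ?thesis
    unfolding diff_compatible_def 1 2 3
    by (simp only: TS.scale_right_distrib TS.scale_scale mult_minus_right mult_minus_left sq)
      (rule add.commute)
qed

end


section \<open>Desuspension\<close>

text \<open>
  Tensors do not see the grading, so those over \<open>V[-1]\<close> are those over \<open>V\<close>; only degrees change.
\<close>

lemma desusp_simps [simp]:
  "scl (desusp V) = scl V" "hcomp (desusp V) i = hcomp V (i + 1)"
  by (simp_all add: desusp_def)

lemma homog_desusp [simp]: "homog (desusp V) = homog V"
proof -
  have "(\<Union>i. hcomp V (i + 1)) = (\<Union>i. hcomp V i)"
    by (rule antisym) (auto intro: exI[of _ "_ - 1"], metis diff_add_cancel)
  then show ?thesis by (simp add: homog_def)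
qed

lemma carr_desusp [simp]: "carr (desusp V) = carr V"
  by (simp add: carr_def)

lemma word_desusp [simp]: "word (desusp V) = word V"
  by (simp add: word_def fun_eq_iff multilinear_form_def)

lemma tens_desusp [simp]: "tens (desusp V) = tens V"
  by (simp add: tens_def)

lemma lift_desusp [simp]: "lift (desusp V) = lift V"
  by (simp add: lift_def fun_eq_iff)

lemma tmul_desusp [simp]: "tmul (desusp V) = tmul V"
  by (simp add: tmul_def fun_eq_iff)

lemma nzl_desusp [simp]: "nzl (desusp V) = nzl V"
  by (simp add: nzl_def)

lemma (in graded_space) graded_desusp: "graded_space (desusp V)"
proof (rule graded_space.intro)
  fix x i
  assume x: "\<And>i. x i \<in> hcomp (desusp V) i" and fin: "finite {i. x i \<noteq> 0}"
    and sum: "(\<Sum>i | x i \<noteq> 0. x i) = 0"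
  define z where "z j = x (j - 1)" for j
  have supp: "{j. z j \<noteq> 0} = (\<lambda>i. i + 1) ` {i. x i \<noteq> 0}"
    by (force simp: z_def image_iff intro: exI[of _ "_ - 1"])
  have "z (i + 1) = 0"
  proof (rule comp_independent[of z])
    show "z j \<in> hcomp V j" for j
      using x[of "j - 1"] by (simp add: z_def)
    show "finite {j. z j \<noteq> 0}"
      unfolding supp using fin by simp
    have "(\<Sum>j | z j \<noteq> 0. z j) = (\<Sum>i | x i \<noteq> 0. x i)"
      unfolding supp by (subst sum.reindex) (simp_all add: inj_on_def z_def)
    then show "(\<Sum>j | z j \<noteq> 0. z j) = 0"
      using sum by simp
  qed
  then show "x i = 0" by (simp add: z_def)
qed (simp_all add: vector_space comp_subspace)

lemma (in graded_space) deg_desusp: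
  assumes "x \<in> homog V" "x \<noteq> 0"
  shows "deg V x = deg (desusp V) x + 1"
proof -
  interpret D: graded_space "desusp V" by (rule graded_desusp)
  from assms obtain i where i: "x \<in> hcomp V i"
    by (auto simp: homog_def)
  then show ?thesis
    using deg_eq[OF i] D.deg_eq[of x "i - 1"] assms by simp
qed


section \<open>The cobar construction\<close>

lemma cobar_simps [simp]:
  "scl (cobar C) = tscale" "hcomp (cobar C) = hcomp (tensor_algebra (desusp C))"
  "diff (cobar C) = odd_derivation (desusp C) (cobar_gen C)"
  "mult (cobar C) = tmul C" "unity (cobar C) = word C []"
  by (simp_all add: cobar_def)

context dg_coalgebra
begin

sublocale desusp: graded_space "desusp C"
  by (rule graded_desusp)

text \<open>The quadratic part of the cobar differential, as a map on \<open>C \<otimes> C\<close>.\<close>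

definition quad :: "('k, 'v) tensor \<Rightarrow> ('k, 'v) tensor"
  where "quad = lift2 C tscale (\<lambda>x y. tscale (ksign (deg C x)) (word C [x, y]))"

lemma quad_lin:
  "x \<in> homog C \<Longrightarrow> linear_on (scl C) tscale (hcomp C i) (\<lambda>y. tscale (ksign (deg C x)) (word C [x, y]))"
  "y \<in> homog C \<Longrightarrow> linear_on (scl C) tscale (hcomp C i) (\<lambda>x. tscale (ksign (deg C x)) (word C [x, y]))"
  by (intro linear_on_scaled[OF vsT] linear_on_subset[OF word2_linear_on(1) hcomp_subset_carr], simp add: homog_carr)
    (intro linear_on_deg[OF vsT, of i "\<lambda>d x. tscale (ksign d) (word C [x, y])"] linear_on_scaled[OF vsT]
      linear_on_subset[OF word2_linear_on(2) hcomp_subset_carr], simp add: homog_carr)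

lemma quad_linear_on: "linear_on tscale tscale (tens C) quad"
  unfolding quad_def by (rule lift2_linear_on[OF vsT quad_lin])

lemma quad_word:
  assumes x: "x \<in> hcomp C i" and y: "y \<in> homog C"
  shows "quad (word C [x, y]) = tscale (ksign i) (word C [x, y])"
proof -
  have "quad (word C [x, y]) = tscale (ksign (deg C x)) (word C [x, y])"
    unfolding quad_def by (rule lift2_word[OF vsT quad_lin hcomp_homog[OF x] y])
  then show ?thesis
    using x y by (cases "x = 0") (simp_all add: deg_eq word2_zero)
qed

lemma quad_tens: "t \<in> tens C \<Longrightarrow> quad t \<in> tens C"
  unfolding quad_def lift2_def
  by (rule lift_in[OF vsT mh2[OF vsT quad_lin] tens_subspace])
    (auto split: list.split intro!: tens_scale word_tens)

lemma quad_hcomp: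
  assumes "t \<in> hcomp (tensor_power 2 C) k"
  shows "quad t \<in> hcomp (tensor_algebra (desusp C)) (k - 2)"
proof (rule hcomp_tensor_power_2_inI[OF vsT quad_linear_on desusp.tensor_algebra_subspace _ assms])
  fix x y i j
  assume x: "x \<in> hcomp C i" and y: "y \<in> hcomp C j" and k: "k = i + j"
  have "word C [x, y] \<in> hcomp (tensor_algebra (desusp C)) (k - 2)"
    using desusp.word_hcomp(1)[of "[x, y]" "[i - 1, j - 1]"] x y k by (simp add: algebra_simps)
  then show "quad (word C [x, y]) \<in> hcomp (tensor_algebra (desusp C)) (k - 2)"
    using TS.subspace_scale[OF desusp.tensor_algebra_subspace]
    by (simp add: quad_word[OF x hcomp_homog[OF y]])
qed

lemma comult_linear_on: "linear_on (scl C) tscale (carr C) (comult C)"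
  using linear_map_on[OF comult_linear] by simp

lemma comult_tens: "x \<in> carr C \<Longrightarrow> comult C x \<in> tens C"
  using comult_linear carr_tensor_power[of 2] by (auto simp: linear_map_def)

lemma comult_hcomp: "x \<in> hcomp C i \<Longrightarrow> comult C x \<in> hcomp (tensor_power 2 C) i"
  using comult_degree by (auto simp: has_degree_def)

lemma cobar_gen_eq: "cobar_gen C x = word C [diff C x] + quad (comult C x)"
  by (simp add: cobar_gen_def quad_def)

lemma cobar_gen_linear_on: "linear_on (scl C) tscale (carr C) (cobar_gen C)"
  unfolding cobar_gen_eq
  by (intro linear_on_plus[OF vsT] linear_on_compose[OF diff_linear_on diff_carr word1_linear_on]
      linear_on_compose[OF comult_linear_on comult_tens quad_linear_on])

lemma cobar_gen_lin: "linear_on (scl (desusp C)) tscale (hcomp (desusp C) i) (cobar_gen C)"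
  using linear_on_subset[OF cobar_gen_linear_on hcomp_subset_carr] by simp

lemma cobar_gen_tens: "x \<in> homog (desusp C) \<Longrightarrow> cobar_gen C x \<in> tens (desusp C)"
  unfolding cobar_gen_eq by (simp add: tens_add word_tens diff_homog quad_tens comult_tens homog_carr)

lemma cobar_gen_hcomp:
  assumes "x \<in> hcomp (desusp C) i"
  shows "cobar_gen C x \<in> hcomp (tensor_algebra (desusp C)) (i - 1)"
proof -
  have x: "x \<in> hcomp C (i + 1)"
    using assms by simp
  have "word C [diff C x] \<in> hcomp (tensor_algebra (desusp C)) (i - 1)"
    using desusp.word_hcomp(1)[of "[diff C x]" "[i - 1]"] diff_hcomp[OF x] by simp
  moreover have "quad (comult C x) \<in> hcomp (tensor_algebra (desusp C)) (i - 1)"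
    using quad_hcomp[OF comult_hcomp[OF x]] by simp
  ultimately show ?thesis
    unfolding cobar_gen_eq by (rule TS.subspace_add[OF desusp.tensor_algebra_subspace])
qed

text \<open>
  The map \<open>x \<otimes> y \<otimes> z \<mapsto> (-1)\<^sup>|\<^sup>y\<^sup>| (x, y, z)\<close>, by which coassociativity enters.
\<close>

definition cubic :: "('k, 'v) tensor \<Rightarrow> ('k, 'v) tensor"
  where "cubic = lift C tscale (\<lambda>xs. case xs of [x, y, z] \<Rightarrow>
    tscale (ksign (deg C y)) (word C [x, y, z]) | _ \<Rightarrow> 0)"

lemma cubic_mh: "multihomogeneous C tscale (\<lambda>xs. case xs of [x, y, z] \<Rightarrow>
    tscale (ksign (deg C y)) (word C [x, y, z]) | _ \<Rightarrow> 0)"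
  by (rule perm3_lin[where \<alpha> = "\<lambda>x y z. y"]) (simp add: word3_linear_on)

lemma cubic_linear_on: "linear_on tscale tscale (tens C) cubic"
  unfolding cubic_def by (rule lift_linear_on[OF vsT cubic_mh])

lemma cubic_word:
  assumes x: "x \<in> homog C" and y: "y \<in> hcomp C i" and z: "z \<in> homog C"
  shows "cubic (word C [x, y, z]) = tscale (ksign i) (word C [x, y, z])"
proof -
  have xs: "[x, y, z] \<in> lists (homog C)"
    using x y z by (simp add: hcomp_homog)
  have eq: "cubic (word C [x, y, z]) = tscale (ksign (deg C y)) (word C [x, y, z])"
    unfolding cubic_def by (subst lift_word[OF vsT cubic_mh xs]) simp
  show ?thesis
  proof (cases "y = 0")
    case True
    then have "word C [x, y, z] = 0"
      using word_eq_0[OF xs] by simp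
    then show ?thesis
      unfolding eq by (simp only: TS.scale_zero_right)
  next
    case False
    then have "deg C y = i"
      by (rule deg_eq[OF y])
    then show ?thesis
      by (simp only: eq)
  qed
qed

text \<open>The two ways to apply \<open>\<Delta>\<close> twice differ by a sign in \<open>\<partial>\<^sup>2\<close>, which \<open>cubic\<close> absorbs.\<close>

lemma cubic_tmul_left:
  assumes t: "t \<in> hcomp (tensor_power 2 C) i" and y: "y \<in> homog C"
  shows "cubic (tmul C t (word C [y])) = tscale (ksign i) (tmul C (quad t) (word C [y]))"
proof (rule hcomp_tensor_power_2_eqI[OF vsT _ _ _ t])
  have wy: "word C [y] \<in> tens C"
    using y by (simp add: word_tens)
  show "linear_on tscale tscale (tens C) (\<lambda>t. cubic (tmul C t (word C [y])))"
    by (rule linear_on_compose[OF tmul_left[OF wy] tmul_tens[OF _ wy] cubic_linear_on])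
  show "linear_on tscale tscale (tens C) (\<lambda>t. tscale (ksign i) (tmul C (quad t) (word C [y])))"
    by (intro linear_on_scaled[OF vsT] linear_on_compose[OF quad_linear_on quad_tens tmul_left[OF wy]])
  fix u v p q
  assume u: "u \<in> hcomp C p" and v: "v \<in> hcomp C q" and i: "i = p + q"
  have h: "u \<in> homog C" "v \<in> homog C"
    using u v by (auto simp: hcomp_homog)
  have "ksign (p + q) * ksign p = (ksign q :: 'k)"
    unfolding ksign_add[symmetric] by (rule ksign_cong) simp
  then show "cubic (tmul C (word C [u, v]) (word C [y])) =
      tscale (ksign i) (tmul C (quad (word C [u, v])) (word C [y]))"
    using h y wy
    by (simp add: cubic_word[OF h(1) v y] quad_word[OF u h(2)] tmul_scale_left word_tens i)
qed

lemma cubic_tmul_right: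
  assumes t: "t \<in> hcomp (tensor_power 2 C) i" and x: "x \<in> homog C"
  shows "cubic (tmul C (word C [x]) t) = tmul C (word C [x]) (quad t)"
proof (rule hcomp_tensor_power_2_eqI[OF vsT _ _ _ t])
  have wx: "word C [x] \<in> tens C"
    using x by (simp add: word_tens)
  show "linear_on tscale tscale (tens C) (\<lambda>t. cubic (tmul C (word C [x]) t))"
    by (rule linear_on_compose[OF tmul_right[OF wx] tmul_tens[OF wx] cubic_linear_on])
  show "linear_on tscale tscale (tens C) (\<lambda>t. tmul C (word C [x]) (quad t))"
    by (rule linear_on_compose[OF quad_linear_on quad_tens tmul_right[OF wx]])
  fix u v p q
  assume u: "u \<in> hcomp C p" and v: "v \<in> hcomp C q"
  have h: "u \<in> homog C" "v \<in> homog C"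
    using u v by (auto simp: hcomp_homog)
  show "cubic (tmul C (word C [x]) (word C [u, v])) = tmul C (word C [x]) (quad (word C [u, v]))"
    using h x wx
    by (simp add: cubic_word[OF x u h(2)] quad_word[OF u h(2)] tmul_scale_right word_tens)
qed

lemma coassoc_lin:
  "x \<in> homog C \<Longrightarrow> linear_on (scl C) tscale (hcomp C i) (\<lambda>y. tmul C (comult C x) (word C [y]))"
  "y \<in> homog C \<Longrightarrow> linear_on (scl C) tscale (hcomp C i) (\<lambda>x. tmul C (comult C x) (word C [y]))"
  "x \<in> homog C \<Longrightarrow> linear_on (scl C) tscale (hcomp C i) (\<lambda>y. tmul C (word C [x]) (comult C y))"
  "y \<in> homog C \<Longrightarrow> linear_on (scl C) tscale (hcomp C i) (\<lambda>x. tmul C (word C [x]) (comult C y))"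
proof -
  note w = linear_on_subset[OF word1_linear_on hcomp_subset_carr]
    and c = linear_on_subset[OF comult_linear_on hcomp_subset_carr]
  show "x \<in> homog C \<Longrightarrow> linear_on (scl C) tscale (hcomp C i) (\<lambda>y. tmul C (comult C x) (word C [y]))"
    by (rule linear_on_compose[OF w _ tmul_right]) (simp_all add: word_tens hcomp_homog comult_tens homog_carr)
  show "y \<in> homog C \<Longrightarrow> linear_on (scl C) tscale (hcomp C i) (\<lambda>x. tmul C (comult C x) (word C [y]))"
    by (rule linear_on_compose[OF c _ tmul_left]) (simp_all add: word_tens comult_tens hcomp_carr)
  show "x \<in> homog C \<Longrightarrow> linear_on (scl C) tscale (hcomp C i) (\<lambda>y. tmul C (word C [x]) (comult C y))"
    by (rule linear_on_compose[OF c _ tmul_right]) (simp_all add: word_tens comult_tens hcomp_carr)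
  show "y \<in> homog C \<Longrightarrow> linear_on (scl C) tscale (hcomp C i) (\<lambda>x. tmul C (word C [x]) (comult C y))"
    by (rule linear_on_compose[OF w _ tmul_left]) (simp_all add: word_tens hcomp_homog comult_tens homog_carr)
qed

lemma coassoc_tens:
  assumes t: "t \<in> tens C"
  shows "lift2 C tscale (\<lambda>x y. tmul C (comult C x) (word C [y])) t \<in> tens C"
    "lift2 C tscale (\<lambda>x y. tmul C (word C [x]) (comult C y)) t \<in> tens C"
proof -
  show "lift2 C tscale (\<lambda>x y. tmul C (comult C x) (word C [y])) t \<in> tens C"
    unfolding lift2_def
  proof (rule lift_in[OF vsT mh2[OF vsT coassoc_lin(1,2)] tens_subspace _ t])
    fix xs assume "xs \<in> lists (homog C)"
    then show "(case xs of [x, y] \<Rightarrow> tmul C (comult C x) (word C [y]) | _ \<Rightarrow> 0) \<in> tens C"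
      by (auto split: list.split intro!: tmul_tens word_tens comult_tens homog_carr)
  qed
  show "lift2 C tscale (\<lambda>x y. tmul C (word C [x]) (comult C y)) t \<in> tens C"
    unfolding lift2_def
  proof (rule lift_in[OF vsT mh2[OF vsT coassoc_lin(3,4)] tens_subspace _ t])
    fix xs assume "xs \<in> lists (homog C)"
    then show "(case xs of [x, y] \<Rightarrow> tmul C (word C [x]) (comult C y) | _ \<Rightarrow> 0) \<in> tens C"
      by (auto split: list.split intro!: tmul_tens word_tens comult_tens homog_carr)
  qed
qed

abbreviation cobar_diff :: "('k, 'v) tensor \<Rightarrow> ('k, 'v) tensor"
  where "cobar_diff \<equiv> odd_derivation (desusp C) (cobar_gen C)"

lemmas cobar_diff_linear_on =
  desusp.odd_derivation_linear_on[OF cobar_gen_lin cobar_gen_tens, simplified]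

lemmas cobar_diff_tens =
  desusp.odd_derivation_tens[OF cobar_gen_lin cobar_gen_tens, simplified]

lemmas cobar_diff_single =
  desusp.odd_derivation_single[OF cobar_gen_lin cobar_gen_tens, simplified]

lemmas cobar_diff_unit =
  desusp.odd_derivation_unit[OF cobar_gen_lin cobar_gen_tens, simplified]

lemma cobar_diff_leibniz:
  "x \<in> hcomp (tensor_algebra (desusp C)) i \<Longrightarrow> y \<in> tens C \<Longrightarrow>
    cobar_diff (tmul C x y) = tmul C (cobar_diff x) y + tscale (ksign i) (tmul C x (cobar_diff y))"
  using desusp.odd_derivation_leibniz[OF cobar_gen_lin cobar_gen_tens, of x i y] by simp

lemma cobar_diff_word2:
  assumes x: "x \<in> hcomp C i" and y: "y \<in> homog C"
  shows "cobar_diff (word C [x, y]) = tmul C (cobar_gen C x) (word C [y]) +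
    tscale (ksign (i - 1)) (tmul C (word C [x]) (cobar_gen C y))"
proof -
  have xh: "x \<in> homog C"
    using x by (rule hcomp_homog)
  have "word C [x] \<in> hcomp (tensor_algebra (desusp C)) (i - 1)"
    using desusp.word_hcomp(1)[of "[x]" "[i - 1]"] x by simp
  from cobar_diff_leibniz[OF this word_tens[of "[y]"]] show ?thesis
    using xh y by (simp add: cobar_diff_single)
qed

text \<open>
  The terms of \<open>\<partial>\<^sup>2\<close> that involve the differential of \<open>C\<close> cancel; the rest is the difference of
  the two iterated coproducts.
\<close>

lemma cobar_diff_quad:
  assumes t: "t \<in> hcomp (tensor_power 2 C) k"
  shows "quad (tensor_diff C (diff C) t) + cobar_diff (quad t) =
    cubic (lift2 C tscale (\<lambda>x y. tmul C (comult C x) (word C [y])) t) -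
    cubic (lift2 C tscale (\<lambda>x y. tmul C (word C [x]) (comult C y)) t)"
proof (rule hcomp_tensor_power_2_eqI[OF vsT _ _ _ t])
  show "linear_on tscale tscale (tens C) (\<lambda>t. quad (tensor_diff C (diff C) t) + cobar_diff (quad t))"
    by (intro linear_on_plus[OF vsT] linear_on_compose[OF tensor_diff_linear_on tensor_diff_tens quad_linear_on]
        linear_on_compose[OF quad_linear_on quad_tens cobar_diff_linear_on])
  show "linear_on tscale tscale (tens C) (\<lambda>t.
      cubic (lift2 C tscale (\<lambda>x y. tmul C (comult C x) (word C [y])) t) -
      cubic (lift2 C tscale (\<lambda>x y. tmul C (word C [x]) (comult C y)) t))"
    unfolding diff_conv_add_uminus
    by (intro linear_on_plus[OF vsT] linear_on_uminus[OF vsT]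
        linear_on_compose[OF lift2_linear_on[OF vsT coassoc_lin(1,2)] coassoc_tens(1) cubic_linear_on]
        linear_on_compose[OF lift2_linear_on[OF vsT coassoc_lin(3,4)] coassoc_tens(2) cubic_linear_on])
  fix x y i j
  assume x: "x \<in> hcomp C i" and y: "y \<in> hcomp C j"
  note d = diff_hcomp[OF x] diff_hcomp[OF y]
  have h: "x \<in> homog C" "y \<in> homog C" "diff C x \<in> homog C" "diff C y \<in> homog C"
    using x y d by (auto simp: hcomp_homog)
  have t: "word C [x] \<in> tens C" "word C [y] \<in> tens C" "word C [diff C x] \<in> tens C"
    "word C [diff C y] \<in> tens C" "word C [diff C x, y] \<in> tens C" "word C [x, diff C y] \<in> tens C"
    "word C [x, y] \<in> tens C" "quad (comult C x) \<in> tens C" "quad (comult C y) \<in> tens C"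
    using h by (simp_all add: word_tens quad_tens comult_tens homog_carr)
  have s: "ksign (i - 1) = (- ksign i :: 'k)"
    by (rule ksign_cong_minus) simp
  have 1: "quad (tensor_diff C (diff C) (word C [x, y])) =
      tscale (- ksign i) (word C [diff C x, y]) + word C [x, diff C y]"
    by (simp add: tensor_diff_word2[OF x h(2)] linear_on_add[OF quad_linear_on] linear_on_scale[OF quad_linear_on]
        t tens_scale quad_word[OF d(1) h(2)] quad_word[OF x h(4)] s ksign_square)
  have 2: "cobar_diff (quad (word C [x, y])) =
      tscale (ksign i) (word C [diff C x, y] + tmul C (quad (comult C x)) (word C [y]))
      - (word C [x, diff C y] + tmul C (word C [x]) (quad (comult C y)))"
    using h
    by (simp add: quad_word[OF x h(2)] linear_on_scale[OF cobar_diff_linear_on] t cobar_diff_word2[OF x h(2)] s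
        cobar_gen_eq tmul_add_left tmul_add_right TS.scale_right_distrib ksign_square
        TS.scale_right_diff_distrib)
  have 3: "cubic (lift2 C tscale (\<lambda>x y. tmul C (comult C x) (word C [y])) (word C [x, y])) =
      tscale (ksign i) (tmul C (quad (comult C x)) (word C [y]))"
  proof -
    have "lift2 C tscale (\<lambda>x y. tmul C (comult C x) (word C [y])) (word C [x, y]) =
        tmul C (comult C x) (word C [y])"
      by (rule lift2_word[OF vsT coassoc_lin(1,2) h(1,2)])
    then show ?thesis
      by (simp only: cubic_tmul_left[OF comult_hcomp[OF x] h(2)])
  qed
  have 4: "cubic (lift2 C tscale (\<lambda>x y. tmul C (word C [x]) (comult C y)) (word C [x, y])) =
      tmul C (word C [x]) (quad (comult C y))"
  proof -
    have "lift2 C tscale (\<lambda>x y. tmul C (word C [x]) (comult C y)) (word C [x, y]) =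
        tmul C (word C [x]) (comult C y)"
      by (rule lift2_word[OF vsT coassoc_lin(3,4) h(1,2)])
    then show ?thesis
      by (simp only: cubic_tmul_right[OF comult_hcomp[OF y] h(1)])
  qed
  show "quad (tensor_diff C (diff C) (word C [x, y])) + cobar_diff (quad (word C [x, y])) =
      cubic (lift2 C tscale (\<lambda>x y. tmul C (comult C x) (word C [y])) (word C [x, y])) -
      cubic (lift2 C tscale (\<lambda>x y. tmul C (word C [x]) (comult C y)) (word C [x, y]))"
  proof -
    have cancel: "(- a + b) + ((a + p) - (b + q)) = p - q" for a b p q :: "'q::ab_group_add"
      by (simp add: algebra_simps)
    show ?thesis
      unfolding 1 2 3 4 TS.scale_right_distrib TS.scale_minus_left by (rule cancel)
  qed
qed

lemma cobar_diff_gen: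
  assumes x: "x \<in> homog C"
  shows "cobar_diff (cobar_gen C x) = 0"
proof -
  obtain i where i: "x \<in> hcomp C i"
    using x by (auto simp: homog_def)
  have dx: "diff C x \<in> homog C" and c: "x \<in> carr C"
    using x by (simp_all add: diff_homog homog_carr)
  have "cobar_diff (cobar_gen C x) = cobar_gen C (diff C x) + cobar_diff (quad (comult C x))"
    unfolding cobar_gen_eq[of x]
    by (simp only: linear_on_add[OF cobar_diff_linear_on] word_tens Cons_in_lists_iff lists.Nil dx
        quad_tens comult_tens c cobar_diff_single simp_thms)
  also have "cobar_gen C (diff C x) = quad (tensor_diff C (diff C) (comult C x))"
    unfolding cobar_gen_eq[of "diff C x"] diff_diff[OF c] comult_diff[OF c]
    by (simp add: word_eq_0)
  also have "\<dots> + cobar_diff (quad (comult C x)) = 0"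
    unfolding cobar_diff_quad[OF comult_hcomp[OF i]] coassoc[OF c] by (rule diff_self)
  finally show ?thesis .
qed

lemma carr_cobar [simp]: "carr (cobar C) = tens C"
  using desusp.carr_tensor_algebra by (simp add: carr_def homog_def)

lemma hcomp_tens: "p \<in> hcomp (tensor_algebra (desusp C)) i \<Longrightarrow> p \<in> tens C"
  using desusp.hcomp_tensor_algebra_tens[of i] by auto

text \<open>Multilinear identities in \<open>\<Omega>(C)\<close> need only be checked on words.\<close>

lemma words_eqI:
  assumes "linear_on tscale tscale (tens C) F" "linear_on tscale tscale (tens C) G"
    and "\<And>v. v \<in> nzl C \<Longrightarrow> wdeg (desusp C) v = i \<Longrightarrow> F (word C v) = G (word C v)"
    and "p \<in> hcomp (tensor_algebra (desusp C)) i"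
  shows "F p = G p"
  using desusp.hcomp_eqI[OF vsT, of F G i p] assms by simp

lemma words_eqI2:
  assumes "\<And>q. q \<in> tens C \<Longrightarrow> linear_on tscale tscale (tens C) (\<lambda>p. F p q)"
    "\<And>q. q \<in> tens C \<Longrightarrow> linear_on tscale tscale (tens C) (\<lambda>p. G p q)"
    and "\<And>p. p \<in> tens C \<Longrightarrow> linear_on tscale tscale (tens C) (F p)"
    "\<And>p. p \<in> tens C \<Longrightarrow> linear_on tscale tscale (tens C) (G p)"
    and "\<And>v w. v \<in> nzl C \<Longrightarrow> w \<in> nzl C \<Longrightarrow> wdeg (desusp C) v = i \<Longrightarrow> wdeg (desusp C) w = j \<Longrightarrow>
      F (word C v) (word C w) = G (word C v) (word C w)"
    and p: "p \<in> hcomp (tensor_algebra (desusp C)) i" and q: "q \<in> hcomp (tensor_algebra (desusp C)) j"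
  shows "F p q = G p q"
proof (rule words_eqI[OF assms(1,2)[OF hcomp_tens[OF q]] _ p])
  fix v assume v: "v \<in> nzl C" "wdeg (desusp C) v = i"
  then have wv: "word C v \<in> tens C"
    by (simp add: word_tens nzl_homog)
  show "F (word C v) q = G (word C v) q"
    by (rule words_eqI[OF assms(3,4)[OF wv] _ q]) (use v assms(5) in simp)
qed

lemma words_eqI3:
  assumes "\<And>q r. q \<in> tens C \<Longrightarrow> r \<in> tens C \<Longrightarrow> linear_on tscale tscale (tens C) (\<lambda>p. F p q r)"
    "\<And>q r. q \<in> tens C \<Longrightarrow> r \<in> tens C \<Longrightarrow> linear_on tscale tscale (tens C) (\<lambda>p. G p q r)"
    and "\<And>p r. p \<in> tens C \<Longrightarrow> r \<in> tens C \<Longrightarrow> linear_on tscale tscale (tens C) (\<lambda>q. F p q r)"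
    "\<And>p r. p \<in> tens C \<Longrightarrow> r \<in> tens C \<Longrightarrow> linear_on tscale tscale (tens C) (\<lambda>q. G p q r)"
    and "\<And>p q. p \<in> tens C \<Longrightarrow> q \<in> tens C \<Longrightarrow> linear_on tscale tscale (tens C) (F p q)"
    "\<And>p q. p \<in> tens C \<Longrightarrow> q \<in> tens C \<Longrightarrow> linear_on tscale tscale (tens C) (G p q)"
    and "\<And>u v w. u \<in> nzl C \<Longrightarrow> v \<in> nzl C \<Longrightarrow> w \<in> nzl C \<Longrightarrow> wdeg (desusp C) u = i \<Longrightarrow>
      wdeg (desusp C) v = j \<Longrightarrow> wdeg (desusp C) w = l \<Longrightarrow>
      F (word C u) (word C v) (word C w) = G (word C u) (word C v) (word C w)"
    and p: "p \<in> hcomp (tensor_algebra (desusp C)) i" and q: "q \<in> hcomp (tensor_algebra (desusp C)) j"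
    and r: "r \<in> hcomp (tensor_algebra (desusp C)) l"
  shows "F p q r = G p q r"
proof (rule words_eqI[OF assms(1,2)[OF hcomp_tens[OF q] hcomp_tens[OF r]] _ p])
  fix u assume u: "u \<in> nzl C" "wdeg (desusp C) u = i"
  then have wu: "word C u \<in> tens C"
    by (simp add: word_tens nzl_homog)
  show "F (word C u) q r = G (word C u) q r"
    by (rule words_eqI2[OF assms(3,4)[OF wu] assms(5,6)[OF wu] _ q r]) (use u assms(7) in simp_all)
qed

lemma dg_algebra_cobar: "dg_algebra (cobar C)"
proof -
  interpret T: graded_space "tensor_algebra (desusp C)"
    by (rule desusp.graded_tensor_algebra)
  note tens = desusp.hcomp_tensor_algebra_tens[THEN subsetD, simplified]
  show ?thesis
  proof (intro dg_algebra.intro dg_space.intro graded_space.intro dg_space_axioms.intro dg_algebra_axioms.intro)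
    show "vector_space (scl (cobar C))"
      by (simp add: vsT)
    show "module.subspace (scl (cobar C)) (hcomp (cobar C) i)" for i
      using desusp.tensor_algebra_subspace by simp
    show "x i = 0" if "\<And>i. x i \<in> hcomp (cobar C) i" "finite {i. x i \<noteq> 0}" "(\<Sum>i | x i \<noteq> 0. x i) = 0"
      for x i
      by (rule T.comp_independent[of x i]) (use that in simp_all)
    show "linear_map (cobar C) (cobar C) (diff (cobar C))"
      using cobar_diff_linear_on by (simp add: linear_map_def linear_on_def cobar_diff_tens)
    show "has_degree (cobar C) (cobar C) (- 1) (diff (cobar C))"
      using desusp.odd_derivation_hcomp[OF cobar_gen_lin cobar_gen_tens cobar_gen_hcomp]
      by (simp add: has_degree_def)
    show "diff (cobar C) (diff (cobar C) x) = 0" if "x \<in> carr (cobar C)" for x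
      using desusp.odd_derivation_square_0[OF cobar_gen_lin cobar_gen_tens cobar_gen_hcomp, of x] that
        cobar_diff_gen by simp
    show "bilinear_map (cobar C) (cobar C) (cobar C) (mult (cobar C))"
      by (simp add: bilinear_map_def linear_map_def tmul_tens tmul_add_left tmul_add_right
          tmul_scale_left tmul_scale_right)
    show "has_bidegree (cobar C) (cobar C) (cobar C) 0 (mult (cobar C))"
      using desusp.tmul_hcomp by (simp add: has_bidegree_def)
    show "unity (cobar C) \<in> hcomp (cobar C) 0"
      using desusp.word_hcomp(1)[of "[]" "[]"] by simp
    show "diff (cobar C) (mult (cobar C) x y) = mult (cobar C) (diff (cobar C) x) y +
        scl (cobar C) (ksign i) (mult (cobar C) x (diff (cobar C) y))"
      if "x \<in> hcomp (cobar C) i" "y \<in> hcomp (cobar C) j" for x y i j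
      using cobar_diff_leibniz[of x i y] that tens[of y j] by simp
  qed (simp_all add: tmul_assoc tmul_unit_left tmul_unit_right)
qed

sublocale cobar: dg_algebra "cobar C"
  by (rule dg_algebra_cobar)

end


section \<open>The double bracket of the cobar construction\<close>

context cyclic_dg_coalgebra
begin

abbreviation N :: int
  where "N \<equiv> n + 2"

abbreviation wd :: "'v list \<Rightarrow> int"
  where "wd \<equiv> wdeg (desusp C)"

lemma pairing_left: "y \<in> carr C \<Longrightarrow> linear_on (scl C) (*) (carr C) (\<lambda>x. pairing C x y)"
  using pairing_bilinear linear_map_on[of C ground "\<lambda>x. pairing C x y"] by (simp add: bilinear_map_def ground_def)

lemma pairing_right: "x \<in> carr C \<Longrightarrow> linear_on (scl C) (*) (carr C) (\<lambda>y. pairing C x y)"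
  using pairing_bilinear linear_map_on[of C ground "pairing C x"] by (simp add: bilinear_map_def ground_def)

lemma pairing_0: "x \<in> carr C \<Longrightarrow> pairing C 0 x = 0" "x \<in> carr C \<Longrightarrow> pairing C x 0 = 0"
  using linear_on_zero[OF vector_space vector_space_ground pairing_left carr_subspace]
    linear_on_zero[OF vector_space vector_space_ground pairing_right carr_subspace] by auto

lemma pairing_nonzero:
  assumes "x \<in> hcomp C i" "y \<in> hcomp C j" "pairing C x y \<noteq> 0"
  shows "i + j + n = 0"
  using assms pairing_degree by (auto simp: has_bidegree_def ground_def split: if_splits)

text \<open>
  The summand of the bracket of \<open>(a, x, b)\<close> and \<open>(c, y, e)\<close> in which \<open>x\<close> is paired with \<open>y\<close>, and
  its coefficient.  All degrees are those of \<open>C[-1]\<close>, so \<open>x\<close> has degree \<open>deg (desusp C) x + 1\<close> in \<open>C\<close>.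
\<close>

definition bcoeff :: "'v list \<Rightarrow> 'v \<Rightarrow> 'v list \<Rightarrow> 'v list \<Rightarrow> 'v \<Rightarrow> 'k"
  where "bcoeff a x b c y =
    ksign (deg (desusp C) x + 1 + (wd a + deg (desusp C) x + wd b + N) * wd c
      + wd b * (wd a + deg (desusp C) x)) * pairing C x y"

definition bterm :: "'v list \<Rightarrow> 'v \<Rightarrow> 'v list \<Rightarrow> 'v list \<Rightarrow> 'v \<Rightarrow> 'v list \<Rightarrow> ('k, ('k, 'v) tensor) tensor"
  where "bterm a x b c y e =
    tscale (bcoeff a x b c y) (word (cobar C) [word C (c @ b), word C (a @ e)])"

text \<open>The bracket of two words.\<close>

definition bwords :: "'v list \<Rightarrow> 'v list \<Rightarrow> ('k, ('k, 'v) tensor) tensor"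
  where "bwords v w = split_sum (\<lambda>a x b. split_sum (\<lambda>c y e. bterm a x b c y e) w) v"

lemma homog_cobar: "homog (cobar C) = homog (tensor_algebra (desusp C))"
  by (simp add: homog_def)

lemma word_homog_cobar: "xs \<in> lists (homog C) \<Longrightarrow> word C xs \<in> homog (cobar C)"
  using desusp.word_homog_tensor_algebra[of xs] by (simp add: homog_cobar)

lemma word_hcomp_cobar: "xs \<in> nzl C \<Longrightarrow> word C xs \<in> hcomp (tensor_algebra (desusp C)) (wd xs)"
  using desusp.word_nzl_hcomp[of xs] by simp

lemma word_cobar_linear_on:
  assumes "q \<in> tens C"
  shows "linear_on tscale tscale (tens C) (\<lambda>z. word (cobar C) [z, q])"
    "linear_on tscale tscale (tens C) (\<lambda>z. word (cobar C) [q, z])"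
  using cobar.word2_linear_on[of q] assms by simp_all

lemma word_cobar_tens:
  "xs \<in> lists (homog C) \<Longrightarrow> ys \<in> lists (homog C) \<Longrightarrow> word (cobar C) [word C xs, word C ys] \<in> tens (cobar C)"
  by (simp add: word_tens word_homog_cobar)

lemma mh_word_append:
  assumes "b \<in> lists (homog C)"
  shows "multihomogeneous (desusp C) tscale (\<lambda>c. word C (c @ b))"
    "multihomogeneous (desusp C) tscale (\<lambda>c. word C (b @ c))"
  using desusp.mh_append[OF desusp.mh_word, of "[]" b] desusp.mh_append[OF desusp.mh_word, of b "[]"] assms
  by simp_all

lemma mh_pair:
  assumes "multihomogeneous (desusp C) tscale \<phi>" "\<And>c. c \<in> lists (homog C) \<Longrightarrow> \<phi> c \<in> tens C" "q \<in> tens C"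
  shows "multihomogeneous (desusp C) tscale (\<lambda>c. word (cobar C) [\<phi> c, q])"
    "multihomogeneous (desusp C) tscale (\<lambda>c. word (cobar C) [q, \<phi> c])"
  by (rule desusp.mh_lin[OF assms(1) _ word_cobar_linear_on(1)[OF assms(3)]], simp add: assms)
    (rule desusp.mh_lin[OF assms(1) _ word_cobar_linear_on(2)[OF assms(3)]], simp add: assms)

lemma linear_on_pairing:
  assumes "y \<in> homog C"
  shows "linear_on (scl (desusp C)) tscale (hcomp (desusp C) i) (\<lambda>x. tscale (k * pairing C x y) W)"
    "linear_on (scl (desusp C)) tscale (hcomp (desusp C) i) (\<lambda>x. tscale (k * pairing C y x) W)"
proof -
  have y: "y \<in> carr C" using assms by (rule homog_carr)
  show "linear_on (scl (desusp C)) tscale (hcomp (desusp C) i) (\<lambda>x. tscale (k * pairing C x y) W)"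
    by (rule linear_onI)
      (simp_all add: linear_on_add[OF pairing_left[OF y]] linear_on_scale[OF pairing_left[OF y]]
        hcomp_carr distrib_left TS.scale_left_distrib mult.left_commute)
  show "linear_on (scl (desusp C)) tscale (hcomp (desusp C) i) (\<lambda>x. tscale (k * pairing C y x) W)"
    by (rule linear_onI)
      (simp_all add: linear_on_add[OF pairing_right[OF y]] linear_on_scale[OF pairing_right[OF y]]
        hcomp_carr distrib_left TS.scale_left_distrib mult.left_commute)
qed

lemma bterm_mh:
  assumes h: "x \<in> homog C" "y \<in> homog C"
  shows "b \<in> lists (homog C) \<Longrightarrow> c \<in> lists (homog C) \<Longrightarrow> e \<in> lists (homog C) \<Longrightarrow>
      multihomogeneous (desusp C) tscale (\<lambda>a. bterm a x b c y e)"
    "a \<in> lists (homog C) \<Longrightarrow> c \<in> lists (homog C) \<Longrightarrow> e \<in> lists (homog C) \<Longrightarrow>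
      multihomogeneous (desusp C) tscale (\<lambda>b. bterm a x b c y e)"
    "a \<in> lists (homog C) \<Longrightarrow> b \<in> lists (homog C) \<Longrightarrow> e \<in> lists (homog C) \<Longrightarrow>
      multihomogeneous (desusp C) tscale (\<lambda>c. bterm a x b c y e)"
    "a \<in> lists (homog C) \<Longrightarrow> b \<in> lists (homog C) \<Longrightarrow> c \<in> lists (homog C) \<Longrightarrow>
      multihomogeneous (desusp C) tscale (\<lambda>e. bterm a x b c y e)"
proof -
  let ?d = "deg (desusp C) x"
  let ?t = "\<lambda>i j k a b c e. tscale (ksign (?d + 1 + (i + ?d + j + N) * k + j * (i + ?d)) * pairing C x y)
    (word (cobar C) [word C (c @ b), word C (a @ e)])"
  note S = mh_pair[OF mh_word_append(1)] mh_pair[OF mh_word_append(2)]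
  note R = desusp.mh_wdeg[OF vsT] and Q = desusp.mh_scale[OF vsT]
  show "multihomogeneous (desusp C) tscale (\<lambda>a. bterm a x b c y e)"
    if "b \<in> lists (homog C)" "c \<in> lists (homog C)" "e \<in> lists (homog C)"
    unfolding bterm_def bcoeff_def
    by (rule R[of "\<lambda>d a. ?t d (wd b) (wd c) a b c e"], rule Q, rule S(2))
      (use that in \<open>simp_all add: word_tens\<close>)
  show "multihomogeneous (desusp C) tscale (\<lambda>b. bterm a x b c y e)"
    if "a \<in> lists (homog C)" "c \<in> lists (homog C)" "e \<in> lists (homog C)"
    unfolding bterm_def bcoeff_def
    by (rule R[of "\<lambda>d b. ?t (wd a) d (wd c) a b c e"], rule Q, rule S(3))
      (use that in \<open>simp_all add: word_tens\<close>)
  show "multihomogeneous (desusp C) tscale (\<lambda>c. bterm a x b c y e)"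
    if "a \<in> lists (homog C)" "b \<in> lists (homog C)" "e \<in> lists (homog C)"
    unfolding bterm_def bcoeff_def
    by (rule R[of "\<lambda>d c. ?t (wd a) (wd b) d a b c e"], rule Q, rule S(1))
      (use that in \<open>simp_all add: word_tens\<close>)
  show "multihomogeneous (desusp C) tscale (\<lambda>e. bterm a x b c y e)"
    if "a \<in> lists (homog C)" "b \<in> lists (homog C)" "c \<in> lists (homog C)"
    unfolding bterm_def by (rule Q, rule S(4)) (use that in \<open>simp_all add: word_tens\<close>)
qed

lemma bterm_linear_on:
  "y \<in> homog C \<Longrightarrow> linear_on (scl (desusp C)) tscale (hcomp (desusp C) i) (\<lambda>x. bterm a x b c y e)"
  "x \<in> homog C \<Longrightarrow> linear_on (scl (desusp C)) tscale (hcomp (desusp C) i) (\<lambda>y. bterm a x b c y e)"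
  unfolding bterm_def bcoeff_def
  by (rule desusp.linear_on_deg[OF vsT, of i "\<lambda>d x. tscale (ksign (d + 1 + (wd a + d + wd b + N) * wd c
      + wd b * (wd a + d)) * pairing C x y) (word (cobar C) [word C (c @ b), word C (a @ e)])"],
      rule linear_on_pairing(1), assumption)
    (rule linear_on_pairing(2))

lemma bwords_mh:
  "v \<in> lists (homog C) \<Longrightarrow> multihomogeneous (desusp C) tscale (\<lambda>w. bwords v w)"
  "w \<in> lists (homog C) \<Longrightarrow> multihomogeneous (desusp C) tscale (\<lambda>v. bwords v w)"
proof -
  show "multihomogeneous (desusp C) tscale (\<lambda>w. bwords v w)" if "v \<in> lists (homog C)"
    unfolding bwords_def
    by (rule desusp.mh_split_sum_param[OF vsT], rule desusp.mh_split_sum[OF vsT])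
      (use that in \<open>simp_all add: bterm_mh bterm_linear_on[simplified]\<close>)
  have swap: "(\<lambda>v. bwords v w) = (\<lambda>v. split_sum (\<lambda>c y e. split_sum (\<lambda>a x b. bterm a x b c y e) v) w)"
    unfolding bwords_def by (rule ext, rule split_sum_swap)
  show "multihomogeneous (desusp C) tscale (\<lambda>v. bwords v w)" if "w \<in> lists (homog C)"
    unfolding swap
    by (rule desusp.mh_split_sum_param[OF vsT], rule desusp.mh_split_sum[OF vsT])
      (use that in \<open>simp_all add: bterm_mh bterm_linear_on[simplified]\<close>)
qed

text \<open>
  The coefficient of the definition of the bracket agrees with \<open>bcoeff\<close>: for \<open>x = 0\<close>, where the
  degrees in \<open>C\<close> and in \<open>C[-1]\<close> are unrelated, both vanish with the pairing.
\<close>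

lemma cobar_bracket_eq:
  "cobar_bracket n C p q = lift (desusp C) tscale (\<lambda>v. lift (desusp C) tscale (bwords v) q) p"
proof -
  have eq: "(\<Sum>i<length v. \<Sum>j<length w.
        tscale
          (ksign (deg C (v ! i)
             + (wdeg (desusp C) v + n + 2) * wdeg (desusp C) (take j w)
             + wdeg (desusp C) (drop (Suc i) v) * wdeg (desusp C) (take (Suc i) v))
           * pairing C (v ! i) (w ! j))
          (word (cobar C)
            [word (desusp C) (take j w @ drop (Suc i) v),
             word (desusp C) (take i v @ drop (Suc j) w)])) = bwords v w"
    if v: "v \<in> lists (homog C)" and w: "w \<in> lists (homog C)" for v w
    unfolding bwords_def split_sum_def
  proof (intro sum.cong refl)
    fix i j assume "i \<in> {..<length v}" and "j \<in> {..<length w}"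
    then have i: "i < length v" and j: "j < length w" by auto
    define x y where "x = v ! i" and "y = w ! j"
    have x: "x \<in> homog C" and y: "y \<in> homog C"
      using v w i j by (auto simp: x_def y_def)
    have "take (Suc i) v = take i v @ [x]"
      using i by (simp add: x_def take_Suc_conv_app_nth)
    then have t: "wd (take (Suc i) v) = wd (take i v) + deg (desusp C) x"
      by simp
    have "v = take i v @ x # drop (Suc i) v"
      using i by (simp add: x_def id_take_nth_drop)
    then have d: "wd v = wd (take i v) + (deg (desusp C) x + wd (drop (Suc i) v))"
      by (metis wdeg_simps(2,3))
    have "ksign (deg C x + (wd v + n + 2) * wd (take j w) + wd (drop (Suc i) v) * wd (take (Suc i) v))
        * pairing C x y = bcoeff (take i v) x (drop (Suc i) v) (take j w) y"
    proof (cases "x = 0")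
      case True
      then show ?thesis
        using y by (simp add: bcoeff_def pairing_0 homog_carr)
    next
      case False
      then show ?thesis
        unfolding bcoeff_def t d deg_desusp[OF x False] by (simp add: add.assoc)
    qed
    then show "tscale (ksign (deg C (v ! i) + (wdeg (desusp C) v + n + 2) * wdeg (desusp C) (take j w)
             + wdeg (desusp C) (drop (Suc i) v) * wdeg (desusp C) (take (Suc i) v)) * pairing C (v ! i) (w ! j))
          (word (cobar C) [word (desusp C) (take j w @ drop (Suc i) v),
             word (desusp C) (take i v @ drop (Suc j) w)]) =
        bterm (take i v) (v ! i) (drop (Suc i) v) (take j w) (w ! j) (drop (Suc j) w)"
      unfolding x_def y_def bterm_def word_desusp by (simp only:)
  qed
  show ?thesis
    unfolding cobar_bracket_def
    by (rule fun_cong[OF desusp.lift_cong], rule fun_cong[OF desusp.lift_cong], rule eq) simp_all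
qed

lemma bwords_lift_mh:
  "q \<in> tens C \<Longrightarrow> multihomogeneous (desusp C) tscale (\<lambda>v. lift (desusp C) tscale (bwords v) q)"
  by (rule desusp.mh_lift[OF vsT]) (simp_all only: homog_desusp tens_desusp bwords_mh)

abbreviation brk :: "('k, 'v) tensor \<Rightarrow> ('k, 'v) tensor \<Rightarrow> ('k, ('k, 'v) tensor) tensor"
  where "brk \<equiv> cobar_bracket n C"

lemma brk_right:
  assumes "p \<in> tens C"
  shows "linear_on tscale tscale (tens C) (\<lambda>q. brk p q)"
  unfolding cobar_bracket_eq
proof (rule desusp.lift_param[OF vsT vsT tens_subspace bwords_lift_mh])
  show "linear_on tscale tscale (tens C) (lift (desusp C) tscale (bwords v))"
    if "v \<in> lists (homog (desusp C))" for v
    using desusp.lift_linear_on[OF vsT bwords_mh(1)] that by (simp only: homog_desusp tens_desusp)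
qed (simp_all only: assms tens_desusp)

lemma brk_left:
  assumes "q \<in> tens C"
  shows "linear_on tscale tscale (tens C) (\<lambda>p. brk p q)"
  unfolding cobar_bracket_eq
  using desusp.lift_linear_on[OF vsT bwords_lift_mh[OF assms]] by (simp only: tens_desusp)

lemma brk_word:
  assumes "v \<in> lists (homog C)" "w \<in> lists (homog C)"
  shows "brk (word C v) (word C w) = bwords v w"
proof -
  have "brk (word C v) (word C w) = lift (desusp C) tscale (bwords v) (word C w)"
    unfolding cobar_bracket_eq
    using desusp.lift_word[OF vsT bwords_lift_mh[OF word_tens[OF assms(2)]], of v] assms(1)
    by (simp only: word_desusp homog_desusp)
  also have "\<dots> = bwords v w"
    using desusp.lift_word[OF vsT bwords_mh(1)[OF assms(1)], of w] assms(2)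
    by (simp only: word_desusp homog_desusp)
  finally show ?thesis .
qed

lemma hcomp_desusp_deg: "x \<in> homog C \<Longrightarrow> x \<noteq> 0 \<Longrightarrow> x \<in> hcomp C (deg (desusp C) x + 1)"
  using deg_desusp[of x] deg_eq by (force simp: homog_def)

lemma pairing_deg:
  assumes "x \<in> homog C" "x \<noteq> 0" "y \<in> homog C" "y \<noteq> 0" "pairing C x y \<noteq> 0"
  shows "N = - deg (desusp C) x - deg (desusp C) y"
  using pairing_nonzero[OF hcomp_desusp_deg[OF assms(1,2)] hcomp_desusp_deg[OF assms(3,4)] assms(5)] by simp

lemma pairing_sym_deg:
  assumes "x \<in> homog C" "x \<noteq> 0" "y \<in> homog C" "y \<noteq> 0"
  shows "pairing C y x = ksign ((deg (desusp C) x + 1) * (deg (desusp C) y + 1)) * pairing C x y"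
  using pairing_symmetric[OF hcomp_desusp_deg[OF assms(3,4)] hcomp_desusp_deg[OF assms(1,2)]] by (simp add: mult.commute)

lemma bterm_tens:
  assumes "a \<in> lists (homog C)" "b \<in> lists (homog C)" "c \<in> lists (homog C)" "e \<in> lists (homog C)"
  shows "bterm a x b c y e \<in> tens (cobar C)"
  unfolding bterm_def by (intro tens_scale word_cobar_tens) (use assms in simp_all)

lemma bwords_linear:
  assumes s: "vector_space s" and f: "linear_on tscale s (tens (cobar C)) f"
    and v: "v \<in> lists (homog C)" and w: "w \<in> lists (homog C)"
  shows "f (bwords v w) = split_sum (\<lambda>a x b. split_sum (\<lambda>c y e. f (bterm a x b c y e)) w) v"
proof -
  have t: "bterm a x b c y e \<in> tens (cobar C)" if "v = a @ x # b" "w = c @ y # e" for a x b c y e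
    using v w that by (intro bterm_tens) simp_all
  have "f (bwords v w) = split_sum (\<lambda>a x b. f (split_sum (\<lambda>c y e. bterm a x b c y e) w)) v"
    unfolding bwords_def
  proof (rule split_sum_linear[OF vsT s f tens_subspace])
    fix a x b assume "v = a @ x # b"
    then show "split_sum (\<lambda>c y e. bterm a x b c y e) w \<in> tens (cobar C)"
      by (intro split_sum_in[where P = "\<lambda>t. t \<in> tens (cobar C)"]) (simp_all add: t tens_add)
  qed
  also have "\<dots> = split_sum (\<lambda>a x b. split_sum (\<lambda>c y e. f (bterm a x b c y e)) w) v"
    by (rule split_sum_cong, rule split_sum_linear[OF vsT s f tens_subspace]) (rule t)
  finally show ?thesis .
qed

lemma bwords_in:
  assumes W: "TS.subspace W"
    and "\<And>a x b c y e. v = a @ x # b \<Longrightarrow> w = c @ y # e \<Longrightarrow> bterm a x b c y e \<in> W"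
  shows "bwords v w \<in> W"
  unfolding bwords_def
proof (rule split_sum_in[where P = "\<lambda>t. t \<in> W"])
  show "split_sum (\<lambda>c y e. bterm a x b c y e) w \<in> W" if "v = a @ x # b" for a x b
    by (rule split_sum_in[where P = "\<lambda>t. t \<in> W"]) (use that assms in \<open>simp_all add: TS.subspace_0 TS.subspace_add\<close>)
qed (simp_all add: W TS.subspace_0 TS.subspace_add)

lemma brk_carr:
  assumes p: "p \<in> tens C" and q: "q \<in> tens C"
  shows "brk p q \<in> carr (tensor_power 2 (cobar C))"
proof (rule tens_inI[OF vsT brk_left[OF q] _ _ p])
  show sub: "TS.subspace (carr (tensor_power 2 (cobar C)))"
    by (simp add: carr_def)
  fix v assume v: "v \<in> lists (homog C)"
  show "brk (word C v) q \<in> carr (tensor_power 2 (cobar C))"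
  proof (rule tens_inI[OF vsT brk_right[OF word_tens[OF v]] sub _ q])
    fix w assume w: "w \<in> lists (homog C)"
    have "bwords v w \<in> carr (tensor_power 2 (cobar C))"
      by (rule bwords_in[OF sub])
        (use v w in \<open>auto simp: bterm_def intro!: TS.subspace_scale[OF sub] cobar.word2_carr word_homog_cobar\<close>)
    then show "brk (word C v) (word C w) \<in> carr (tensor_power 2 (cobar C))"
      by (simp only: brk_word v w)
  qed
qed

lemma brk_tens: "p \<in> tens C \<Longrightarrow> q \<in> tens C \<Longrightarrow> brk p q \<in> tens (cobar C)"
  using brk_carr cobar.carr_tensor_power by blast

text \<open>The two paired letters drop out; together they have degree \<open>- N\<close> in \<open>C[-1]\<close>.\<close>

lemma bterm_hcomp:
  assumes nz: "a \<in> nzl C" "b \<in> nzl C" "c \<in> nzl C" "e \<in> nzl C"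
    and x: "x \<in> homog C" "x \<noteq> 0" and y: "y \<in> homog C" "y \<noteq> 0"
  shows "bterm a x b c y e \<in> hcomp (tensor_power 2 (cobar C)) (wd (a @ x # b) + wd (c @ y # e) + N)"
proof (cases "pairing C x y = 0")
  case True
  then have "bterm a x b c y e = 0"
    by (simp add: bterm_def bcoeff_def)
  then show ?thesis
    using TS.subspace_0[OF cobar.tensor_power_subspace] by simp
next
  case False
  from pairing_deg[OF x y False] have N: "wd (a @ x # b) + wd (c @ y # e) + N = wd (c @ b) + wd (a @ e)"
    by simp
  have "word (cobar C) [word C (c @ b), word C (a @ e)] \<in>
      hcomp (tensor_power 2 (cobar C)) (wd (c @ b) + wd (a @ e))"
    using cobar.word_hcomp(2)[of "[word C (c @ b), word C (a @ e)]" "[wd (c @ b), wd (a @ e)]"]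
      word_hcomp_cobar[of "c @ b"] word_hcomp_cobar[of "a @ e"] nz by (simp add: numeral_2_eq_2)
  then show ?thesis
    unfolding bterm_def N by (rule TS.subspace_scale[OF cobar.tensor_power_subspace])
qed

lemma brk_hcomp:
  assumes p: "p \<in> hcomp (tensor_algebra (desusp C)) i" and q: "q \<in> hcomp (tensor_algebra (desusp C)) j"
  shows "brk p q \<in> hcomp (tensor_power 2 (cobar C)) (i + j + N)"
proof (rule desusp.hcomp_inI[OF vsT _ cobar.tensor_power_subspace _ p])
  have "q \<in> tens C"
    using desusp.hcomp_tensor_algebra_tens[of j] q by auto
  then show "linear_on tscale tscale (tens (desusp C)) (\<lambda>p. brk p q)"
    using brk_left by simp
  fix v assume v: "v \<in> nzl (desusp C)" "wd v = i"
  show "brk (word (desusp C) v) q \<in> hcomp (tensor_power 2 (cobar C)) (i + j + N)"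
  proof (rule desusp.hcomp_inI[OF vsT _ cobar.tensor_power_subspace _ q])
    show "linear_on tscale tscale (tens (desusp C)) (\<lambda>q. brk (word (desusp C) v) q)"
      using brk_right v(1) by (simp add: word_tens nzl_homog)
    fix w assume w: "w \<in> nzl (desusp C)" "wd w = j"
    have "bwords v w \<in> hcomp (tensor_power 2 (cobar C)) (i + j + N)"
    proof (rule bwords_in[OF cobar.tensor_power_subspace])
      fix a x b c y e assume "v = a @ x # b" "w = c @ y # e"
      then show "bterm a x b c y e \<in> hcomp (tensor_power 2 (cobar C)) (i + j + N)"
        using bterm_hcomp[of a b c e x y] v w by simp
    qed
    then show "brk (word (desusp C) v) (word (desusp C) w) \<in> hcomp (tensor_power 2 (cobar C)) (i + j + N)"
      using v w by (simp add: brk_word nzl_homog)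
  qed
qed

text \<open>
  Appending \<open>u\<close> to \<open>w\<close> only extends the right end of the terms in which a letter of \<open>w\<close> is marked, and
  puts \<open>w\<close> in front of those in which a letter of \<open>u\<close> is marked, past \<open>v\<close> and the bracket.
\<close>

lemma bwords_append:
  assumes v: "v \<in> lists (homog C)" and w: "w \<in> lists (homog C)" and u: "u \<in> lists (homog C)"
  shows "bwords v (w @ u) = outer_right (cobar C) (bwords v w) (word C u) +
    tscale (ksign ((wd v + N) * wd w)) (outer_left (cobar C) (word C w) (bwords v u))"
proof -
  have wc: "word C u \<in> carr (cobar C)" "word C w \<in> carr (cobar C)"
    using u w by (simp_all add: word_tens)
  have 1: "split_sum (\<lambda>a x b. split_sum (\<lambda>c y e. bterm a x b c y (e @ u)) w) v =
      outer_right (cobar C) (bwords v w) (word C u)"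
    unfolding bwords_linear[OF vsT cobar.outer_right_linear_on[OF wc(1)] v w]
  proof (intro split_sum_cong)
    fix a x b c y e assume *: "v = a @ x # b" "w = c @ y # e"
    have t: "word (cobar C) [word C (c @ b), word C (a @ e)] \<in> tens (cobar C)"
      using * v w by (intro word_cobar_tens) simp_all
    have "outer_right (cobar C) (word (cobar C) [word C (c @ b), word C (a @ e)]) (word C u) =
        word (cobar C) [word C (c @ b), word C (a @ e @ u)]"
      using * v w u by (subst cobar.outer_right_word[OF wc(1)]) (simp_all add: word_homog_cobar)
    then show "bterm a x b c y (e @ u) = outer_right (cobar C) (bterm a x b c y e) (word C u)"
      unfolding bterm_def linear_on_scale[OF cobar.outer_right_linear_on[OF wc(1)] t] by simp
  qed
  have 2: "split_sum (\<lambda>a x b. split_sum (\<lambda>c y e. bterm a x b (w @ c) y e) u) v =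
      tscale (ksign ((wd v + N) * wd w)) (outer_left (cobar C) (word C w) (bwords v u))"
    unfolding bwords_linear[OF vsT linear_on_scaled[OF vsT cobar.outer_left_linear_on[OF wc(2)]] v u]
  proof (intro split_sum_cong)
    fix a x b c y e assume *: "v = a @ x # b" "u = c @ y # e"
    have t: "word (cobar C) [word C (c @ b), word C (a @ e)] \<in> tens (cobar C)"
      using * v u by (intro word_cobar_tens) simp_all
    have o: "outer_left (cobar C) (word C w) (word (cobar C) [word C (c @ b), word C (a @ e)]) =
        word (cobar C) [word C (w @ c @ b), word C (a @ e)]"
      using * v w u by (subst cobar.outer_left_word[OF wc(2)]) (simp_all add: word_homog_cobar)
    have "bcoeff a x b (w @ c) y = ksign ((wd v + N) * wd w) * bcoeff a x b c y"
      by (simp add: bcoeff_def * ksign_add[symmetric] mult.assoc[symmetric]) (simp add: algebra_simps)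
    then show "bterm a x b (w @ c) y e =
        tscale (ksign ((wd v + N) * wd w)) (outer_left (cobar C) (word C w) (bterm a x b c y e))"
      unfolding bterm_def linear_on_scale[OF cobar.outer_left_linear_on[OF wc(2)] t] o by simp
  qed
  have "bwords v (w @ u) = split_sum (\<lambda>a x b. split_sum (\<lambda>c y e. bterm a x b c y (e @ u)) w) v
      + split_sum (\<lambda>a x b. split_sum (\<lambda>c y e. bterm a x b (w @ c) y e) u) v"
    unfolding bwords_def split_sum_append by (rule split_sum_add)
  then show ?thesis
    by (simp only: 1 2)
qed

text \<open>
  The signs for skew symmetry.  Here \<open>a\<close>, \<open>x\<close>, \<open>b\<close> and \<open>c\<close>, \<open>y\<close>, \<open>e\<close> stand for the degrees of the
  parts of the two words; the assumption holds whenever the pairing of the marked letters does not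
  vanish.
\<close>

lemma skew_sign:
  fixes a b c e x y N :: int
  assumes "N = - x - y"
  shows "(ksign (x + 1 + (a + x + b + N) * c + b * (a + x)) :: 'k) =
    - (ksign ((a + x + b + N) * (c + y + e + N)) * ksign ((a + e) * (c + b)) *
      ksign (y + 1 + (c + y + e + N) * a + e * (c + y)) * ksign ((x + 1) * (y + 1)))"
proof -
  have "odd (x + 1 + (a + x + b + N) * c + b * (a + x) +
    ((a + x + b + N) * (c + y + e + N) + (a + e) * (c + b) +
     (y + 1 + (c + y + e + N) * a + e * (c + y)) + (x + 1) * (y + 1)))"
    unfolding assms by (simp add: algebra_simps)
  then show ?thesis
    unfolding ksign_add[symmetric] by (rule ksign_cong_minus)
qed

lemma bterm_skew:
  assumes nz: "a \<in> nzl C" "b \<in> nzl C" "c \<in> nzl C" "e \<in> nzl C"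
    and x: "x \<in> homog C" "x \<noteq> 0" and y: "y \<in> homog C" "y \<noteq> 0"
  shows "bterm a x b c y e = - tscale (ksign ((wd (a @ x # b) + N) * (wd (c @ y # e) + N)))
    (flip (cobar C) (bterm c y e a x b))"
proof (cases "pairing C x y = 0")
  case True
  then have z: "bterm a x b c y e = 0" "bterm c y e a x b = 0"
    using pairing_sym_deg[OF x y] by (simp_all add: bterm_def bcoeff_def)
  have "flip (cobar C) 0 = 0"
    by (rule linear_on_zero[OF vsT vsT cobar.flip_linear_on tens_subspace])
  then show ?thesis
    by (simp only: z TS.scale_zero_right minus_zero)
next
  case False
  let ?x = "deg (desusp C) x" and ?y = "deg (desusp C) y"
  have t: "word (cobar C) [word C (a @ e), word C (c @ b)] \<in> tens (cobar C)"
    using nz by (intro word_cobar_tens) (simp_all add: nzl_homog)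
  have f: "flip (cobar C) (word (cobar C) [word C (a @ e), word C (c @ b)]) =
      tscale (ksign ((wd a + wd e) * (wd c + wd b))) (word (cobar C) [word C (c @ b), word C (a @ e)])"
    using cobar.flip_word[of "word C (a @ e)" "wd (a @ e)" "word C (c @ b)" "wd (c @ b)"]
      word_hcomp_cobar[of "a @ e"] word_hcomp_cobar[of "c @ b"] nz by simp
  have s: "bcoeff a x b c y = - (ksign ((wd (a @ x # b) + N) * (wd (c @ y # e) + N)) *
      (bcoeff c y e a x * ksign ((wd a + wd e) * (wd c + wd b))))"
    using skew_sign[OF pairing_deg[OF x y False], of "wd a" "wd b" "wd c" "wd e"]
    unfolding bcoeff_def pairing_sym_deg[OF x y] wdeg_simps
    by (simp only: mult_minus_left add.assoc mult.assoc) (simp only: ac_simps)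
  show ?thesis
    unfolding bterm_def s linear_on_scale[OF cobar.flip_linear_on t] f TS.scale_scale
    by (simp only: TS.scale_minus_left mult.assoc)
qed

lemma bwords_skew:
  assumes v: "v \<in> nzl C" and w: "w \<in> nzl C"
  shows "bwords v w = - tscale (ksign ((wd v + N) * (wd w + N))) (flip (cobar C) (bwords w v))"
proof -
  let ?s = "ksign ((wd v + N) * (wd w + N))"
  have "- tscale ?s (flip (cobar C) (bwords w v)) =
      split_sum (\<lambda>c y e. split_sum (\<lambda>a x b. - tscale ?s (flip (cobar C) (bterm c y e a x b))) v) w"
    by (rule bwords_linear[OF vsT linear_on_uminus[OF vsT linear_on_scaled[OF vsT cobar.flip_linear_on]]])
      (use v w in \<open>simp_all add: nzl_homog\<close>)
  also have "\<dots> = split_sum (\<lambda>c y e. split_sum (\<lambda>a x b. bterm a x b c y e) v) w"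
  proof (intro split_sum_cong)
    fix c y e a x b assume "w = c @ y # e" "v = a @ x # b"
    then show "- tscale ?s (flip (cobar C) (bterm c y e a x b)) = bterm a x b c y e"
      using bterm_skew[of a b c e x y] v w by simp
  qed
  also have "\<dots> = bwords v w"
    unfolding bwords_def by (rule split_sum_swap)
  finally show ?thesis ..
qed

lemma brk_skew:
  assumes p: "p \<in> hcomp (tensor_algebra (desusp C)) i" and q: "q \<in> hcomp (tensor_algebra (desusp C)) j"
  shows "brk p q = - tscale (ksign ((i + N) * (j + N))) (flip (cobar C) (brk q p))"
proof (rule words_eqI2[OF brk_left _ brk_right _ _ p q])
  note F = cobar.flip_linear_on
  show "linear_on tscale tscale (tens C) (\<lambda>p. - tscale (ksign ((i + N) * (j + N))) (flip (cobar C) (brk q p)))"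
    if "q \<in> tens C" for q
    by (intro linear_on_uminus[OF vsT] linear_on_scaled[OF vsT]
        linear_on_compose[OF brk_right[OF that] brk_tens[OF that] F])
  show "linear_on tscale tscale (tens C) (\<lambda>q. - tscale (ksign ((i + N) * (j + N))) (flip (cobar C) (brk q p)))"
    if "p \<in> tens C" for p
    by (intro linear_on_uminus[OF vsT] linear_on_scaled[OF vsT]
        linear_on_compose[OF brk_left[OF that] brk_tens[OF _ that] F])
  fix v w assume "v \<in> nzl C" "w \<in> nzl C" "wd v = i" "wd w = j"
  then show "brk (word C v) (word C w) =
      - tscale (ksign ((i + N) * (j + N))) (flip (cobar C) (brk (word C w) (word C v)))"
    using bwords_skew[of v w] by (simp only: brk_word nzl_homog)
qed

lemma brk_derivation:
  assumes p: "p \<in> hcomp (tensor_algebra (desusp C)) i" and q: "q \<in> hcomp (tensor_algebra (desusp C)) j"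
    and r: "r \<in> hcomp (tensor_algebra (desusp C)) l"
  shows "brk p (tmul C q r) = outer_right (cobar C) (brk p q) r +
    tscale (ksign ((i + N) * j)) (outer_left (cobar C) q (brk p r))"
proof (rule words_eqI3[OF _ _ _ _ _ _ _ p q r])
  note R = cobar.outer_right_linear_on[unfolded carr_cobar cobar_simps]
    and L = cobar.outer_left_linear_on[unfolded carr_cobar cobar_simps]
    and Rp = cobar.outer_right_param[unfolded carr_cobar cobar_simps]
    and Lp = cobar.outer_left_param[unfolded carr_cobar cobar_simps]
  let ?G = "\<lambda>p q r. outer_right (cobar C) (brk p q) r + tscale (ksign ((i + N) * j)) (outer_left (cobar C) q (brk p r))"
  show "linear_on tscale tscale (tens C) (\<lambda>p. brk p (tmul C q r))" if "q \<in> tens C" "r \<in> tens C" for q r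
    by (rule brk_left[OF tmul_tens[OF that]])
  show "linear_on tscale tscale (tens C) (\<lambda>q. brk p (tmul C q r))" if "p \<in> tens C" "r \<in> tens C" for p r
    by (rule linear_on_compose[OF tmul_left[OF that(2)] tmul_tens[OF _ that(2)] brk_right[OF that(1)]])
  show "linear_on tscale tscale (tens C) (\<lambda>r. brk p (tmul C q r))" if "p \<in> tens C" "q \<in> tens C" for p q
    by (rule linear_on_compose[OF tmul_right[OF that(2)] tmul_tens[OF that(2)] brk_right[OF that(1)]])
  show "linear_on tscale tscale (tens C) (\<lambda>p. ?G p q r)" if "q \<in> tens C" "r \<in> tens C" for q r
    by (intro linear_on_plus[OF vsT] linear_on_scaled[OF vsT]
        linear_on_compose[OF brk_left[OF that(1)] brk_tens[OF _ that(1)] R[OF that(2)]]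
        linear_on_compose[OF brk_left[OF that(2)] brk_tens[OF _ that(2)] L[OF that(1)]])
  show "linear_on tscale tscale (tens C) (\<lambda>q. ?G p q r)" if "p \<in> tens C" "r \<in> tens C" for p r
    by (intro linear_on_plus[OF vsT] linear_on_scaled[OF vsT] Lp brk_tens[OF that]
        linear_on_compose[OF brk_right[OF that(1)] brk_tens[OF that(1)] R[OF that(2)]])
  show "linear_on tscale tscale (tens C) (\<lambda>r. ?G p q r)" if "p \<in> tens C" "q \<in> tens C" for p q
    by (intro linear_on_plus[OF vsT] linear_on_scaled[OF vsT] Rp brk_tens[OF that]
        linear_on_compose[OF brk_right[OF that(1)] brk_tens[OF that(1)] L[OF that(2)]])
  fix v w u assume nz: "v \<in> nzl C" "w \<in> nzl C" "u \<in> nzl C" and d: "wd v = i" "wd w = j"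
  then have h: "v \<in> lists (homog C)" "w \<in> lists (homog C)" "u \<in> lists (homog C)"
    by (simp_all add: nzl_homog)
  then show "brk (word C v) (tmul C (word C w) (word C u)) = ?G (word C v) (word C w) (word C u)"
    using bwords_append[of v w u] d by (simp only: tmul_word brk_word append_in_lists_conv simp_thms)
qed

lemma graded_double_bracket_cobar: "graded_double_bracket (cobar C) N brk"
proof (intro graded_double_bracket.intro graded_double_bracket_axioms.intro)
  show "dg_algebra (cobar C)"
    by (rule dg_algebra_cobar)
  show "bilinear_map (cobar C) (cobar C) (tensor_power 2 (cobar C)) brk"
    using brk_left brk_right
    by (simp add: bilinear_map_def linear_map_def linear_on_def brk_carr)
  show "has_bidegree (cobar C) (cobar C) (tensor_power 2 (cobar C)) N brk"
    using brk_hcomp by (simp add: has_bidegree_def)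
qed (simp_all only: cobar_simps brk_derivation, rule brk_skew)

sublocale cobar: graded_double_bracket "cobar C" "n + 2" "cobar_bracket n C"
  by (rule graded_double_bracket_cobar)

end


section \<open>Compatibility with the differential\<close>

context cyclic_dg_coalgebra
begin

text \<open>The two sides of the cyclicity condition as maps on \<open>C \<otimes> C\<close>; \<open>j\<close> is the degree of \<open>w\<close>.\<close>

definition contract_left :: "int \<Rightarrow> 'v \<Rightarrow> ('k, 'v) tensor \<Rightarrow> 'v"
  where "contract_left j w = lift2 C (scl C)
    (\<lambda>x y. scl C (ksign (deg C y * (n + j)) * pairing C x w) y)"

definition contract_right :: "'v \<Rightarrow> ('k, 'v) tensor \<Rightarrow> 'v"
  where "contract_right v = lift2 C (scl C)
    (\<lambda>x y. scl C (ksign (deg C x * deg C y) * pairing C v y) x)"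

lemma contract_cyclic:
  "v \<in> hcomp C i \<Longrightarrow> w \<in> hcomp C j \<Longrightarrow> contract_left j w (comult C v) = contract_right v (comult C w)"
  unfolding contract_left_def contract_right_def by (rule cyclic)

lemma scaled_linear:
  assumes "linear_on (scl C) (*) (hcomp C i) f"
  shows "linear_on (scl C) (scl C) (hcomp C i) (\<lambda>x. scl C (k * f x) y)"
  by (rule linear_onI)
    (simp_all add: linear_on_add[OF assms] linear_on_scale[OF assms] distrib_left
      VS.scale_left_distrib mult.left_commute)

lemma contract_lin:
  assumes w: "w \<in> homog C"
  shows "x \<in> homog C \<Longrightarrow> linear_on (scl C) (scl C) (hcomp C i)
      (\<lambda>y. scl C (ksign (deg C y * (n + j)) * pairing C x w) y)"
    "y \<in> homog C \<Longrightarrow> linear_on (scl C) (scl C) (hcomp C i)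
      (\<lambda>x. scl C (ksign (deg C y * (n + j)) * pairing C x w) y)"
    "x \<in> homog C \<Longrightarrow> linear_on (scl C) (scl C) (hcomp C i)
      (\<lambda>y. scl C (ksign (deg C x * deg C y) * pairing C w y) x)"
    "y \<in> homog C \<Longrightarrow> linear_on (scl C) (scl C) (hcomp C i)
      (\<lambda>x. scl C (ksign (deg C x * deg C y) * pairing C w y) x)"
proof -
  have wc: "w \<in> carr C" using w by (rule homog_carr)
  note pl = linear_on_subset[OF pairing_left[OF wc] hcomp_subset_carr]
    and pr = linear_on_subset[OF pairing_right[OF wc] hcomp_subset_carr]
  show "linear_on (scl C) (scl C) (hcomp C i) (\<lambda>y. scl C (ksign (deg C y * (n + j)) * pairing C x w) y)"
    by (rule linear_on_deg[OF vector_space, of i "\<lambda>d y. scl C (ksign (d * (n + j)) * pairing C x w) y"])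
      (rule linear_on_scaled[OF vector_space linear_on_id])
  show "linear_on (scl C) (scl C) (hcomp C i) (\<lambda>x. scl C (ksign (deg C y * (n + j)) * pairing C x w) y)"
    by (rule scaled_linear[OF pl])
  show "linear_on (scl C) (scl C) (hcomp C i) (\<lambda>y. scl C (ksign (deg C x * deg C y) * pairing C w y) x)"
    by (rule linear_on_deg[OF vector_space, of i "\<lambda>d y. scl C (ksign (deg C x * d) * pairing C w y) x"])
      (rule scaled_linear[OF pr])
  show "linear_on (scl C) (scl C) (hcomp C i) (\<lambda>x. scl C (ksign (deg C x * deg C y) * pairing C w y) x)"
    by (rule linear_on_deg[OF vector_space, of i "\<lambda>d x. scl C (ksign (d * deg C y) * pairing C w y) x"])
      (rule linear_on_scaled[OF vector_space linear_on_id])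
qed

lemma contract_linear_on:
  assumes "w \<in> homog C"
  shows "linear_on tscale (scl C) (tens C) (contract_left j w)"
    "linear_on tscale (scl C) (tens C) (contract_right w)"
  unfolding contract_left_def contract_right_def
  by (rule lift2_linear_on[OF vector_space contract_lin(1,2)[OF assms]], assumption+)
    (rule lift2_linear_on[OF vector_space contract_lin(3,4)[OF assms]], assumption+)

lemma contract_word:
  assumes w: "w \<in> homog C" and x: "x \<in> hcomp C p" and y: "y \<in> hcomp C q"
  shows "contract_left j w (word C [x, y]) = scl C (ksign (q * (n + j)) * pairing C x w) y"
    "contract_right w (word C [x, y]) = scl C (ksign (p * q) * pairing C w y) x"
proof -
  have h: "x \<in> homog C" "y \<in> homog C"
    using x y by (auto simp: hcomp_homog)
  have 1: "contract_left j w (word C [x, y]) = scl C (ksign (deg C y * (n + j)) * pairing C x w) y"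
    unfolding contract_left_def by (rule lift2_word[OF vector_space contract_lin(1,2)[OF w] h])
  have 2: "contract_right w (word C [x, y]) = scl C (ksign (deg C x * deg C y) * pairing C w y) x"
    unfolding contract_right_def by (rule lift2_word[OF vector_space contract_lin(3,4)[OF w] h])
  show "contract_left j w (word C [x, y]) = scl C (ksign (q * (n + j)) * pairing C x w) y"
    unfolding 1 using deg_eq[OF y] by (cases "y = 0") simp_all
  show "contract_right w (word C [x, y]) = scl C (ksign (p * q) * pairing C w y) x"
    unfolding 2 using deg_eq[OF x] deg_eq[OF y] w
    by (cases "x = 0 \<or> y = 0") (auto simp: pairing_0 homog_carr)
qed

lemma contract_carr:
  assumes "w \<in> homog C" "t \<in> tens C"
  shows "contract_left j w t \<in> carr C" "contract_right w t \<in> carr C"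
proof -
  have sc: "scl C k x \<in> carr C" if "x \<in> homog C" for k x
    using that by (simp add: homog_carr VS.subspace_scale[OF carr_subspace])
  show "contract_left j w t \<in> carr C"
    unfolding contract_left_def lift2_def
  proof (rule lift_in[OF vector_space mh2[OF vector_space contract_lin(1,2)[OF assms(1)]] carr_subspace _ assms(2)])
    fix xs assume "xs \<in> lists (homog C)"
    then show "(case xs of [x, y] \<Rightarrow> scl C (ksign (deg C y * (n + j)) * pairing C x w) y | _ \<Rightarrow> 0) \<in> carr C"
      by (auto split: list.split intro!: sc)
  qed
  show "contract_right w t \<in> carr C"
    unfolding contract_right_def lift2_def
  proof (rule lift_in[OF vector_space mh2[OF vector_space contract_lin(3,4)[OF assms(1)]] carr_subspace _ assms(2)])
    fix xs assume "xs \<in> lists (homog C)"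
    then show "(case xs of [x, y] \<Rightarrow> scl C (ksign (deg C x * deg C y) * pairing C w y) x | _ \<Rightarrow> 0) \<in> carr C"
      by (auto split: list.split intro!: sc)
  qed
qed

text \<open>The embeddings \<open>z \<mapsto> (z) \<otimes> 1\<close> and \<open>z \<mapsto> 1 \<otimes> (z)\<close> of \<open>C\<close>.\<close>

definition left_emb :: "'v \<Rightarrow> ('k, ('k, 'v) tensor) tensor"
  where "left_emb z = word (cobar C) [word C [z], word C []]"

definition right_emb :: "'v \<Rightarrow> ('k, ('k, 'v) tensor) tensor"
  where "right_emb z = word (cobar C) [word C [], word C [z]]"

lemma word1_tens: "z \<in> carr C \<Longrightarrow> word C [z] \<in> tens C"
  using linear_on_span_in[OF vector_space vsT _ tens_subspace, of "homog C" "\<lambda>z. word C [z]" C z]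
    word1_linear_on by (simp add: carr_def word_tens)

lemma emb_linear_on:
  "linear_on (scl C) tscale (carr C) left_emb" "linear_on (scl C) tscale (carr C) right_emb"
proof -
  have u: "word C [] \<in> tens C" by (simp add: word_tens)
  show "linear_on (scl C) tscale (carr C) left_emb"
    unfolding left_emb_def by (rule linear_on_compose[OF word1_linear_on word1_tens word_cobar_linear_on(1)[OF u]])
  show "linear_on (scl C) tscale (carr C) right_emb"
    unfolding right_emb_def by (rule linear_on_compose[OF word1_linear_on word1_tens word_cobar_linear_on(2)[OF u]])
qed

lemma emb_scale:
  "z \<in> carr C \<Longrightarrow> left_emb (scl C c z) = tscale c (left_emb z)"
  "z \<in> carr C \<Longrightarrow> right_emb (scl C c z) = tscale c (right_emb z)"
  using linear_on_scale[OF emb_linear_on(1)] linear_on_scale[OF emb_linear_on(2)] by auto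

lemma deg_desusp_eq: "x \<in> hcomp C i \<Longrightarrow> x \<noteq> 0 \<Longrightarrow> deg (desusp C) x = i - 1"
  using desusp.deg_eq[of x "i - 1"] by simp

lemma bwords_gen:
  assumes x: "x \<in> hcomp C i" and y: "y \<in> homog C"
  shows "bwords [x] [y] = tscale (ksign i * pairing C x y) (word (cobar C) [word C [], word C []])"
proof (cases "x = 0")
  case True
  then show ?thesis
    using y by (simp add: bwords_def bterm_def bcoeff_def pairing_0 homog_carr)
next
  case False
  then show ?thesis
    using deg_desusp_eq[OF x False] by (simp add: bwords_def bterm_def bcoeff_def)
qed

text \<open>
  Brackets of a generator with the quadratic part of a differential, from either side; the pairing
  vanishes unless the degrees of its arguments add up to \<open>- n\<close>, which decides the signs.
\<close>

lemma brk_quad_left: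
  assumes y: "y \<in> hcomp C j" and t: "t \<in> hcomp (tensor_power 2 C) i"
  shows "brk (quad t) (word C [y]) =
    tscale (- ksign i) (left_emb (contract_left j y t)) +
    tscale (ksign (i + (j + n) * (i + n))) (right_emb (contract_right y t))"
proof (rule hcomp_tensor_power_2_eqI[OF vsT _ _ _ t])
  have yh: "y \<in> homog C" using y by (rule hcomp_homog)
  have wy: "word C [y] \<in> tens C" using yh by (simp add: word_tens)
  show "linear_on tscale tscale (tens C) (\<lambda>t. brk (quad t) (word C [y]))"
    by (rule linear_on_compose[OF quad_linear_on quad_tens brk_left[OF wy]])
  show "linear_on tscale tscale (tens C) (\<lambda>t. tscale (- ksign i) (left_emb (contract_left j y t)) +
      tscale (ksign (i + (j + n) * (i + n))) (right_emb (contract_right y t)))"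
    by (intro linear_on_plus[OF vsT] linear_on_scaled[OF vsT]
        linear_on_compose[OF contract_linear_on(1)[OF yh] contract_carr(1)[OF yh] emb_linear_on(1)]
        linear_on_compose[OF contract_linear_on(2)[OF yh] contract_carr(2)[OF yh] emb_linear_on(2)])
  fix x z p q
  assume x: "x \<in> hcomp C p" and z: "z \<in> hcomp C q" and nz: "x \<noteq> 0" "z \<noteq> 0" and i: "i = p + q"
  have h: "x \<in> homog C" "z \<in> homog C"
    using x z by (auto simp: hcomp_homog)
  have c: "x \<in> carr C" "z \<in> carr C"
    using h by (simp_all add: homog_carr)
  have e: "left_emb (contract_left j y (word C [x, z])) = tscale (ksign (q * (n + j)) * pairing C x y) (left_emb z)"
    "right_emb (contract_right y (word C [x, z])) = tscale (ksign (p * q) * pairing C y z) (right_emb x)"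
    by (simp_all only: contract_word[OF yh x z] emb_scale c)
  have b: "brk (quad (word C [x, z])) (word C [y]) = tscale (ksign p) (bwords [x, z] [y])"
    using h yh by (simp add: quad_word[OF x h(2)] linear_on_scale[OF brk_left[OF wy]] word_tens brk_word)
  show "brk (quad (word C [x, z])) (word C [y]) =
      tscale (- ksign i) (left_emb (contract_left j y (word C [x, z]))) +
      tscale (ksign (i + (j + n) * (i + n))) (right_emb (contract_right y (word C [x, z])))"
  proof -
    from nz have d: "deg (desusp C) x = p - 1" "deg (desusp C) z = q - 1"
      using deg_desusp_eq x z by auto
    have 1: "ksign p * (ksign (p + (q - 1) * (p - 1)) * pairing C x y) =
        - ksign i * (ksign (q * (n + j)) * pairing C x y)"
    proof (cases "pairing C x y = 0")
      case False
      then have n: "n = - p - j"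
        using pairing_nonzero[OF x y] by simp
      have "ksign (p + (p + (q - 1) * (p - 1))) = (- ksign (i + q * (n + j)) :: 'k)"
        by (rule ksign_cong_minus) (simp add: n i algebra_simps)
      then show ?thesis
        by (simp add: ksign_add mult.assoc[symmetric])
    qed simp
    have 2: "ksign p * (ksign q * pairing C z y) =
        ksign (i + (j + n) * (i + n)) * (ksign (p * q) * pairing C y z)"
    proof (cases "pairing C z y = 0")
      case True
      then show ?thesis
        using pairing_symmetric[OF y z] by simp
    next
      case False
      then have n: "n = - q - j"
        using pairing_nonzero[OF z y] by simp
      have "ksign (p + q) = (ksign (i + (j + n) * (i + n) + p * q + j * q) :: 'k)"
        by (rule ksign_cong) (simp add: n i algebra_simps)
      then show ?thesis
        using pairing_symmetric[OF y z] by (simp add: ksign_add mult.assoc[symmetric])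
    qed
    have "bwords [x, z] [y] = tscale (ksign (p + (q - 1) * (p - 1)) * pairing C x y) (left_emb z) +
        tscale (ksign q * pairing C z y) (right_emb x)"
      by (simp add: bwords_def split_sum_Cons bterm_def bcoeff_def d left_emb_def right_emb_def)
    then show ?thesis
      unfolding b e by (simp only: TS.scale_right_distrib TS.scale_scale 1 2)
  qed
qed

lemma brk_quad_right:
  assumes x: "x \<in> hcomp C i" and x0: "x \<noteq> 0" and t: "t \<in> hcomp (tensor_power 2 C) j"
  shows "brk (word C [x]) (quad t) =
    tscale (ksign (n + 1)) (left_emb (contract_right x t)) +
    tscale (ksign (n + (i + n) * (j + n))) (right_emb (contract_left i x t))"
proof (rule hcomp_tensor_power_2_eqI[OF vsT _ _ _ t])
  have xh: "x \<in> homog C" using x by (rule hcomp_homog)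
  have wx: "word C [x] \<in> tens C" using xh by (simp add: word_tens)
  show "linear_on tscale tscale (tens C) (\<lambda>t. brk (word C [x]) (quad t))"
    by (rule linear_on_compose[OF quad_linear_on quad_tens brk_right[OF wx]])
  show "linear_on tscale tscale (tens C) (\<lambda>t. tscale (ksign (n + 1)) (left_emb (contract_right x t)) +
      tscale (ksign (n + (i + n) * (j + n))) (right_emb (contract_left i x t)))"
    by (intro linear_on_plus[OF vsT] linear_on_scaled[OF vsT]
        linear_on_compose[OF contract_linear_on(1)[OF xh] contract_carr(1)[OF xh] emb_linear_on(2)]
        linear_on_compose[OF contract_linear_on(2)[OF xh] contract_carr(2)[OF xh] emb_linear_on(1)])
  fix y z p q
  assume y: "y \<in> hcomp C p" and z: "z \<in> hcomp C q" and nz: "y \<noteq> 0" "z \<noteq> 0" and j: "j = p + q"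
  have h: "y \<in> homog C" "z \<in> homog C"
    using y z by (auto simp: hcomp_homog)
  have c: "y \<in> carr C" "z \<in> carr C"
    using h by (simp_all add: homog_carr)
  have e: "right_emb (contract_left i x (word C [y, z])) = tscale (ksign (q * (n + i)) * pairing C y x) (right_emb z)"
    "left_emb (contract_right x (word C [y, z])) = tscale (ksign (p * q) * pairing C x z) (left_emb y)"
    by (simp_all only: contract_word[OF xh y z] emb_scale c)
  have b: "brk (word C [x]) (quad (word C [y, z])) = tscale (ksign p) (bwords [x] [y, z])"
    using h xh by (simp add: quad_word[OF y h(2)] linear_on_scale[OF brk_right[OF wx]] word_tens brk_word)
  show "brk (word C [x]) (quad (word C [y, z])) =
      tscale (ksign (n + 1)) (left_emb (contract_right x (word C [y, z]))) +
      tscale (ksign (n + (i + n) * (j + n))) (right_emb (contract_left i x (word C [y, z])))"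
  proof -
    from x0 nz have d: "deg (desusp C) x = i - 1" "deg (desusp C) y = p - 1" "deg (desusp C) z = q - 1"
      using deg_desusp_eq x y z by auto
    have 1: "ksign p * (ksign (i + (i - 1 + N) * (p - 1)) * pairing C x z) =
        ksign (n + 1) * (ksign (p * q) * pairing C x z)"
    proof (cases "pairing C x z = 0")
      case False
      then have n: "n = - i - q"
        using pairing_nonzero[OF x z] by simp
      have "ksign (p + (i + (i - 1 + N) * (p - 1))) = (ksign (n + 1 + p * q) :: 'k)"
        by (rule ksign_cong) (simp add: n algebra_simps)
      then show ?thesis
        by (simp add: ksign_add mult.assoc[symmetric])
    qed simp
    have 2: "ksign p * (ksign i * pairing C x y) =
        ksign (n + (i + n) * (j + n)) * (ksign (q * (n + i)) * pairing C y x)"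
    proof (cases "pairing C x y = 0")
      case True
      then show ?thesis
        using pairing_symmetric[OF y x] by simp
    next
      case False
      then have n: "n = - i - p"
        using pairing_nonzero[OF x y] by simp
      have "ksign (p + i) = (ksign (n + (i + n) * (j + n) + q * (n + i) + p * i) :: 'k)"
        by (rule ksign_cong) (simp add: n j algebra_simps)
      then show ?thesis
        using pairing_symmetric[OF y x] by (simp add: ksign_add mult.assoc[symmetric])
    qed
    have "bwords [x] [y, z] = tscale (ksign i * pairing C x y) (right_emb z) +
        tscale (ksign (i + (i - 1 + N) * (p - 1)) * pairing C x z) (left_emb y)"
      by (simp add: bwords_def split_sum_Cons bterm_def bcoeff_def d left_emb_def right_emb_def)
    then show ?thesis
      unfolding b e by (simp only: TS.scale_right_distrib TS.scale_scale 1 2 add.commute)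
  qed
qed

lemma diff_compatible_gen:
  assumes x: "x \<in> hcomp C i" and x0: "x \<noteq> 0" and y: "y \<in> hcomp C j"
  shows "cobar.diff_compatible (i - 1) (word C [x]) (word C [y])"
proof -
  have h: "x \<in> homog C" "y \<in> homog C" "diff C x \<in> homog C" "diff C y \<in> homog C"
    using x y diff_hcomp by (auto simp: hcomp_homog diff_homog)
  have w: "word C [x] \<in> tens C" "word C [y] \<in> tens C" "word C [diff C x] \<in> tens C" "word C [diff C y] \<in> tens C"
    "quad (comult C x) \<in> tens C" "quad (comult C y) \<in> tens C"
    using h by (simp_all add: word_tens quad_tens comult_tens homog_carr)
  let ?W = "word (cobar C) [word C [], word C []]"
  let ?A = "left_emb (contract_right x (comult C y))" and ?B = "right_emb (contract_right y (comult C x))"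
  define s where "s = (ksign (i - 1) :: 'k)"
  define r where "r = (ksign (i + (j + n) * (i + n)) :: 'k)"
  have gen: "cobar_diff (word C [x]) = word C [diff C x] + quad (comult C x)"
    "cobar_diff (word C [y]) = word C [diff C y] + quad (comult C y)"
    using h by (simp_all only: cobar_diff_single cobar_gen_eq)
  have s1: "- ksign i = s"
    unfolding s_def by (rule ksign_cong_minus[symmetric]) simp
  have s2: "ksign (i - 1 + N) * ksign i = (ksign (n + 1) :: 'k)"
    unfolding ksign_add[symmetric] by (rule ksign_cong) simp
  have s3: "ksign (i - 1 + N) * ksign (n + 1) = - s"
    unfolding s_def ksign_add[symmetric] by (rule ksign_cong_minus) simp
  have s4: "ksign (i - 1 + N) * ksign (n + (i + n) * (j + n)) = - r"
    unfolding r_def ksign_add[symmetric] by (rule ksign_cong_minus) (simp add: algebra_simps)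
  have s5: "ksign (n + 1) = s * (ksign (i + n) :: 'k)"
    unfolding s_def ksign_add[symmetric] by (rule ksign_cong) simp
  have "tensor_diff (cobar C) cobar_diff ?W = 0"
  proof -
    have u: "word C [] \<in> hcomp (cobar C) 0" "word C [] \<in> homog (cobar C)"
      using cobar.unit_degree word_homog_cobar[of "[]"] by simp_all
    show ?thesis
      using cobar.tensor_diff_word2[OF u]
      by (simp only: cobar_simps cobar_diff_unit cobar.word2_zero u TS.scale_zero_right add_0_left)
  qed
  then have lhs: "tensor_diff (cobar C) cobar_diff (brk (word C [x]) (word C [y])) = 0"
    using bwords_gen[OF x h(2)] h linear_on_scale[OF cobar.tensor_diff_linear_on, of ?W]
    by (simp only: brk_word Cons_in_lists_iff lists.Nil simp_thms word_cobar_tens cobar_simps TS.scale_zero_right)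
  have 1: "brk (cobar_diff (word C [x])) (word C [y]) =
      tscale (s * pairing C (diff C x) y) ?W + (tscale s ?A + tscale r ?B)"
    unfolding gen linear_on_add[OF brk_left[OF w(2)] w(3,5)] brk_quad_left[OF y comult_hcomp[OF x]]
      contract_cyclic[OF x y] s1 r_def s_def
    using bwords_gen[OF diff_hcomp[OF x] h(2)] h
    by (simp only: brk_word Cons_in_lists_iff lists.Nil simp_thms)
  have 2: "brk (word C [x]) (cobar_diff (word C [y])) =
      tscale (ksign i * pairing C x (diff C y)) ?W +
      (tscale (ksign (n + 1)) ?A + tscale (ksign (n + (i + n) * (j + n))) ?B)"
    unfolding gen linear_on_add[OF brk_right[OF w(1)] w(4,6)] brk_quad_right[OF x x0 comult_hcomp[OF y]]
      contract_cyclic[OF y x]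
    using bwords_gen[OF x h(4)] h
    by (simp only: brk_word Cons_in_lists_iff lists.Nil simp_thms)
  \<comment> \<open>Compatibility of the pairing with \<open>d\<close>.\<close>
  have pair: "s * pairing C (diff C x) y + ksign (i - 1 + N) * (ksign i * pairing C x (diff C y)) = 0"
    using pairing_diff[OF x y]
    by (simp only: mult.assoc[symmetric] s2 s5) (simp only: mult.assoc distrib_left[symmetric] mult_zero_right)
  have sum: "(p + (a + b)) + (p' + (- a + - b)) = p + p'" for p a b p' :: "'q::ab_group_add"
    by (simp add: algebra_simps)
  have "brk (cobar_diff (word C [x])) (word C [y]) +
      tscale (ksign (i - 1 + N)) (brk (word C [x]) (cobar_diff (word C [y]))) = 0"
    unfolding 1 2 TS.scale_right_distrib TS.scale_scale s3 s4 TS.scale_minus_left sum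
      TS.scale_left_distrib[symmetric] pair by (rule TS.scale_zero_left)
  then show ?thesis
    using lhs by (simp only: cobar.diff_compatible_def cobar_simps)
qed

text \<open>Induction on the second word, letter by letter.\<close>

lemma diff_compatible_word_gen:
  assumes p: "p \<in> hcomp (cobar C) i" and v: "v \<in> nzl C"
    and gen: "\<And>y j. y \<in> hcomp C j \<Longrightarrow> y \<noteq> 0 \<Longrightarrow> cobar.diff_compatible i p (word C [y])"
  shows "cobar.diff_compatible i p (word C v)"
  using v
proof (induction v)
  case Nil
  have pt: "p \<in> tens C"
    using p hcomp_tens by simp
  have b0: "brk p 0 = 0"
    by (rule linear_on_zero[OF vsT vsT brk_right[OF pt] tens_subspace])
  have t0: "tensor_diff (cobar C) (diff (cobar C)) 0 = 0"
    by (rule linear_on_zero[OF vsT vsT cobar.tensor_diff_linear_on tens_subspace])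
  have unit: "brk q (word C []) = 0" if "q \<in> tens C" for q
  proof (rule tens_eqI[OF vsT brk_left linear_on_const0[OF vsT] _ that])
    show "brk (word C v) (word C []) = 0" if "v \<in> lists (homog C)" for v
      using that by (simp add: brk_word bwords_def split_sum_def)
  qed (simp add: word_tens)
  show ?case
    unfolding cobar.diff_compatible_def cobar_simps cobar_diff_unit unit[OF pt] unit[OF cobar_diff_tens[OF pt]]
      b0 t0[unfolded cobar_simps] by (simp only: TS.scale_zero_right add_0_left)
next
  case (Cons y v)
  then obtain j where y: "y \<in> hcomp C j" "y \<noteq> 0"
    by (auto simp: homog_def)
  then have 1: "word C [y] \<in> hcomp (cobar C) (j - 1)"
    using desusp.word_hcomp(1)[of "[y]" "[j - 1]"] by simp
  have vh: "v \<in> nzl C" "v \<in> lists (homog C)"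
    using Cons.prems by (simp_all add: nzl_homog)
  obtain l where 2: "word C v \<in> hcomp (cobar C) l"
    using word_homog_cobar[OF vh(2)] by (auto simp only: homog_def)
  have "word C (y # v) = mult (cobar C) (word C [y]) (word C v)"
    using y vh hcomp_homog by simp
  then show ?case
    using cobar.diff_compatible_mult[OF p 1 2 gen[OF y] Cons.IH[OF vh(1)]] by (simp only:)
qed

lemma diff_compatible_word:
  assumes v: "v \<in> nzl C" and w: "w \<in> nzl C"
  shows "cobar.diff_compatible (wd v) (word C v) (word C w)"
proof (rule diff_compatible_word_gen)
  show p: "word C v \<in> hcomp (cobar C) (wd v)"
    using word_hcomp_cobar[OF v] by simp
  show "w \<in> nzl C"
    by (rule w)
  fix y j assume y: "y \<in> hcomp C j" "y \<noteq> 0"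
  have 1: "word C [y] \<in> hcomp (cobar C) (j - 1)"
    using desusp.word_hcomp(1)[of "[y]" "[j - 1]"] y by simp
  have "cobar.diff_compatible (j - 1) (word C [y]) (word C v)"
    by (rule diff_compatible_word_gen[OF 1 v]) (rule diff_compatible_gen[OF y])
  then show "cobar.diff_compatible (wd v) (word C v) (word C [y])"
    by (rule cobar.diff_compatible_skew[OF p 1])
qed

lemma brk_diff:
  assumes p: "p \<in> hcomp (cobar C) i" and q: "q \<in> hcomp (cobar C) j"
  shows "cobar.diff_compatible i p q"
  unfolding cobar.diff_compatible_def cobar_simps
proof (rule words_eqI2[OF _ _ _ _ _ p[unfolded cobar_simps] q[unfolded cobar_simps]])
  note T = cobar.tensor_diff_linear_on[unfolded cobar_simps]
  let ?G = "\<lambda>p q. brk (cobar_diff p) q + tscale (ksign (i + N)) (brk p (cobar_diff q))"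
  show "linear_on tscale tscale (tens C) (\<lambda>p. tensor_diff (cobar C) cobar_diff (brk p q))"
    if "q \<in> tens C" for q
    by (rule linear_on_compose[OF brk_left[OF that] brk_tens[OF _ that] T])
  show "linear_on tscale tscale (tens C) (\<lambda>q. tensor_diff (cobar C) cobar_diff (brk p q))"
    if "p \<in> tens C" for p
    by (rule linear_on_compose[OF brk_right[OF that] brk_tens[OF that] T])
  show "linear_on tscale tscale (tens C) (\<lambda>p. ?G p q)" if "q \<in> tens C" for q
    by (intro linear_on_plus[OF vsT] linear_on_scaled[OF vsT] brk_left cobar_diff_tens that
        linear_on_compose[OF cobar_diff_linear_on cobar_diff_tens brk_left[OF that]])
  show "linear_on tscale tscale (tens C) (\<lambda>q. ?G p q)" if "p \<in> tens C" for p
    by (intro linear_on_plus[OF vsT] linear_on_scaled[OF vsT] brk_right cobar_diff_tens that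
        linear_on_compose[OF cobar_diff_linear_on cobar_diff_tens brk_right[OF that]])
  fix v w assume "v \<in> nzl C" "w \<in> nzl C" "wd v = i" "wd w = j"
  then show "tensor_diff (cobar C) cobar_diff (brk (word C v) (word C w)) = ?G (word C v) (word C w)"
    using diff_compatible_word[of v w] by (simp only: cobar.diff_compatible_def cobar_simps)
qed

lemma double_bracket_cobar: "double_bracket (cobar C) N brk"
proof (intro double_bracket.intro double_bracket_axioms.intro)
  show "dg_algebra (cobar C)"
    by (rule dg_algebra_cobar)
  show "tensor_diff (cobar C) (diff (cobar C)) (brk p q) =
      brk (diff (cobar C) p) q + tscale (ksign (i + N)) (brk p (diff (cobar C) q))"
    if "p \<in> hcomp (cobar C) i" "q \<in> hcomp (cobar C) j" for p q i j
    using brk_diff[OF that] by (simp only: cobar.diff_compatible_def)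
qed (rule cobar.br_bilinear cobar.br_degree cobar.br_derivation cobar.br_skew; assumption)+

end


section \<open>The double Jacobi identity\<close>

context graded_double_bracket
begin

text \<open>
  The operation \<open>bracket_L\<close>, made to vanish on tensors of length \<open>0\<close> so that it is linear in its
  first argument, too.
\<close>

definition brL :: "'a \<Rightarrow> ('k, 'a) tensor \<Rightarrow> ('k, 'a) tensor"
  where "brL a = lift A tscale (\<lambda>xs. case xs of [] \<Rightarrow> 0 | p # qs \<Rightarrow> tmul A (br a p) (word A qs))"

lemma brL_mh:
  assumes a: "a \<in> carr A"
  shows "multihomogeneous A tscale (\<lambda>xs. case xs of [] \<Rightarrow> 0 | p # qs \<Rightarrow> tmul A (br a p) (word A qs))"
proof (rule mhI)
  fix us ws i
  assume us: "us \<in> lists (homog A)" and ws: "ws \<in> lists (homog A)"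
  show "linear_on (scl A) tscale (hcomp A i)
      (\<lambda>x. case us @ x # ws of [] \<Rightarrow> 0 | p # qs \<Rightarrow> tmul A (br a p) (word A qs))"
  proof (cases us)
    case Nil
    have "linear_on (scl A) tscale (hcomp A i) (\<lambda>x. tmul A (br a x) (word A ws))"
      by (rule linear_on_compose[OF linear_on_subset[OF br_right[OF a] hcomp_subset_carr] _ tmul_left])
        (simp_all add: br_tens a hcomp_carr word_tens ws)
    then show ?thesis by (simp add: Nil)
  next
    case (Cons u us')
    then have u: "u \<in> homog A" "us' \<in> lists (homog A)" using us by auto
    have "linear_on (scl A) tscale (hcomp A i) (\<lambda>x. tmul A (br a u) (word A (us' @ x # ws)))"
      by (rule linear_on_compose[OF word_linear_on_hcomp[OF u(2) ws] _ tmul_right])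
        (use u ws in \<open>simp_all add: br_tens a homog_carr word_tens hcomp_homog\<close>)
    then show ?thesis by (simp add: Cons)
  qed
qed

lemma brL_linear_on: "a \<in> carr A \<Longrightarrow> linear_on tscale tscale (tens A) (brL a)"
  unfolding brL_def by (rule lift_linear_on[OF vsT brL_mh])

lemma brL_word:
  assumes "a \<in> carr A" "p \<in> homog A" "qs \<in> lists (homog A)"
  shows "brL a (word A (p # qs)) = tmul A (br a p) (word A qs)"
  unfolding brL_def by (subst lift_word[OF vsT brL_mh]) (use assms in simp_all)

lemma brL_tens:
  assumes "a \<in> carr A" "t \<in> tens A"
  shows "brL a t \<in> tens A"
  unfolding brL_def
proof (rule lift_in[OF vsT brL_mh[OF assms(1)] tens_subspace _ assms(2)])
  fix xs assume "xs \<in> lists (homog A)"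
  then show "(case xs of [] \<Rightarrow> 0 | p # qs \<Rightarrow> tmul A (br a p) (word A qs)) \<in> tens A"
    by (cases xs) (simp_all add: tmul_tens br_tens word_tens homog_carr assms(1))
qed

lemma brL_param:
  assumes "t \<in> tens A"
  shows "linear_on (scl A) tscale (carr A) (\<lambda>a. brL a t)"
  unfolding brL_def
proof (rule lift_param[OF vsT vector_space carr_subspace brL_mh _ assms])
  fix xs assume xs: "xs \<in> lists (homog A)"
  show "linear_on (scl A) tscale (carr A) (\<lambda>a. case xs of [] \<Rightarrow> 0 | p # qs \<Rightarrow> tmul A (br a p) (word A qs))"
  proof (cases xs)
    case Nil
    then show ?thesis by (simp add: linear_on_const0[OF vsT])
  next
    case (Cons p qs)
    then have p: "p \<in> homog A" "qs \<in> lists (homog A)" using xs by auto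
    have "linear_on (scl A) tscale (carr A) (\<lambda>a. tmul A (br a p) (word A qs))"
      by (rule linear_on_compose[OF br_left _ tmul_left]) (simp_all add: p br_tens homog_carr word_tens)
    then show ?thesis by (simp add: Cons)
  qed
qed

lemma bracket_L_eq:
  assumes a: "a \<in> carr A" and t: "t \<in> hcomp (tensor_power 2 A) k"
  shows "bracket_L A br a t = brL a t"
proof -
  have mh: "multihomogeneous A tscale (\<lambda>xs. tmul A (br a (hd xs)) (word A (tl xs)))"
    by (rule mh_cong[OF brL_mh[OF a]]) (simp split: list.split)
  show ?thesis
  proof (rule hcomp_tensor_power_2_eqI[OF vsT _ brL_linear_on[OF a] _ t])
    show "linear_on tscale tscale (tens A) (bracket_L A br a)"
      unfolding bracket_L_def by (rule lift_linear_on[OF vsT mh])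
    fix x y i j assume "x \<in> hcomp A i" "y \<in> hcomp A j"
    then have h: "x \<in> homog A" "y \<in> homog A" by (auto simp: hcomp_homog)
    then have "bracket_L A br a (word A [x, y]) = tmul A (br a x) (word A [y])"
      unfolding bracket_L_def by (subst lift_word[OF vsT mh]) simp_all
    then show "bracket_L A br a (word A [x, y]) = brL a (word A [x, y])"
      using h by (simp add: brL_word[OF a])
  qed
qed

end

text \<open>
  The signs in the double Jacobi identity, for the degrees of the parts of \<open>(u1, x, u2)\<close>,
  \<open>(v1, y, v2)\<close> and \<open>(w1, z, w2, z', w3)\<close>, where \<open>x\<close> is paired with \<open>z\<close> and \<open>y\<close> with \<open>z'\<close>.
\<close>

lemma jacobi_sign:
  fixes u1 u2 v1 v2 w1 w2 w3 x y z z' N :: int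
  assumes N: "N = - x - z" and z': "N = - y - z'"
  shows "(ksign (y + 1 + (v1 + y + v2 + N) * (w1 + (z + w2)) + v2 * (v1 + y)) *
      ksign (x + 1 + (u1 + x + u2 + N) * w1 + u2 * (u1 + x)) :: 'k::field) =
    - (ksign ((u1 + (x + u2) + N) * (v1 + (y + v2) + (w1 + (z + (w2 + (z' + w3)))))) *
      (ksign ((w1 + u2) * (u1 + (w2 + v2) + (v1 + w3))) *
      (ksign (z + 1 + (w1 + z + (w2 + (z' + w3)) + N) * u1 + (w2 + (z' + w3)) * (w1 + z)) *
       ksign ((x + 1) * (z + 1)) *
      ksign (y + 1 + (v1 + y + v2 + N) * (u1 + w2) + v2 * (v1 + y)))))"
proof -
  have z': "z' = x + z - y" using assms by simp
  have "odd ((y + 1 + (v1 + y + v2 + N) * (w1 + (z + w2)) + v2 * (v1 + y)) +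
      (x + 1 + (u1 + x + u2 + N) * w1 + u2 * (u1 + x)) +
    ((u1 + (x + u2) + N) * (v1 + (y + v2) + (w1 + (z + (w2 + (z' + w3))))) +
      ((w1 + u2) * (u1 + (w2 + v2) + (v1 + w3)) +
      (z + 1 + (w1 + z + (w2 + (z' + w3)) + N) * u1 + (w2 + (z' + w3)) * (w1 + z) +
       (x + 1) * (z + 1) +
      (y + 1 + (v1 + y + v2 + N) * (u1 + w2) + v2 * (v1 + y))))))"
    unfolding z' N by (simp add: algebra_simps)
  then show ?thesis
    unfolding ksign_add[symmetric] by (rule ksign_cong_minus)
qed

text \<open>Tensors of length three, and the relations between the two cyclic permutations on them.\<close>

definition tens3 :: "('k::field, 'v::ab_group_add, 'z) gspace_scheme \<Rightarrow> ('k, 'v) tensor set"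
  where "tens3 V = TS.span {word V [x, y, z] | x y z. x \<in> homog V \<and> y \<in> homog V \<and> z \<in> homog V}"

lemma tens3_subspace: "TS.subspace (tens3 V)"
  by (simp add: tens3_def)

lemma word_tens3: "x \<in> homog V \<Longrightarrow> y \<in> homog V \<Longrightarrow> z \<in> homog V \<Longrightarrow> word V [x, y, z] \<in> tens3 V"
  unfolding tens3_def by (rule TS.span_base) blast

lemma tens3_tens: "tens3 V \<subseteq> tens V"
  unfolding tens3_def by (rule TS.span_minimal[OF _ tens_subspace]) (auto simp: word_tens)

context graded_space
begin

abbreviation \<sigma> :: "('k, 'v) tensor \<Rightarrow> ('k, 'v) tensor"
  where "\<sigma> \<equiv> tensor_perm 3 V (cycle_of_list [0, 1, 2])"

abbreviation \<sigma>' :: "('k, 'v) tensor \<Rightarrow> ('k, 'v) tensor"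
  where "\<sigma>' \<equiv> tensor_perm 3 V (cycle_of_list [0, 2, 1])"

lemma tensor_perm_compose:
  assumes t: "t \<in> tens3 V"
  shows "\<sigma> (\<sigma> t) = \<sigma>' t" "\<sigma>' (\<sigma> t) = t"
proof -
  note lin = linear_on_compose[OF tensor_perm_linear_on(1) tensor_perm_in_tens(1) tensor_perm_linear_on(1)]
    linear_on_compose[OF tensor_perm_linear_on(1) tensor_perm_in_tens(1) tensor_perm_linear_on(2)]
  note sub = linear_on_subset[OF _ tens3_tens, unfolded tens3_def]
  have *: "\<sigma> (\<sigma> b) = \<sigma>' b \<and> \<sigma>' (\<sigma> b) = b"
    if b: "b \<in> {word V [x, y, z] | x y z. x \<in> homog V \<and> y \<in> homog V \<and> z \<in> homog V}" for b
  proof -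
    from b obtain x y z i j l where b: "b = word V [x, y, z]"
      and x: "x \<in> hcomp V i" and y: "y \<in> hcomp V j" and z: "z \<in> hcomp V l"
      unfolding homog_def by blast
    have t: "word V [z, x, y] \<in> tens V"
      using x y z by (simp add: word_tens hcomp_homog)
    have s: "ksign (l * (i + j) + j * (l + i)) = (ksign (i * (j + l)) :: 'k)"
      by (rule ksign_cong) (simp add: algebra_simps)
    have "\<sigma> (\<sigma> b) = tscale (ksign (l * (i + j) + j * (l + i))) (word V [y, z, x])"
      unfolding b tensor_perm_word(1)[OF x y z] linear_on_scale[OF tensor_perm_linear_on(1) t]
        tensor_perm_word(1)[OF z x y] ksign_add[of "l * (i + j)"] by (rule TS.scale_scale)
    moreover have "\<sigma>' (\<sigma> b) = b"
      unfolding b tensor_perm_word(1)[OF x y z] linear_on_scale[OF tensor_perm_linear_on(2) t]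
        tensor_perm_word(2)[OF z x y] TS.scale_scale ksign_square by (rule TS.scale_one)
    ultimately show ?thesis
      unfolding b tensor_perm_word(2)[OF x y z] s by blast
  qed
  show "\<sigma> (\<sigma> t) = \<sigma>' t"
    by (rule linear_on_span_eq[OF vsT vsT sub[OF lin(1)] sub[OF tensor_perm_linear_on(2)] _ t[unfolded tens3_def]])
      (assumption | rule *[THEN conjunct1])+
  show "\<sigma>' (\<sigma> t) = t"
    by (rule linear_on_span_eq[OF vsT vsT sub[OF lin(2)] linear_on_id _ t[unfolded tens3_def]])
      (assumption | rule *[THEN conjunct2])+
qed

end

text \<open>
  Sums over all ways to mark two letters \<open>z\<close>, \<open>z'\<close> of \<open>w\<close> in this order, a letter of \<open>u\<close> and a
  letter of \<open>v\<close>.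
\<close>

definition marked_sum where
  "marked_sum u v w F = split_sum (\<lambda>w1 z r. split_sum (\<lambda>w2 z' w3. split_sum (\<lambda>u1 x u2.
    split_sum (\<lambda>v1 y v2. F w1 z w2 z' w3 u1 x u2 v1 y v2) v) u) r) w"

lemma marked_sum_cong:
  assumes "\<And>w1 z w2 z' w3 u1 x u2 v1 y v2. w = w1 @ z # w2 @ z' # w3 \<Longrightarrow> u = u1 @ x # u2 \<Longrightarrow>
    v = v1 @ y # v2 \<Longrightarrow> F w1 z w2 z' w3 u1 x u2 v1 y v2 = G w1 z w2 z' w3 u1 x u2 v1 y v2"
  shows "marked_sum u v w F = marked_sum u v w G"
  unfolding marked_sum_def by (intro split_sum_cong) (rule assms; simp)

lemma marked_sum_subspace:
  assumes "TS.subspace S" "\<And>w1 z w2 z' w3 u1 x u2 v1 y v2. w = w1 @ z # w2 @ z' # w3 \<Longrightarrow> u = u1 @ x # u2 \<Longrightarrow>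
    v = v1 @ y # v2 \<Longrightarrow> F w1 z w2 z' w3 u1 x u2 v1 y v2 \<in> S"
  shows "marked_sum u v w F \<in> S"
  unfolding marked_sum_def by (intro split_sum_subspace[OF assms(1)]) (rule assms(2); simp)

lemma marked_sum_linear:
  assumes S: "TS.subspace S" and f: "linear_on tscale tscale S f"
    and F: "\<And>w1 z w2 z' w3 u1 x u2 v1 y v2. w = w1 @ z # w2 @ z' # w3 \<Longrightarrow> u = u1 @ x # u2 \<Longrightarrow>
    v = v1 @ y # v2 \<Longrightarrow> F w1 z w2 z' w3 u1 x u2 v1 y v2 \<in> S"
  shows "f (marked_sum u v w F) =
    marked_sum u v w (\<lambda>w1 z w2 z' w3 u1 x u2 v1 y v2. f (F w1 z w2 z' w3 u1 x u2 v1 y v2))"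
proof -
  note L = split_sum_linear[OF vsT vsT f S] and I = split_sum_subspace[OF S]
  have "f (marked_sum u v w F) = split_sum (\<lambda>w1 z r. f (split_sum (\<lambda>w2 z' w3. split_sum (\<lambda>u1 x u2.
      split_sum (\<lambda>v1 y v2. F w1 z w2 z' w3 u1 x u2 v1 y v2) v) u) r)) w"
    unfolding marked_sum_def by (rule L, (rule I)+, rule F) simp_all
  also have "\<dots> = split_sum (\<lambda>w1 z r. split_sum (\<lambda>w2 z' w3. f (split_sum (\<lambda>u1 x u2.
      split_sum (\<lambda>v1 y v2. F w1 z w2 z' w3 u1 x u2 v1 y v2) v) u)) r) w"
    by (rule split_sum_cong, rule L, (rule I)+, rule F) simp_all
  also have "\<dots> = split_sum (\<lambda>w1 z r. split_sum (\<lambda>w2 z' w3. split_sum (\<lambda>u1 x u2. f (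
      split_sum (\<lambda>v1 y v2. F w1 z w2 z' w3 u1 x u2 v1 y v2) v)) u) r) w"
    by (rule split_sum_cong, rule split_sum_cong, rule L, rule I, rule F) simp_all
  also have "\<dots> = marked_sum u v w (\<lambda>w1 z w2 z' w3 u1 x u2 v1 y v2. f (F w1 z w2 z' w3 u1 x u2 v1 y v2))"
    unfolding marked_sum_def
    by (rule split_sum_cong, rule split_sum_cong, rule split_sum_cong, rule L, rule F) simp_all
  finally show ?thesis .
qed

context cyclic_dg_coalgebra
begin

text \<open>
  The two kinds of summands of the iterated bracket of words \<open>u\<close>, \<open>v\<close>, \<open>w\<close>: in the first one, \<open>w\<close> is
  paired both with \<open>v\<close> and, further left, with \<open>u\<close>; in the second one, taken for the words
  \<open>v\<close>, \<open>w\<close>, \<open>u\<close> in place of \<open>u\<close>, \<open>v\<close>, \<open>w\<close>, the same letters are paired.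
\<close>

definition jterm1 where
  "jterm1 w1 z w2 z' w3 u1 x u2 v1 y v2 =
    tscale (bcoeff v1 y v2 (w1 @ z # w2) z' * bcoeff u1 x u2 w1 z)
      (word (cobar C) [word C (w1 @ u2), word C (u1 @ w2 @ v2), word C (v1 @ w3)])"

definition jterm2 where
  "jterm2 w1 z w2 z' w3 u1 x u2 v1 y v2 =
    tscale (bcoeff w1 z (w2 @ z' # w3) u1 x * bcoeff v1 y v2 (u1 @ w2) z')
      (word (cobar C) [word C (u1 @ w2 @ v2), word C (v1 @ w3), word C (w1 @ u2)])"

lemma jterm_tens3:
  assumes "w1 @ z # w2 @ z' # w3 \<in> lists (homog C)" "u1 @ x # u2 \<in> lists (homog C)" "v1 @ y # v2 \<in> lists (homog C)"
  shows "jterm1 w1 z w2 z' w3 u1 x u2 v1 y v2 \<in> tens3 (cobar C)"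
    "jterm2 w1 z w2 z' w3 u1 x u2 v1 y v2 \<in> tens3 (cobar C)"
  unfolding jterm1_def jterm2_def
  by (intro TS.subspace_scale[OF tens3_subspace] word_tens3 word_homog_cobar; use assms in simp)+

lemma jterm_cancel:
  assumes w: "w1 @ z # w2 @ z' # w3 \<in> nzl C" and u: "u1 @ x # u2 \<in> nzl C" and v: "v1 @ y # v2 \<in> nzl C"
  shows "tscale (ksign ((wd (u1 @ x # u2) + N) * (wd (v1 @ y # v2) + wd (w1 @ z # w2 @ z' # w3))))
      (cobar.\<sigma> (jterm2 w1 z w2 z' w3 u1 x u2 v1 y v2)) = - jterm1 w1 z w2 z' w3 u1 x u2 v1 y v2"
proof -
  have h: "x \<in> homog C" "x \<noteq> 0" "y \<in> homog C" "y \<noteq> 0" "z \<in> homog C" "z \<noteq> 0" "z' \<in> homog C" "z' \<noteq> 0"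
    using u v w by simp_all
  let ?l = "[word C (u1 @ w2 @ v2), word C (v1 @ w3), word C (w1 @ u2)]"
  let ?r = "[word C (w1 @ u2), word C (u1 @ w2 @ v2), word C (v1 @ w3)]"
  have t: "word (cobar C) ?l \<in> tens (cobar C)"
    by (intro word_tens) (use u v w in \<open>simp add: word_homog_cobar nzl_homog\<close>)
  have p: "cobar.\<sigma> (word (cobar C) ?l) =
      tscale (ksign ((wd w1 + wd u2) * (wd u1 + (wd w2 + wd v2) + (wd v1 + wd w3)))) (word (cobar C) ?r)"
    using cobar.tensor_perm_word(1)[of "word C (u1 @ w2 @ v2)" "wd (u1 @ w2 @ v2)"
        "word C (v1 @ w3)" "wd (v1 @ w3)" "word C (w1 @ u2)" "wd (w1 @ u2)"]
      word_hcomp_cobar[of "u1 @ w2 @ v2"] word_hcomp_cobar[of "v1 @ w3"] word_hcomp_cobar[of "w1 @ u2"] u v w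
    by simp
  have c: "ksign ((wd (u1 @ x # u2) + N) * (wd (v1 @ y # v2) + wd (w1 @ z # w2 @ z' # w3))) *
      (bcoeff w1 z (w2 @ z' # w3) u1 x * bcoeff v1 y v2 (u1 @ w2) z' *
       ksign ((wd w1 + wd u2) * (wd u1 + (wd w2 + wd v2) + (wd v1 + wd w3)))) =
    - (bcoeff v1 y v2 (w1 @ z # w2) z' * bcoeff u1 x u2 w1 z)"
  proof (cases "pairing C x z = 0 \<or> pairing C y z' = 0")
    case True
    then show ?thesis
      using pairing_sym_deg[OF h(1,2,5,6)] by (auto simp: bcoeff_def)
  next
    case False
    then have n: "N = - deg (desusp C) x - deg (desusp C) z" "N = - deg (desusp C) y - deg (desusp C) z'"
      using pairing_deg h by blast+
    \<comment> \<open>Only the signs differ; the two pairings are common to both sides.\<close>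
    have comb: "A * (B * s * p * (D * q) * E) = - (F * q * G * p)"
      if "F * G = - (A * (E * (B * s * D)))" for A B D E F G s p q :: 'k
    proof -
      have "F * q * G * p = (F * G) * (p * q)"
        by (simp only: ac_simps)
      then show ?thesis
        unfolding that by (simp only: mult_minus_left minus_minus) (simp only: ac_simps)
    qed
    show ?thesis
      unfolding bcoeff_def pairing_sym_deg[OF h(1,2,5,6)] wdeg_simps mult.assoc[of _ _ "pairing C x z", symmetric]
      by (rule comb, rule jacobi_sign[OF n])
  qed
  show ?thesis
    unfolding jterm1_def jterm2_def linear_on_scale[OF cobar.tensor_perm_linear_on(1) t] p TS.scale_scale c
    by (rule TS.scale_minus_left)
qed

text \<open>Both sums have the same summands up to a cyclic permutation and a sign.\<close>

lemma jacobi_cancel: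
  assumes u: "u \<in> nzl C" and v: "v \<in> nzl C" and w: "w \<in> nzl C"
  shows "tscale (ksign ((wd u + N) * (wd v + wd w))) (cobar.\<sigma> (marked_sum u v w jterm2)) =
    - marked_sum u v w jterm1"
proof -
  have sub: "tens3 (cobar C) \<subseteq> tens (cobar C)"
    by (rule tens3_tens)
  have h: "u \<in> lists (homog C)" "v \<in> lists (homog C)" "w \<in> lists (homog C)"
    using u v w by (simp_all add: nzl_homog)
  let ?s = "ksign ((wd u + N) * (wd v + wd w)) :: 'k"
  have "tscale ?s (cobar.\<sigma> (marked_sum u v w jterm2)) =
      marked_sum u v w (\<lambda>w1 z w2 z' w3 u1 x u2 v1 y v2. tscale ?s (cobar.\<sigma> (jterm2 w1 z w2 z' w3 u1 x u2 v1 y v2)))"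
    by (rule marked_sum_linear[OF tens3_subspace
          linear_on_scaled[OF vsT linear_on_subset[OF cobar.tensor_perm_linear_on(1) sub]]],
        rule jterm_tens3(2)) (use h in simp_all)
  also have "\<dots> = marked_sum u v w (\<lambda>w1 z w2 z' w3 u1 x u2 v1 y v2. - jterm1 w1 z w2 z' w3 u1 x u2 v1 y v2)"
  proof (rule marked_sum_cong)
    fix w1 z w2 z' w3 u1 x u2 v1 y v2
    assume eq: "w = w1 @ z # w2 @ z' # w3" "u = u1 @ x # u2" "v = v1 @ y # v2"
    show "tscale ?s (cobar.\<sigma> (jterm2 w1 z w2 z' w3 u1 x u2 v1 y v2)) = - jterm1 w1 z w2 z' w3 u1 x u2 v1 y v2"
      unfolding eq by (rule jterm_cancel) (use u v w eq in simp_all)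
  qed
  also have "\<dots> = - marked_sum u v w jterm1"
    by (rule marked_sum_linear[OF tens3_subspace linear_on_uminus[OF vsT linear_on_id], symmetric],
        rule jterm_tens3(1)) (use h in simp_all)
  finally show ?thesis .
qed

lemma marked_sum_jterm_tens3:
  assumes "u \<in> lists (homog C)" "v \<in> lists (homog C)" "w \<in> lists (homog C)"
  shows "marked_sum u v w jterm1 \<in> tens3 (cobar C)" "marked_sum u v w jterm2 \<in> tens3 (cobar C)"
  by (rule marked_sum_subspace[OF tens3_subspace], rule jterm_tens3(1); use assms in simp)
    (rule marked_sum_subspace[OF tens3_subspace], rule jterm_tens3(2); use assms in simp)

text \<open>
  In \<open>{{v, w}}' = (c, b)\<close> the part \<open>c\<close> comes from \<open>w\<close> and \<open>b\<close> from \<open>v\<close>; a letter of \<open>u\<close> is paired with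
  a letter of either.
\<close>

lemma brL_bwords:
  assumes u: "u \<in> lists (homog C)" and v: "v \<in> lists (homog C)" and w: "w \<in> lists (homog C)"
  shows "cobar.brL (word C u) (bwords v w) = marked_sum u v w jterm1 + marked_sum w u v jterm2"
proof -
  have wu: "word C u \<in> carr (cobar C)"
    using u by (simp add: word_tens)
  note B = cobar.brL_linear_on[OF wu]
  \<comment> \<open>\<open>X\<close> pairs \<open>x'\<close> with \<open>z\<close> in \<open>c = c1 @ z # c2\<close>, and \<open>Y\<close> with \<open>z\<close> in \<open>b = b1 @ z # b2\<close>.\<close>
  define X where "X a x b c1 z c2 y e p x' q =
    tscale (bcoeff a x b (c1 @ z # c2) y * bcoeff p x' q c1 z)
      (word (cobar C) [word C (c1 @ q), word C (p @ c2 @ b), word C (a @ e)])" for a x b c1 z c2 y e p x' q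
  define Y where "Y a x b1 z b2 c y e p x' q =
    tscale (bcoeff a x (b1 @ z # b2) c y * bcoeff p x' q (c @ b1) z)
      (word (cobar C) [word C (c @ b1 @ q), word C (p @ b2), word C (a @ e)])" for a x b1 z b2 c y e p x' q
  have step: "cobar.brL (word C u) (bterm a x b c y e) =
      split_sum (\<lambda>p x' q. split_sum (\<lambda>c1 z c2. X a x b c1 z c2 y e p x' q) c) u +
      split_sum (\<lambda>p x' q. split_sum (\<lambda>b1 z b2. Y a x b1 z b2 c y e p x' q) b) u"
    if eq: "v = a @ x # b" "w = c @ y # e" for a x b c y e
  proof -
    have h: "a \<in> lists (homog C)" "b \<in> lists (homog C)" "c \<in> lists (homog C)" "e \<in> lists (homog C)"
      using v w eq by simp_all
    have cb: "c @ b \<in> lists (homog C)"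
      using h by simp
    have m: "word (cobar C) [word C (a @ e)] \<in> tens (cobar C)"
      using h by (simp add: word_tens word_homog_cobar)
    define f where "f t = tscale (bcoeff a x b c y) (tmul (cobar C) t (word (cobar C) [word C (a @ e)]))" for t
    have f: "linear_on tscale tscale (tens (cobar C)) f"
      unfolding f_def by (rule linear_on_scaled[OF vsT cobar.tmul_left[OF m]])
    have fb: "f (bterm p x' q r z s) = tscale (bcoeff a x b c y * bcoeff p x' q r z)
        (word (cobar C) [word C (r @ q), word C (p @ s), word C (a @ e)])"
      if "p \<in> lists (homog C)" "q \<in> lists (homog C)" "r \<in> lists (homog C)" "s \<in> lists (homog C)"
      for p x' q r z s
    proof -
      have "tmul (cobar C) (word (cobar C) [word C (r @ q), word C (p @ s)]) (word (cobar C) [word C (a @ e)]) =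
          word (cobar C) [word C (r @ q), word C (p @ s), word C (a @ e)]"
        using that h by (subst cobar.tmul_word) (simp_all add: word_homog_cobar)
      then show ?thesis
        unfolding f_def bterm_def
        using cobar.tmul_scale_left[OF word_cobar_tens[of "r @ q" "p @ s"] m] that
        by (simp only: append_in_lists_conv simp_thms TS.scale_scale)
    qed
    have "cobar.brL (word C u) (bterm a x b c y e) = f (bwords u (c @ b))"
    proof -
      have "cobar.brL (word C u) (word (cobar C) [word C (c @ b), word C (a @ e)]) =
          tmul (cobar C) (bwords u (c @ b)) (word (cobar C) [word C (a @ e)])"
        using h u by (subst cobar.brL_word[OF wu]) (simp_all add: word_homog_cobar brk_word)
      then show ?thesis
        unfolding f_def bterm_def
        using linear_on_scale[OF B word_cobar_tens[of "c @ b" "a @ e"]] h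
        by (simp only: append_in_lists_conv simp_thms)
    qed
    also have "\<dots> = split_sum (\<lambda>p x' q. split_sum (\<lambda>r z s. f (bterm p x' q r z s)) (c @ b)) u"
      by (rule bwords_linear[OF vsT f u cb])
    \<comment> \<open>The marked letter of \<open>c @ b\<close> lies in \<open>c\<close> or in \<open>b\<close>.\<close>
    also have "\<dots> = split_sum (\<lambda>p x' q. split_sum (\<lambda>c1 z c2. X a x b c1 z c2 y e p x' q) c +
        split_sum (\<lambda>b1 z b2. Y a x b1 z b2 c y e p x' q) b) u"
    proof (rule split_sum_cong)
      fix p x' q assume uq: "u = p @ x' # q"
      have "split_sum (\<lambda>c1 z c2. f (bterm p x' q c1 z (c2 @ b))) c =
          split_sum (\<lambda>c1 z c2. X a x b c1 z c2 y e p x' q) c"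
      proof (rule split_sum_cong)
        fix c1 z c2 assume cc: "c = c1 @ z # c2"
        then show "f (bterm p x' q c1 z (c2 @ b)) = X a x b c1 z c2 y e p x' q"
          using fb[of p q c1 "c2 @ b" x' z] u uq h by (simp add: X_def)
      qed
      moreover have "split_sum (\<lambda>b1 z b2. f (bterm p x' q (c @ b1) z b2)) b =
          split_sum (\<lambda>b1 z b2. Y a x b1 z b2 c y e p x' q) b"
      proof (rule split_sum_cong)
        fix b1 z b2 assume bb: "b = b1 @ z # b2"
        then show "f (bterm p x' q (c @ b1) z b2) = Y a x b1 z b2 c y e p x' q"
          using fb[of p q "c @ b1" b2 x' z] u uq h by (simp add: Y_def)
      qed
      ultimately show "split_sum (\<lambda>r z s. f (bterm p x' q r z s)) (c @ b) =
          split_sum (\<lambda>c1 z c2. X a x b c1 z c2 y e p x' q) c + split_sum (\<lambda>b1 z b2. Y a x b1 z b2 c y e p x' q) b"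
        unfolding split_sum_append by (simp only:)
    qed
    also have "\<dots> = split_sum (\<lambda>p x' q. split_sum (\<lambda>c1 z c2. X a x b c1 z c2 y e p x' q) c) u +
        split_sum (\<lambda>p x' q. split_sum (\<lambda>b1 z b2. Y a x b1 z b2 c y e p x' q) b) u"
      by (rule split_sum_add)
    finally show ?thesis .
  qed
  have "cobar.brL (word C u) (bwords v w) =
      split_sum (\<lambda>a x b. split_sum (\<lambda>c y e. cobar.brL (word C u) (bterm a x b c y e)) w) v"
    by (rule bwords_linear[OF vsT B v w])
  also have "\<dots> = split_sum (\<lambda>a x b. split_sum (\<lambda>c y e.
        split_sum (\<lambda>p x' q. split_sum (\<lambda>c1 z c2. X a x b c1 z c2 y e p x' q) c) u +
        split_sum (\<lambda>p x' q. split_sum (\<lambda>b1 z b2. Y a x b1 z b2 c y e p x' q) b) u) w) v"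
    by (rule split_sum_cong, rule split_sum_cong, rule step)
  also have "\<dots> = split_sum (\<lambda>a x b. split_sum (\<lambda>c y e.
        split_sum (\<lambda>p x' q. split_sum (\<lambda>c1 z c2. X a x b c1 z c2 y e p x' q) c) u) w) v +
      split_sum (\<lambda>a x b. split_sum (\<lambda>c y e.
        split_sum (\<lambda>p x' q. split_sum (\<lambda>b1 z b2. Y a x b1 z b2 c y e p x' q) b) u) w) v"
    unfolding split_sum_add ..
  also have "split_sum (\<lambda>a x b. split_sum (\<lambda>c y e.
        split_sum (\<lambda>p x' q. split_sum (\<lambda>c1 z c2. X a x b c1 z c2 y e p x' q) c) u) w) v =
      marked_sum u v w jterm1"
  proof -
    have "split_sum (\<lambda>a x b. split_sum (\<lambda>c y e.
          split_sum (\<lambda>p x' q. split_sum (\<lambda>c1 z c2. X a x b c1 z c2 y e p x' q) c) u) w) v =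
        split_sum (\<lambda>c y e. split_sum (\<lambda>a x b.
          split_sum (\<lambda>p x' q. split_sum (\<lambda>c1 z c2. X a x b c1 z c2 y e p x' q) c) u) v) w"
      by (rule split_sum_swap)
    also have "\<dots> = split_sum (\<lambda>c y e. split_sum (\<lambda>c1 z c2.
          split_sum (\<lambda>p x' q. split_sum (\<lambda>a x b. X a x b c1 z c2 y e p x' q) v) u) c) w"
      by (rule split_sum_cong, rule split_sum_reverse)
    also have "\<dots> = split_sum (\<lambda>c1 z r. split_sum (\<lambda>c2 y e.
          split_sum (\<lambda>p x' q. split_sum (\<lambda>a x b. X a x b c1 z c2 y e p x' q) v) u) r) w"
      by (rule split_sum_nested)
    finally show ?thesis
      unfolding marked_sum_def X_def jterm1_def .
  qed
  also have "split_sum (\<lambda>a x b. split_sum (\<lambda>c y e.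
        split_sum (\<lambda>p x' q. split_sum (\<lambda>b1 z b2. Y a x b1 z b2 c y e p x' q) b) u) w) v =
      marked_sum w u v jterm2"
  proof -
    have "split_sum (\<lambda>a x b. split_sum (\<lambda>c y e.
          split_sum (\<lambda>p x' q. split_sum (\<lambda>b1 z b2. Y a x b1 z b2 c y e p x' q) b) u) w) v =
        split_sum (\<lambda>a x b. split_sum (\<lambda>c y e.
          split_sum (\<lambda>b1 z b2. split_sum (\<lambda>p x' q. Y a x b1 z b2 c y e p x' q) u) b) w) v"
      by (rule split_sum_cong, rule split_sum_cong, rule split_sum_swap)
    also have "\<dots> = split_sum (\<lambda>a x b. split_sum (\<lambda>b1 z b2.
          split_sum (\<lambda>c y e. split_sum (\<lambda>p x' q. Y a x b1 z b2 c y e p x' q) u) w) b) v"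
      by (rule split_sum_cong, rule split_sum_swap)
    finally show ?thesis
      unfolding marked_sum_def Y_def jterm2_def append_assoc .
  qed
  finally show ?thesis .
qed

text \<open>
  The part \<open>P\<close> of each of the three expressions cancels against the part \<open>Q\<close> of the next one, in
  cyclic order.
\<close>

lemma jacobi_word:
  assumes u: "u \<in> nzl C" and v: "v \<in> nzl C" and w: "w \<in> nzl C"
  shows "cobar.brL (word C u) (bwords v w)
    + tscale (ksign ((wd u + N) * (wd v + wd w))) (cobar.\<sigma> (cobar.brL (word C v) (bwords w u)))
    + tscale (ksign ((wd w + N) * (wd u + wd v))) (cobar.\<sigma>' (cobar.brL (word C w) (bwords u v))) = 0"
proof -
  note h = nzl_homog[OF u] nzl_homog[OF v] nzl_homog[OF w]
  let ?s = "ksign ((wd u + N) * (wd v + wd w)) :: 'k" and ?r = "ksign ((wd w + N) * (wd u + wd v)) :: 'k"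
  let ?q = "ksign ((wd v + N) * (wd w + wd u)) :: 'k"
  define P1 Q1 where "P1 = marked_sum u v w jterm1" and "Q1 = marked_sum u v w jterm2"
  define P2 Q2 where "P2 = marked_sum v w u jterm1" and "Q2 = marked_sum v w u jterm2"
  define P3 Q3 where "P3 = marked_sum w u v jterm1" and "Q3 = marked_sum w u v jterm2"
  note M = marked_sum_jterm_tens3
  have t3: "P1 \<in> tens3 (cobar C)" "Q1 \<in> tens3 (cobar C)" "P2 \<in> tens3 (cobar C)" "Q2 \<in> tens3 (cobar C)"
    "P3 \<in> tens3 (cobar C)" "Q3 \<in> tens3 (cobar C)"
    unfolding P1_def P2_def P3_def Q1_def Q2_def Q3_def by (intro M h)+
  then have t: "P1 \<in> tens (cobar C)" "Q1 \<in> tens (cobar C)" "P2 \<in> tens (cobar C)" "Q2 \<in> tens (cobar C)"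
    "P3 \<in> tens (cobar C)" "Q3 \<in> tens (cobar C)"
    using tens3_tens by blast+
  note S = cobar.tensor_perm_linear_on(1) and S' = cobar.tensor_perm_linear_on(2)
  have c1: "tscale ?s (cobar.\<sigma> Q1) = - P1"
    unfolding P1_def Q1_def by (rule jacobi_cancel[OF u v w])
  have c2: "tscale ?q (cobar.\<sigma> Q2) = - P2"
    unfolding P2_def Q2_def by (rule jacobi_cancel[OF v w u])
  have c3: "tscale ?r (cobar.\<sigma> Q3) = - P3"
    unfolding P3_def Q3_def by (rule jacobi_cancel[OF w u v])
  \<comment> \<open>Two rotations of the identity by one step have the weight of one rotation by two steps.\<close>
  have sq: "?r = ?s * ?q"
    unfolding ksign_add[symmetric] by (rule ksign_cong) (simp add: algebra_simps)
  have T: "cobar.\<sigma> Q \<in> tens (cobar C)" if "Q \<in> tens (cobar C)" for Q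
    using cobar.tensor_perm_in_tens(1)[OF that] .
  have neg: "- P = tscale (- 1) P" for P :: "('k, ('k, 'v) tensor) tensor"
    by (simp only: TS.scale_minus_left TS.scale_one)
  have "cobar.\<sigma> P2 = cobar.\<sigma> (tscale (- ?q) (cobar.\<sigma> Q2))"
    using c2 by (simp only: TS.scale_minus_left minus_minus)
  also have "\<dots> = tscale (- ?q) (cobar.\<sigma>' Q2)"
    by (simp only: linear_on_scale[OF S T[OF t(4)]] cobar.tensor_perm_compose(1)[OF t3(4)])
  finally have d2: "tscale ?s (cobar.\<sigma> P2) = - tscale ?r (cobar.\<sigma>' Q2)"
    by (simp only: sq TS.scale_scale mult_minus_right TS.scale_minus_left TS.scale_minus_right)
  have "cobar.\<sigma>' P3 = cobar.\<sigma>' (tscale (- ?r) (cobar.\<sigma> Q3))"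
    using c3 by (simp only: TS.scale_minus_left minus_minus)
  also have "\<dots> = tscale (- ?r) Q3"
    by (simp only: linear_on_scale[OF S' T[OF t(6)]] cobar.tensor_perm_compose(2)[OF t3(6)])
  finally have d3: "tscale ?r (cobar.\<sigma>' P3) = - Q3"
    by (simp only: TS.scale_scale mult_minus_right ksign_square TS.scale_minus_left TS.scale_minus_right TS.scale_one)
  have b: "cobar.brL (word C u) (bwords v w) = P1 + Q3" "cobar.brL (word C v) (bwords w u) = P2 + Q1"
    "cobar.brL (word C w) (bwords u v) = P3 + Q2"
    unfolding P1_def P2_def P3_def Q1_def Q2_def Q3_def using brL_bwords h by blast+
  have cancel: "p + q + (- r + - p) + (- q + r) = 0" for p q r :: "'q::ab_group_add"
    by (simp add: algebra_simps)
  show ?thesis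
    unfolding b linear_on_add[OF S t(3,2)] linear_on_add[OF S' t(5,4)] TS.scale_right_distrib c1 d2 d3
    by (rule cancel)
qed

lemma brk_jacobi:
  assumes p: "p \<in> hcomp (tensor_algebra (desusp C)) i" and q: "q \<in> hcomp (tensor_algebra (desusp C)) j"
    and r: "r \<in> hcomp (tensor_algebra (desusp C)) l"
  shows "cobar.brL p (brk q r)
    + tscale (ksign ((i + N) * (j + l))) (cobar.\<sigma> (cobar.brL q (brk r p)))
    + tscale (ksign ((l + N) * (i + j))) (cobar.\<sigma>' (cobar.brL r (brk p q))) = 0"
proof -
  note L = cobar.brL_linear_on[unfolded carr_cobar] and Lp = cobar.brL_param[unfolded carr_cobar cobar_simps]
    and Lt = cobar.brL_tens[unfolded carr_cobar]
  note S = cobar.tensor_perm_linear_on(1) and S' = cobar.tensor_perm_linear_on(2)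
  have left1: "linear_on tscale tscale (tens C) (\<lambda>p. cobar.brL a (brk p b))"
    if "a \<in> tens C" "b \<in> tens C" for a b
    by (rule linear_on_compose[OF brk_left[OF that(2)] brk_tens[OF _ that(2)] L[OF that(1)]])
  have left2: "linear_on tscale tscale (tens C) (\<lambda>p. cobar.brL a (brk b p))"
    if "a \<in> tens C" "b \<in> tens C" for a b
    by (rule linear_on_compose[OF brk_right[OF that(2)] brk_tens[OF that(2)] L[OF that(1)]])
  have left3: "linear_on tscale tscale (tens C) (\<lambda>p. cobar.brL p (brk a b))"
    if "a \<in> tens C" "b \<in> tens C" for a b
    by (rule Lp[OF brk_tens[OF that]])
  have J: "cobar.brL a (brk b c) \<in> tens (cobar C)" if "a \<in> tens C" "b \<in> tens C" "c \<in> tens C" for a b c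
    using that by (intro Lt brk_tens)
  let ?J = "\<lambda>p q r. cobar.brL p (brk q r)
    + tscale (ksign ((i + N) * (j + l))) (cobar.\<sigma> (cobar.brL q (brk r p)))
    + tscale (ksign ((l + N) * (i + j))) (cobar.\<sigma>' (cobar.brL r (brk p q)))"
  have J1: "linear_on tscale tscale (tens C) (\<lambda>p. ?J p q r)" if "q \<in> tens C" "r \<in> tens C" for q r
    by (intro linear_on_plus[OF vsT] linear_on_scaled[OF vsT] left1 left2 left3 that
        linear_on_compose[OF left2[OF that] J[OF that] S]
        linear_on_compose[OF left1[OF that(2,1)] J[OF that(2) _ that(1)] S'])
  have J2: "linear_on tscale tscale (tens C) (\<lambda>q. ?J p q r)" if "p \<in> tens C" "r \<in> tens C" for p r
    by (intro linear_on_plus[OF vsT] linear_on_scaled[OF vsT] left1 left2 left3 that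
        linear_on_compose[OF left3[OF that(2,1)] J[OF _ that(2,1)] S]
        linear_on_compose[OF left2[OF that(2,1)] J[OF that(2,1)] S'])
  have J3: "linear_on tscale tscale (tens C) (\<lambda>r. ?J p q r)" if "p \<in> tens C" "q \<in> tens C" for p q
    by (intro linear_on_plus[OF vsT] linear_on_scaled[OF vsT] left1 left2 left3 that
        linear_on_compose[OF left1[OF that(2,1)] J[OF that(2) _ that(1)] S]
        linear_on_compose[OF left3[OF that] J[OF _ that] S'])
  show ?thesis
  proof (rule words_eqI3[OF J1 _ J2 _ J3 _ _ p q r])
    fix u v w assume nz: "u \<in> nzl C" "v \<in> nzl C" "w \<in> nzl C" and d: "wd u = i" "wd v = j" "wd w = l"
    show "?J (word C u) (word C v) (word C w) = 0"
      using jacobi_word[OF nz] nz[THEN nzl_homog] by (simp only: brk_word d)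
  qed (rule linear_on_const0[OF vsT] | assumption)+
qed

lemma double_poisson_cobar: "double_poisson_algebra (cobar C) N brk"
proof (intro double_poisson_algebra.intro double_poisson_algebra_axioms.intro double_bracket_cobar)
  fix p q r i j l
  assume "p \<in> hcomp (cobar C) i" "q \<in> hcomp (cobar C) j" "r \<in> hcomp (cobar C) l"
  then have h: "p \<in> hcomp (tensor_algebra (desusp C)) i" "q \<in> hcomp (tensor_algebra (desusp C)) j"
    "r \<in> hcomp (tensor_algebra (desusp C)) l"
    by simp_all
  then have c: "p \<in> carr (cobar C)" "q \<in> carr (cobar C)" "r \<in> carr (cobar C)"
    by (simp_all add: hcomp_tens)
  show "bracket_L (cobar C) brk p (brk q r)
      + tscale (ksign ((i + N) * (j + l))) (cobar.\<sigma> (bracket_L (cobar C) brk q (brk r p)))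
      + tscale (ksign ((l + N) * (i + j))) (cobar.\<sigma>' (bracket_L (cobar C) brk r (brk p q))) = 0"
    using brk_jacobi[OF h] cobar.bracket_L_eq[OF c(1) brk_hcomp[OF h(2,3)]]
      cobar.bracket_L_eq[OF c(2) brk_hcomp[OF h(3,1)]] cobar.bracket_L_eq[OF c(3) brk_hcomp[OF h(1,2)]]
    by (simp only:)
qed

end

theorem theorem15:
  fixes C :: "('k::field_char_0, 'v::ab_group_add) cyclic_dgcoalg" and n :: int
  assumes "cyclic_dg_coalgebra n C"
  shows "double_poisson_algebra (cobar C) (n + 2) (cobar_bracket n C)"
  using assms by (rule cyclic_dg_coalgebra.double_poisson_cobar)

end
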